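(* Let $G=Aff(\mathbb{R})$ be the Lie group of affine transformations of the real line and let $\nabla^+$ be any flat left invariant affine structure on $G$. Then the Lie group $Aff(G,\nabla^+)$ is a flat affine Lie group.
   Context: $Aff(\mathbb{R})=\mathbb{R}^*\times\mathbb{R}$ with product $(a,b)(c,d)=(ac,ad+b)$. A flat left invariant affine structure on a Lie group is a flat, torsion free, left invariant linear connection; a flat affine Lie group is a Lie group endowed with (admitting) such a structure. $Aff(G,\nabla^+)$ is the Lie group (under composition, with the compact-open topology) of all diffeomorphisms of $G$ preserving $\nabla^+$. *)

theory Defs
  imports "HOL-Analysis.Analysis" "HOL-Algebra.Bij" "HOL-Library.Function_Algebras"
begin

section \<open>Smooth functions on open subsets of Euclidean space\<close>

text \<open>
  The dimension of the Lie group of affine transformations depends on the connection, so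
  dimensions are natural numbers and not types: points of Euclidean \<open>n\<close>-space are the elements
  of \<^const>\<open>Euclidean_space\<close> \<open>n\<close>, i.e. sequences vanishing from index \<open>n\<close> on.
\<close>

definition partial :: "nat \<Rightarrow> ((nat \<Rightarrow> real) \<Rightarrow> real) \<Rightarrow> (nat \<Rightarrow> real) \<Rightarrow> real" where
  "partial i f x = deriv (\<lambda>t. f (x(i := t))) (x i)"

text \<open>\<open>S\<close> is meant to be open in \<^const>\<open>Euclidean_space\<close> \<open>n\<close>.\<close>

primrec C_k_on :: "nat \<Rightarrow> nat \<Rightarrow> (nat \<Rightarrow> real) set \<Rightarrow> ((nat \<Rightarrow> real) \<Rightarrow> real) \<Rightarrow> bool" where
  "C_k_on 0 n S f \<longleftrightarrow> continuous_map (subtopology (Euclidean_space n) S) euclideanreal f"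
| "C_k_on (Suc k) n S f \<longleftrightarrow>
     continuous_map (subtopology (Euclidean_space n) S) euclideanreal f \<and>
     (\<forall>i<n. (\<forall>x\<in>S. (\<lambda>t. f (x(i := t))) field_differentiable (at (x i))) \<and>
            C_k_on k n S (partial i f))"

definition C_inf_on :: "nat \<Rightarrow> (nat \<Rightarrow> real) set \<Rightarrow> ((nat \<Rightarrow> real) \<Rightarrow> real) \<Rightarrow> bool" where
  "C_inf_on n S f \<longleftrightarrow> (\<forall>k. C_k_on k n S f)"


section \<open>Smooth manifolds and smooth maps\<close>

type_synonym 'a chart = "'a set \<times> ('a \<Rightarrow> nat \<Rightarrow> real)"

record 'a manifold =
  mdim :: nat
  mtop :: "'a topology"
  matlas :: "'a chart set"

abbreviation points :: "'a manifold \<Rightarrow> 'a set" where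
  "points M \<equiv> topspace (mtop M)"

definition is_chart :: "nat \<Rightarrow> 'a topology \<Rightarrow> 'a set \<Rightarrow> ('a \<Rightarrow> nat \<Rightarrow> real) \<Rightarrow> bool" where
  "is_chart n T U \<phi> \<longleftrightarrow>
     openin T U \<and> openin (Euclidean_space n) (\<phi> ` U) \<and>
     homeomorphic_map (subtopology T U) (subtopology (Euclidean_space n) (\<phi> ` U)) \<phi>"

text \<open>The atlas need not be maximal; it determines a unique maximal one.\<close>

definition smooth_manifold :: "'a manifold \<Rightarrow> bool" where
  "smooth_manifold M \<longleftrightarrow>
     Hausdorff_space (mtop M) \<and> second_countable (mtop M) \<and>
     (\<forall>(U, \<phi>) \<in> matlas M. is_chart (mdim M) (mtop M) U \<phi>) \<and>
     (\<Union>(U, \<phi>) \<in> matlas M. U) = points M \<and>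
     (\<forall>(U, \<phi>) \<in> matlas M. \<forall>(V, \<psi>) \<in> matlas M. \<forall>i < mdim M.
        C_inf_on (mdim M) (\<phi> ` (U \<inter> V)) (\<lambda>x. \<psi> (inv_into U \<phi> x) i))"

definition smooth_map :: "'a manifold \<Rightarrow> 'b manifold \<Rightarrow> ('a \<Rightarrow> 'b) \<Rightarrow> bool" where
  "smooth_map M N f \<longleftrightarrow>
     continuous_map (mtop M) (mtop N) f \<and>
     (\<forall>(U, \<phi>) \<in> matlas M. \<forall>(V, \<psi>) \<in> matlas N. \<forall>i < mdim N.
        C_inf_on (mdim M) (\<phi> ` (U \<inter> f -` V)) (\<lambda>x. \<psi> (f (inv_into U \<phi> x)) i))"

definition product_chart :: "nat \<Rightarrow> ('a \<Rightarrow> nat \<Rightarrow> real) \<Rightarrow> ('b \<Rightarrow> nat \<Rightarrow> real) \<Rightarrow> 'a \<times> 'b \<Rightarrow> nat \<Rightarrow> real"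
  where "product_chart m \<phi> \<psi> = (\<lambda>(x, y) i. if i < m then \<phi> x i else \<psi> y (i - m))"

definition product_manifold :: "'a manifold \<Rightarrow> 'b manifold \<Rightarrow> ('a \<times> 'b) manifold" where
  "product_manifold M N =
     \<lparr>mdim = mdim M + mdim N,
      mtop = prod_topology (mtop M) (mtop N),
      matlas = {(U \<times> V, product_chart (mdim M) \<phi> \<psi>) | U \<phi> V \<psi>.
                  (U, \<phi>) \<in> matlas M \<and> (V, \<psi>) \<in> matlas N}\<rparr>"

text \<open>
  Self-maps of \<open>M\<close> are taken in \<^const>\<open>Bij\<close>, i.e. with a fixed value outside the points of \<open>M\<close>,
  so that equality of functions is equality of maps on \<open>M\<close>.
\<close>

definition diffeo :: "'a manifold \<Rightarrow> ('a \<Rightarrow> 'a) \<Rightarrow> bool" where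
  "diffeo M \<phi> \<longleftrightarrow> \<phi> \<in> Bij (points M) \<and> smooth_map M M \<phi> \<and> smooth_map M M (inv_into (points M) \<phi>)"


section \<open>Vector fields and linear connections\<close>

text \<open>
  Real functions on \<open>M\<close> are extended by 0 outside the points of \<open>M\<close>, which makes them closed
  under the pointwise operations.  The constant 1 is the indicator function of the points.
\<close>

definition smooth_funs :: "'a manifold \<Rightarrow> ('a \<Rightarrow> real) set" where
  "smooth_funs M =
     {f. (\<forall>(U, \<phi>) \<in> matlas M. C_inf_on (mdim M) (\<phi> ` U) (\<lambda>x. f (inv_into U \<phi> x))) \<and>
         (\<forall>p. p \<notin> points M \<longrightarrow> f p = 0)}"

text \<open>
  A smooth vector field is a derivation of the algebra of smooth functions.  The last clause only
  fixes the value at arguments outside that algebra, so that equality of functions is equality of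
  derivations.
\<close>

type_synonym 'a vfield = "('a \<Rightarrow> real) \<Rightarrow> 'a \<Rightarrow> real"

definition vfields :: "'a manifold \<Rightarrow> 'a vfield set" where
  "vfields M =
     {X. (\<forall>f \<in> smooth_funs M. X f \<in> smooth_funs M) \<and>
         (\<forall>f \<in> smooth_funs M. \<forall>g \<in> smooth_funs M. X (f + g) = X f + X g) \<and>
         (\<forall>c. \<forall>f \<in> smooth_funs M. X (\<lambda>p. c * f p) = (\<lambda>p. c * X f p)) \<and>
         (\<forall>f \<in> smooth_funs M. \<forall>g \<in> smooth_funs M. X (f * g) = f * X g + g * X f) \<and>
         (\<forall>f. f \<notin> smooth_funs M \<longrightarrow> X f = 0)}"

definition fscale :: "('a \<Rightarrow> real) \<Rightarrow> 'a vfield \<Rightarrow> 'a vfield" where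
  "fscale f X = (\<lambda>h. f * X h)"

definition lie_bracket :: "'a vfield \<Rightarrow> 'a vfield \<Rightarrow> 'a vfield" where
  "lie_bracket X Y = (\<lambda>f. X (Y f) - Y (X f))"

text \<open>
  Linearity over the reals in the second argument is additivity together with the Leibniz rule
  for constant \<open>f\<close>.
\<close>

definition linear_connection :: "'a manifold \<Rightarrow> ('a vfield \<Rightarrow> 'a vfield \<Rightarrow> 'a vfield) \<Rightarrow> bool" where
  "linear_connection M D \<longleftrightarrow>
     (\<forall>X \<in> vfields M. \<forall>Y \<in> vfields M. D X Y \<in> vfields M) \<and>
     (\<forall>X \<in> vfields M. \<forall>X' \<in> vfields M. \<forall>Y \<in> vfields M. D (X + X') Y = D X Y + D X' Y) \<and>
     (\<forall>f \<in> smooth_funs M. \<forall>X \<in> vfields M. \<forall>Y \<in> vfields M.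
        D (fscale f X) Y = fscale f (D X Y)) \<and>
     (\<forall>X \<in> vfields M. \<forall>Y \<in> vfields M. \<forall>Y' \<in> vfields M. D X (Y + Y') = D X Y + D X Y') \<and>
     (\<forall>f \<in> smooth_funs M. \<forall>X \<in> vfields M. \<forall>Y \<in> vfields M.
        D X (fscale f Y) = fscale (X f) Y + fscale f (D X Y))"

definition torsion_free :: "'a manifold \<Rightarrow> ('a vfield \<Rightarrow> 'a vfield \<Rightarrow> 'a vfield) \<Rightarrow> bool" where
  "torsion_free M D \<longleftrightarrow>
     (\<forall>X \<in> vfields M. \<forall>Y \<in> vfields M. D X Y - D Y X - lie_bracket X Y = 0)"

definition flat :: "'a manifold \<Rightarrow> ('a vfield \<Rightarrow> 'a vfield \<Rightarrow> 'a vfield) \<Rightarrow> bool" where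
  "flat M D \<longleftrightarrow>
     (\<forall>X \<in> vfields M. \<forall>Y \<in> vfields M. \<forall>Z \<in> vfields M.
        D X (D Y Z) - D Y (D X Z) - D (lie_bracket X Y) Z = 0)"

definition pull_fun :: "'a manifold \<Rightarrow> ('a \<Rightarrow> 'a) \<Rightarrow> ('a \<Rightarrow> real) \<Rightarrow> 'a \<Rightarrow> real" where
  "pull_fun M \<phi> f = (\<lambda>p. if p \<in> points M then f (\<phi> p) else 0)"

definition push_field :: "'a manifold \<Rightarrow> ('a \<Rightarrow> 'a) \<Rightarrow> 'a vfield \<Rightarrow> 'a vfield" where
  "push_field M \<phi> X =
     (\<lambda>f. if f \<in> smooth_funs M
          then pull_fun M (inv_into (points M) \<phi>) (X (pull_fun M \<phi> f)) else 0)"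

definition preserves_connection ::
    "'a manifold \<Rightarrow> ('a vfield \<Rightarrow> 'a vfield \<Rightarrow> 'a vfield) \<Rightarrow> ('a \<Rightarrow> 'a) \<Rightarrow> bool" where
  "preserves_connection M D \<phi> \<longleftrightarrow>
     (\<forall>X \<in> vfields M. \<forall>Y \<in> vfields M.
        push_field M \<phi> (D X Y) = D (push_field M \<phi> X) (push_field M \<phi> Y))"


section \<open>Flat affine Lie groups\<close>

definition lie_group :: "'a monoid \<Rightarrow> 'a manifold \<Rightarrow> bool" where
  "lie_group G M \<longleftrightarrow>
     group G \<and> smooth_manifold M \<and> points M = carrier G \<and>
     smooth_map (product_manifold M M) M (\<lambda>(x, y). x \<otimes>\<^bsub>G\<^esub> y) \<and>
     smooth_map M M (\<lambda>x. inv\<^bsub>G\<^esub> x)"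

definition left_translation :: "'a monoid \<Rightarrow> 'a \<Rightarrow> 'a \<Rightarrow> 'a" where
  "left_translation G g = (\<lambda>x \<in> carrier G. g \<otimes>\<^bsub>G\<^esub> x)"

definition flat_left_invariant_affine_structure ::
    "'a monoid \<Rightarrow> 'a manifold \<Rightarrow> ('a vfield \<Rightarrow> 'a vfield \<Rightarrow> 'a vfield) \<Rightarrow> bool" where
  "flat_left_invariant_affine_structure G M D \<longleftrightarrow>
     linear_connection M D \<and> flat M D \<and> torsion_free M D \<and>
     (\<forall>g \<in> carrier G. preserves_connection M D (left_translation G g))"

definition flat_affine_lie_group :: "'a monoid \<Rightarrow> 'a manifold \<Rightarrow> bool" where
  "flat_affine_lie_group G M \<longleftrightarrow>
     lie_group G M \<and> (\<exists>D. flat_left_invariant_affine_structure G M D)"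


section \<open>The group of affine transformations of a connection\<close>

definition affine_transformations ::
    "'a manifold \<Rightarrow> ('a vfield \<Rightarrow> 'a vfield \<Rightarrow> 'a vfield) \<Rightarrow> ('a \<Rightarrow> 'a) set" where
  "affine_transformations M D = {\<phi>. diffeo M \<phi> \<and> preserves_connection M D \<phi>}"

definition affine_group ::
    "'a manifold \<Rightarrow> ('a vfield \<Rightarrow> 'a vfield \<Rightarrow> 'a vfield) \<Rightarrow> ('a \<Rightarrow> 'a) monoid" where
  "affine_group M D = (BijGroup (points M))\<lparr>carrier := affine_transformations M D\<rparr>"

definition compact_open_topology :: "'a topology \<Rightarrow> 'b topology \<Rightarrow> ('a \<Rightarrow> 'b) topology" where
  "compact_open_topology S T =
     topology_generated_by
       {{f \<in> extensional (topspace S). continuous_map S T f \<and> f ` K \<subseteq> U} | K U.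
          compactin S K \<and> openin T U}"

definition affine_group_topology ::
    "'a manifold \<Rightarrow> ('a vfield \<Rightarrow> 'a vfield \<Rightarrow> 'a vfield) \<Rightarrow> ('a \<Rightarrow> 'a) topology" where
  "affine_group_topology M D =
     subtopology (compact_open_topology (mtop M) (mtop M)) (affine_transformations M D)"


section \<open>The Lie group of affine transformations of the real line\<close>

definition Aff_line :: "(real \<times> real) monoid" where
  "Aff_line =
     \<lparr>carrier = {(a, b). a \<noteq> 0},
      mult = (\<lambda>(a, b) (c, d). (a * c, a * d + b)),
      one = (1, 0)\<rparr>"

definition Aff_line_manifold :: "(real \<times> real) manifold" where
  "Aff_line_manifold =
     \<lparr>mdim = 2,
      mtop = top_of_set {(a, b). a \<noteq> 0},
      matlas = {({(a, b). a \<noteq> 0}, \<lambda>(a, b) i. if i = 0 then a else if i = 1 then b else 0)}\<rparr>"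

end

theory Submission
  imports Defs
begin

text \<open>
  Let \<open>E 0 = a \<partial>/\<partial>a\<close> and \<open>E 1 = a \<partial>/\<partial>b\<close> be the left invariant frame of the affine group, so that
  \<open>[E 0, E 1] = E 1\<close>.  A flat left invariant connection is a left symmetric product on the Lie algebra
  spanned by the frame; flatness and vanishing torsion are polynomial equations for its eight
  structure constants, and their solution (\<open>developing_pair_exists\<close>) shows that the half plane
  \<open>a > 0\<close> has two globally defined affine coordinate functions which map it diffeomorphically onto
  one of three kinds of domains \<open>\<Omega>\<close>: the plane, a half plane, or one side of a parabola.  The other
  component of the group is a left translate, so it has the same developing image.

  A diffeomorphism preserves the connection if and only if it pulls affine functions back to affine
  functions, and on each component the affine functions are spanned by \<open>1\<close> and the two
  coordinates.  Hence an affine transformation of the group is a permutation of its two components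
  together with two affine maps of the plane, one for each component, that preserve \<open>\<Omega>\<close>
  (\<open>affine_transformations_eq\<close>).

  The affine maps that preserve \<open>\<Omega>\<close> form a group of dimension 6, 4 or 2, on which some of the matrix
  entries serve as global coordinates.  Thus the group of affine transformations consists of two
  sheets, each a copy of an open subset of Euclidean space of dimension 12, 8 or 4.  These charts are
  homeomorphisms for the compact-open topology: a transformation is recovered continuously from its
  values at finitely many points, and conversely it depends continuously on its coordinates, uniformly on
  compact sets, by the tube lemma.

  In all three cases the entries of a product of matrices that serve as coordinates are affine
  functions of the coordinates of the right factor.  So left translations are affine maps in these
  coordinates, and the standard flat connection of Euclidean space is left invariant
  (\<open>flat_affine_HG\<close>).

  Vector fields are given as derivations.  That they are determined by their components
  (\<open>vf_expand\<close>) is Hadamard's lemma, multiplied by a bump function because derivations act on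
  globally defined functions.
\<close>

section \<open>Calculus of smooth functions\<close>

declare C_k_on.simps [simp del]

abbreviation Eset :: "nat \<Rightarrow> (nat \<Rightarrow> real) set" where
  "Eset n \<equiv> {x. \<forall>i\<ge>n. x i = 0}"

lemma Euclidean_space_top_of_set: "Euclidean_space n = top_of_set (Eset n)"
  by (simp add: Euclidean_space_def euclidean_product_topology)

lemma openin_Euclidean_subset: "openin (Euclidean_space n) S \<Longrightarrow> S \<subseteq> Eset n"
  by (metis openin_subset topspace_Euclidean_space)

lemma subtopology_Euclidean_eq:
  assumes "openin (Euclidean_space n) S"
  shows "subtopology (Euclidean_space n) S = top_of_set S"
  using openin_Euclidean_subset[OF assms]
  by (simp add: Euclidean_space_top_of_set subtopology_subtopology Int_absorb1)

lemma C_0_iff: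
  assumes "openin (Euclidean_space n) S"
  shows "C_k_on 0 n S f \<longleftrightarrow> continuous_on S f"
  by (simp only: C_k_on.simps subtopology_Euclidean_eq[OF assms] continuous_map_iff_continuous)

lemma C_k_continuous:
  assumes "openin (Euclidean_space n) S" "C_k_on k n S f"
  shows "continuous_on S f"
proof -
  have "continuous_map (subtopology (Euclidean_space n) S) euclideanreal f"
    using assms(2) by (cases k) (auto simp only: C_k_on.simps)
  then show ?thesis
    by (simp only: subtopology_Euclidean_eq[OF assms(1)] continuous_map_iff_continuous)
qed

lemma openin_Euclidean_preimage:
  assumes "openin (Euclidean_space n) S" "continuous_on S f" "open T"
  shows "openin (Euclidean_space n) {x \<in> S. f x \<in> T}"
proof -
  have "openin (top_of_set S) (S \<inter> f -` T)"
    using assms(2,3) continuous_openin_preimage_gen by blast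
  then have "openin (Euclidean_space n) (S \<inter> f -` T)"
    using assms(1) openin_trans unfolding Euclidean_space_top_of_set by blast
  then show ?thesis by (simp add: vimage_def Int_def)
qed

lemma continuous_on_fun_upd: "continuous_on UNIV (\<lambda>t. (x::nat \<Rightarrow> real)(i := t))"
proof (rule continuous_on_coordinatewise_then_product)
  show "continuous_on UNIV (\<lambda>t. (x(i := t)) j)" for j
    by (cases "j = i") (simp_all add: continuous_on_id continuous_on_const)
qed

lemma eventually_line_in_open:
  assumes S: "openin (Euclidean_space n) S" and x: "x \<in> S" and i: "i < n"
  shows "eventually (\<lambda>t. x(i := t) \<in> S) (nhds (x i))"
proof -
  obtain U where U: "open U" "S = Eset n \<inter> U"
    using S unfolding Euclidean_space_top_of_set openin_open by blast
  have "open ((\<lambda>t. x(i := t)) -` U)"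
    using continuous_on_open_vimage[OF open_UNIV, of "\<lambda>t. x(i := t)"] continuous_on_fun_upd U(1)
    by auto
  moreover have "x i \<in> (\<lambda>t. x(i := t)) -` U" using x U by simp
  ultimately have "eventually (\<lambda>t. t \<in> (\<lambda>t. x(i := t)) -` U) (nhds (x i))"
    by (rule eventually_nhds_in_open)
  then show ?thesis by eventually_elim (use x U i in auto)
qed

lemma partial_eqI:
  "((\<lambda>t. f (x(i := t))) has_field_derivative d) (at (x i)) \<Longrightarrow> partial i f x = d"
  by (simp add: partial_def DERIV_imp_deriv)

lemma has_partial_cong:
  assumes S: "openin (Euclidean_space n) S" and x: "x \<in> S" and i: "i < n"
    and eq: "\<And>y. y \<in> S \<Longrightarrow> f y = g y"
  shows "((\<lambda>t. f (x(i := t))) has_field_derivative d) (at (x i)) \<longleftrightarrow>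
         ((\<lambda>t. g (x(i := t))) has_field_derivative d) (at (x i))"
  by (rule DERIV_cong_ev)
     (use eventually_line_in_open[OF S x i] eq in \<open>auto elim: eventually_mono\<close>)

lemma partial_cong:
  assumes "openin (Euclidean_space n) S" "x \<in> S" "i < n" "\<And>y. y \<in> S \<Longrightarrow> f y = g y"
  shows "partial i f x = partial i g x"
  using has_partial_cong[where f = f and g = g, OF assms] unfolding partial_def deriv_def by simp

lemma C_k_cong:
  assumes S: "openin (Euclidean_space n) S" and eq: "\<And>y. y \<in> S \<Longrightarrow> f y = g y"
    and f: "C_k_on k n S f"
  shows "C_k_on k n S g"
  using eq f
proof (induction k arbitrary: f g)
  case 0
  then show ?case using C_0_iff[OF S] by (metis continuous_on_eq)
next
  case (Suc k)
  have c: "continuous_on S g"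
    using C_k_continuous[OF S Suc.prems(2)] Suc.prems(1) by (metis continuous_on_eq)
  have d: "(\<lambda>t. g (x(i := t))) field_differentiable (at (x i))" if "i < n" "x \<in> S" for i x
  proof -
    have "(\<lambda>t. f (x(i := t))) field_differentiable (at (x i))"
      using Suc.prems(2) that by (simp add: C_k_on.simps)
    then show ?thesis
      using has_partial_cong[OF S that(2) that(1), of f g] Suc.prems(1)
      unfolding field_differentiable_def by metis
  qed
  have "C_k_on k n S (partial i g)" if i: "i < n" for i
  proof (rule Suc.IH[of "partial i f"])
    show "partial i f y = partial i g y" if "y \<in> S" for y
      using partial_cong[OF S that i] Suc.prems(1) by blast
    show "C_k_on k n S (partial i f)" using Suc.prems(2) i by (simp add: C_k_on.simps)
  qed
  then show ?case
    using c d by (simp only: C_k_on.simps subtopology_Euclidean_eq[OF S] continuous_map_iff_continuous) blast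
qed

lemma C_Suc_I:
  assumes S: "openin (Euclidean_space n) S" and c: "continuous_on S f"
    and d: "\<And>i x. i < n \<Longrightarrow> x \<in> S \<Longrightarrow> ((\<lambda>t. f (x(i := t))) has_field_derivative g i x) (at (x i))"
    and g: "\<And>i. i < n \<Longrightarrow> C_k_on k n S (g i)"
  shows "C_k_on (Suc k) n S f"
proof -
  have "C_k_on k n S (partial i f)" if i: "i < n" for i
  proof (rule C_k_cong[OF S _ g[OF i]])
    show "g i y = partial i f y" if "y \<in> S" for y
      using partial_eqI[of f y i, OF d[OF i that]] by simp
  qed
  then show ?thesis
    using c d
    by (auto simp only: C_k_on.simps subtopology_Euclidean_eq[OF S] continuous_map_iff_continuous
        field_differentiable_def)
qed

lemma C_Suc_D:
  assumes S: "openin (Euclidean_space n) S" and f: "C_k_on (Suc k) n S f" and i: "i < n"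
  shows "x \<in> S \<Longrightarrow> ((\<lambda>t. f (x(i := t))) has_field_derivative partial i f x) (at (x i))"
    and "C_k_on k n S (partial i f)"
  using f i by (auto simp: C_k_on.simps partial_def field_differentiable_derivI DERIV_deriv_iff_field_differentiable)

lemma C_k_Suc_imp: "openin (Euclidean_space n) S \<Longrightarrow> C_k_on (Suc k) n S f \<Longrightarrow> C_k_on k n S f"
proof (induction k arbitrary: f)
  case 0
  then show ?case using C_k_continuous C_0_iff by blast
next
  case (Suc k)
  show ?case
    by (rule C_Suc_I[OF Suc.prems(1) C_k_continuous[OF Suc.prems] C_Suc_D(1)[OF Suc.prems]])
       (use Suc.IH[OF Suc.prems(1) C_Suc_D(2)[OF Suc.prems]] in auto)
qed

lemma C_k_subset:
  assumes S: "openin (Euclidean_space n) S" and T: "openin (Euclidean_space n) T" and "T \<subseteq> S"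
  shows "C_k_on k n S f \<Longrightarrow> C_k_on k n T f"
proof (induction k arbitrary: f)
  case 0
  then show ?case using C_0_iff S T assms(3) by (metis continuous_on_subset)
next
  case (Suc k)
  show ?case
    by (rule C_Suc_I[OF T continuous_on_subset[OF C_k_continuous[OF S Suc.prems] assms(3)]])
       (use Suc.IH[OF C_Suc_D(2)[OF S Suc.prems]] C_Suc_D(1)[OF S Suc.prems] assms(3) in auto)
qed

lemma continuous_on_locally_smooth:
  assumes S: "openin (Euclidean_space n) S"
    and loc: "\<And>x. x \<in> S \<Longrightarrow> \<exists>T. openin (Euclidean_space n) T \<and> x \<in> T \<and> T \<subseteq> S \<and> C_k_on k n T f"
  shows "continuous_on S f"
proof -
  have "continuous (at x within S) f" if x: "x \<in> S" for x
  proof -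
    obtain T where T: "openin (Euclidean_space n) T" "x \<in> T" "T \<subseteq> S" "C_k_on k n T f"
      using loc[OF x] by blast
    obtain U where U: "open U" "T = Eset n \<inter> U"
      using T(1) unfolding Euclidean_space_top_of_set openin_open by blast
    have "S \<inter> U - {x} = T \<inter> U - {x}"
      using T(3) U(2) openin_Euclidean_subset[OF S] by blast
    then have "at x within T = at x within S"
      using at_within_nhd[of x U T S] U T(2) by auto
    then show ?thesis
      using T(2) C_k_continuous[OF T(1,4)] unfolding continuous_on_eq_continuous_within by metis
  qed
  then show ?thesis by (simp add: continuous_on_eq_continuous_within)
qed

text \<open>Smoothness is local, which is what lets a function be assembled from pieces.\<close>

lemma C_k_local:
  assumes S: "openin (Euclidean_space n) S"
    and loc: "\<And>x. x \<in> S \<Longrightarrow> \<exists>T. openin (Euclidean_space n) T \<and> x \<in> T \<and> T \<subseteq> S \<and> C_k_on k n T f"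
  shows "C_k_on k n S f"
  using loc
proof (induction k arbitrary: f)
  case 0
  have "continuous_on S f"
  by (rule continuous_on_locally_smooth[OF S 0])
  then show ?case using C_0_iff[OF S] by blast
next
  case (Suc k)
  have c: "continuous_on S f"
  by (rule continuous_on_locally_smooth[OF S Suc.prems])
  show ?case
  proof (rule C_Suc_I[OF S c])
    fix i x assume i: "i < n" and x: "x \<in> S"
    obtain T where "openin (Euclidean_space n) T" "x \<in> T" "C_k_on (Suc k) n T f"
      using Suc.prems[OF x] by blast
    then show "((\<lambda>t. f (x(i := t))) has_field_derivative partial i f x) (at (x i))"
      using C_Suc_D(1) i by simp
  next
    fix i assume i: "i < n"
    show "C_k_on k n S (partial i f)"
    proof (rule Suc.IH)
      fix x assume "x \<in> S"
      then obtain T where "openin (Euclidean_space n) T" "x \<in> T" "T \<subseteq> S" "C_k_on (Suc k) n T f"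
        using Suc.prems by blast
      then show "\<exists>T. openin (Euclidean_space n) T \<and> x \<in> T \<and> T \<subseteq> S \<and> C_k_on k n T (partial i f)"
        using C_Suc_D(2) i by metis
    qed
  qed
qed

lemma C_k_const: "openin (Euclidean_space n) S \<Longrightarrow> C_k_on k n S (\<lambda>x. c)"
proof (induction k arbitrary: c)
  case 0
  then show ?case by (simp add: C_0_iff)
next
  case (Suc k)
  show ?case
    by (rule C_Suc_I[where g = "\<lambda>i x. 0"]) (use Suc in \<open>auto intro!: continuous_intros\<close>)
qed

lemma C_k_coord:
  assumes S: "openin (Euclidean_space n) S"
  shows "C_k_on k n S (\<lambda>x. x j)"
proof (cases k)
  case 0
  have "continuous_on S (\<lambda>x. x j)"
    by (rule continuous_on_product_then_coordinatewise[OF continuous_on_id])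
  then show ?thesis using C_0_iff[OF S] 0 by simp
next
  case (Suc k)
  show ?thesis unfolding Suc
    by (rule C_Suc_I[where g = "\<lambda>i x. if i = j then 1 else 0", OF S])
       (auto intro!: derivative_eq_intros C_k_const S
         continuous_on_product_then_coordinatewise[OF continuous_on_id])
qed

lemma C_k_add:
  assumes S: "openin (Euclidean_space n) S"
  shows "C_k_on k n S f \<Longrightarrow> C_k_on k n S g \<Longrightarrow> C_k_on k n S (\<lambda>x. f x + g x)"
proof (induction k arbitrary: f g)
  case 0
  then show ?case using C_0_iff[OF S] by (metis continuous_on_add)
next
  case (Suc k)
  show ?case
    by (rule C_Suc_I[where g = "\<lambda>i x. partial i f x + partial i g x", OF S])
       (use Suc C_Suc_D[OF S] C_k_continuous[OF S]
        in \<open>auto intro!: derivative_intros continuous_on_add simp del: fun_upd_apply\<close>)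
qed

lemma C_k_mult:
  assumes S: "openin (Euclidean_space n) S"
  shows "C_k_on k n S f \<Longrightarrow> C_k_on k n S g \<Longrightarrow> C_k_on k n S (\<lambda>x. f x * g x)"
proof (induction k arbitrary: f g)
  case 0
  then show ?case using C_0_iff[OF S] by (metis continuous_on_mult)
next
  case (Suc k)
  show ?case
  proof (rule C_Suc_I[where g = "\<lambda>i x. partial i f x * g x + partial i g x * f x", OF S])
    show "continuous_on S (\<lambda>x. f x * g x)"
      using Suc.prems C_k_continuous[OF S] by (intro continuous_on_mult)
    show "C_k_on k n S (\<lambda>x. partial i f x * g x + partial i g x * f x)" if "i < n" for i
      using Suc.prems C_Suc_D(2)[OF S _ that] C_k_Suc_imp[OF S]
      by (intro C_k_add[OF S] Suc.IH) auto
  next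
    fix i x assume ix: "i < n" "x \<in> S"
    show "((\<lambda>t. f (x(i := t)) * g (x(i := t))) has_field_derivative
        partial i f x * g x + partial i g x * f x) (at (x i))"
      using DERIV_mult[OF C_Suc_D(1)[OF S Suc.prems(1) ix] C_Suc_D(1)[OF S Suc.prems(2) ix]]
      by (simp del: fun_upd_apply)
  qed
qed

lemma C_k_minus:
  "openin (Euclidean_space n) S \<Longrightarrow> C_k_on k n S f \<Longrightarrow> C_k_on k n S (\<lambda>x. - f x)"
  using C_k_mult[OF _ C_k_const[of n S k "-1"], of f] by simp

lemma C_k_diff:
  "openin (Euclidean_space n) S \<Longrightarrow> C_k_on k n S f \<Longrightarrow> C_k_on k n S g \<Longrightarrow> C_k_on k n S (\<lambda>x. f x - g x)"
  using C_k_add[of n S k f "\<lambda>x. - g x"] C_k_minus[of n S k g] by simp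

lemma C_k_sum:
  assumes S: "openin (Euclidean_space n) S" and f: "\<And>j. j \<in> J \<Longrightarrow> C_k_on k n S (f j)"
  shows "C_k_on k n S (\<lambda>x. \<Sum>j\<in>J. f j x)"
  using f by (induction J rule: infinite_finite_induct) (auto intro!: C_k_const C_k_add S)

text \<open>
  The derivative of an elementary function is expressed by the function itself, or, for the bump
  function below, by further members of a family.  The induction over the order of
  differentiability therefore has to run for all members at once.
\<close>

lemma C_k_compose_family:
  fixes h :: "'b \<Rightarrow> real \<Rightarrow> real"
  assumes S: "openin (Euclidean_space n) S"
    and J: "\<And>x. x \<in> S \<Longrightarrow> f x \<in> J"
    and h: "\<And>m t. t \<in> J \<Longrightarrow> (h m has_field_derivative h' m t) (at t)"
    and h': "\<And>m k. (\<And>m. C_k_on k n S (\<lambda>x. h m (f x))) \<Longrightarrow> C_k_on k n S (\<lambda>x. h' m (f x))"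
    and f: "C_k_on k n S f"
  shows "C_k_on k n S (\<lambda>x. h m (f x))"
  using f
proof (induction k arbitrary: m)
  case 0
  have "continuous_on J (h m)"
    using h by (meson DERIV_isCont continuous_at_imp_continuous_on)
  then show ?case using 0 J C_0_iff[OF S] continuous_on_compose2 by (metis image_subsetI)
next
  case (Suc k)
  show ?case
  proof (rule C_Suc_I[where g = "\<lambda>i x. h' m (f x) * partial i f x", OF S])
    have "continuous_on J (h m)"
      using h by (meson DERIV_isCont continuous_at_imp_continuous_on)
    then show "continuous_on S (\<lambda>x. h m (f x))"
      using Suc.prems J C_k_continuous[OF S] continuous_on_compose2 by (metis image_subsetI)
    show "C_k_on k n S (\<lambda>x. h' m (f x) * partial i f x)" if "i < n" for i
      using C_Suc_D(2)[OF S Suc.prems that] Suc.IH[OF C_k_Suc_imp[OF S Suc.prems]]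
      by (intro C_k_mult[OF S] h') auto
  next
    fix i x assume ix: "i < n" "x \<in> S"
    show "((\<lambda>t. h m (f (x(i := t)))) has_field_derivative h' m (f x) * partial i f x) (at (x i))"
      using DERIV_chain2[where f = "h m" and g = "\<lambda>t. f (x(i := t))" and x = "x i" and s = UNIV]
        h[OF J[OF ix(2)]] C_Suc_D(1)[OF S Suc.prems ix] by (simp del: fun_upd_apply)
  qed
qed

lemma C_k_exp:
  assumes S: "openin (Euclidean_space n) S" and "C_k_on k n S f"
  shows "C_k_on k n S (\<lambda>x. exp (f x))"
  by (rule C_k_compose_family[where h = "\<lambda>_::unit. exp" and J = UNIV and h' = "\<lambda>_::unit. exp", OF S])
     (use assms in auto)

lemma C_k_inverse:
  assumes S: "openin (Euclidean_space n) S" and f: "C_k_on k n S f" and nz: "\<And>x. x \<in> S \<Longrightarrow> f x \<noteq> 0"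
  shows "C_k_on k n S (\<lambda>x. inverse (f x))"
  by (rule C_k_compose_family[where h = "\<lambda>_::unit. inverse" and J = "-{0}"
        and h' = "\<lambda>_::unit. \<lambda>t. - (inverse t * inverse t)", OF S])
     (use assms in \<open>auto intro!: C_k_mult[OF S] C_k_minus[OF S] derivative_eq_intros simp: power2_eq_square\<close>)

lemma C_k_ln:
  assumes S: "openin (Euclidean_space n) S" and f: "C_k_on k n S f" and pos: "\<And>x. x \<in> S \<Longrightarrow> f x > 0"
  shows "C_k_on k n S (\<lambda>x. ln (f x))"
proof -
  have cont: "continuous_on S (\<lambda>x. ln (f x))"
    by (rule continuous_on_ln[OF C_k_continuous[OF S f]]) (use pos in force)
  show ?thesis
  proof (cases k)
    case 0
    then show ?thesis using cont C_0_iff[OF S] by blast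
  next
    case (Suc k)
    note f = f[unfolded Suc]
    show ?thesis unfolding Suc
    proof (rule C_Suc_I[where g = "\<lambda>i x. inverse (f x) * partial i f x", OF S cont])
      show "C_k_on k n S (\<lambda>x. inverse (f x) * partial i f x)" if "i < n" for i
        by (rule C_k_mult[OF S C_k_inverse[OF S C_k_Suc_imp[OF S f]] C_Suc_D(2)[OF S f that]])
           (use pos in force)
    next
      fix i x assume ix: "i < n" "x \<in> S"
      show "((\<lambda>t. ln (f (x(i := t)))) has_field_derivative inverse (f x) * partial i f x) (at (x i))"
        by (rule DERIV_chain2[where f = ln and g = "\<lambda>t. f (x(i := t))" and x = "x i", OF _ C_Suc_D(1)[OF S f ix]])
           (use DERIV_ln[OF pos[OF ix(2)]] in simp)
    qed
  qed
qed


subsection \<open>The chain rule\<close>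

text \<open>
  Along a curve \<open>c\<close>, one coordinate is released after the other: passing from the curve with
  \<open>j\<close> moving coordinates to the one with \<open>j + 1\<close> is an instance of differentiability of a
  function of two variables, one of whose partial derivatives is continuous.
\<close>

lemma has_derivative_along_curve:
  fixes c :: "real \<Rightarrow> nat \<Rightarrow> real"
  assumes T: "openin (Euclidean_space m) T"
    and f: "\<And>j x. j < m \<Longrightarrow> x \<in> T \<Longrightarrow> ((\<lambda>t. f (x(j := t))) has_field_derivative p j x) (at (x j))"
    and p: "\<And>j. j < m \<Longrightarrow> continuous_on T (p j)"
    and I: "open I" "t0 \<in> I" "continuous_on I c" "\<And>t. t \<in> I \<Longrightarrow> c t \<in> T"
    and c: "\<And>j. j < m \<Longrightarrow> ((\<lambda>t. c t j) has_field_derivative c' j) (at t0)"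
  shows "((\<lambda>t. f (c t)) has_field_derivative (\<Sum>j<m. p j (c t0) * c' j)) (at t0)"
proof -
  define q where "q j t = (\<lambda>i. if i < j then c t i else c t0 i)" for j t
  have TE: "T \<subseteq> Eset m" using T by (rule openin_Euclidean_subset)
  have c0: "c t i = 0" if "t \<in> I" "i \<ge> m" for t i using I(4) TE that by blast
  have cc: "continuous_on I (\<lambda>t. c t i)" for i
    using I(3) by (rule continuous_on_product_then_coordinatewise)
  have "((\<lambda>t. f (q j t)) has_field_derivative (\<Sum>i<j. p i (c t0) * c' i)) (at t0)" if "j \<le> m" for j
    using that
  proof (induction j)
    case 0
    then show ?case by (simp add: q_def)
  next
    case (Suc j)
    then have j: "j < m" by simp
    define Q where "Q z = (q j (fst z))(j := snd z)" for z :: "real \<times> real"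
    have Qc: "continuous_on (I \<times> UNIV) Q"
    proof (rule continuous_on_coordinatewise_then_product)
      fix i
      have 1: "continuous_on (I \<times> UNIV) (\<lambda>z. c (fst z) i)"
        by (rule continuous_on_compose2[OF cc[of i] continuous_on_fst[OF continuous_on_id]]) auto
      show "continuous_on (I \<times> UNIV) (\<lambda>z. Q z i)"
        unfolding Q_def q_def using 1
        by (cases "i = j"; cases "i < j") (auto intro!: continuous_intros)
    qed
    obtain U where U: "open U" "T = Eset m \<inter> U"
      using T unfolding Euclidean_space_top_of_set openin_open by blast
    define N where "N = {z \<in> I \<times> UNIV. Q z \<in> U}"
    have "openin (top_of_set (I \<times> UNIV)) ((I \<times> UNIV) \<inter> Q -` U)"
      using Qc U(1) by (rule continuous_openin_preimage_gen)
    moreover have "N = (I \<times> UNIV) \<inter> Q -` U" by (auto simp: N_def)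
    moreover have "open (I \<times> (UNIV::real set))" using I(1) by (simp add: open_Times)
    ultimately have "open N" by (metis openin_open_trans)
    have Qt0: "Q (t0, c t0 j) = c t0" by (auto simp: Q_def q_def)
    then have "(t0, c t0 j) \<in> N" using I(2,4) U by (auto simp: N_def)
    then obtain A B where AB: "open A" "open B" "t0 \<in> A" "c t0 j \<in> B" "A \<times> B \<subseteq> N"
      using \<open>open N\<close> by (metis open_prod_elim mem_Sigma_iff)
    obtain e where e: "e > 0" "ball (c t0 j) e \<subseteq> B" using AB(2,4) open_contains_ball by blast
    let ?Y = "ball (c t0 j) e"
    have QT: "Q (t, y) \<in> T" if "t \<in> A" "y \<in> ?Y" for t y
    proof -
      have "(t, y) \<in> N" using AB(5) e(2) that by blast
      then have "Q (t, y) \<in> U" "t \<in> I" by (auto simp: N_def)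
      then show ?thesis using U(2) c0 I(2) j by (auto simp: Q_def q_def)
    qed
    have AI: "A \<subseteq> I"
    proof
      fix t assume "t \<in> A"
      then have "(t, c t0 j) \<in> N" using AB(4,5) by blast
      then show "t \<in> I" by (simp add: N_def)
    qed
    have "((\<lambda>(x, y). f (Q (x, y))) has_derivative
        (\<lambda>(tx, ty). (\<Sum>i<j. p i (c t0) * c' i) * tx +
           blinfun_apply (blinfun_mult_right (p j (Q (t0, c t0 j)))) ty))
      (at (t0, c t0 j) within A \<times> ?Y)"
    proof (rule has_derivative_partialsI[where f = "\<lambda>x y. f (Q (x, y))"
          and fy = "\<lambda>x y. blinfun_mult_right (p j (Q (x, y)))"])
      have "Q (t, c t0 j) = q j t" for t by (auto simp: Q_def q_def)
      then show "((\<lambda>x. f (Q (x, c t0 j))) has_derivative (\<lambda>tx. (\<Sum>i<j. p i (c t0) * c' i) * tx)) (at t0 within A)"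
        using Suc.IH j by (simp add: has_field_derivative_def has_derivative_at_withinI)
      show "((\<lambda>y. f (Q (x, y))) has_derivative blinfun_apply (blinfun_mult_right (p j (Q (x, y))))) (at y within ?Y)"
        if "x \<in> A" "y \<in> ?Y" for x y
      proof -
        have "(\<lambda>t. f ((Q (x, y))(j := t))) = (\<lambda>t. f (Q (x, t)))" by (simp add: Q_def)
        moreover have "Q (x, y) j = y" by (simp add: Q_def)
        ultimately show ?thesis
          using f[OF j QT[OF that]] by (simp add: has_field_derivative_def has_derivative_at_withinI)
      qed
      have "continuous_on (A \<times> ?Y) (\<lambda>z. p j (Q z))"
        by (rule continuous_on_compose2[OF p[OF j] continuous_on_subset[OF Qc]]) (use QT AI in auto)
      then have "continuous_on (A \<times> ?Y) (\<lambda>z. blinfun_mult_right (p j (Q z)))"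
        by (rule bounded_linear.continuous_on[OF bounded_linear_blinfun_mult_right])
      then show "continuous (at (t0, c t0 j) within A \<times> ?Y) (\<lambda>(x, y). blinfun_mult_right (p j (Q (x, y))))"
        using AB(3) e(1) unfolding continuous_on_eq_continuous_within by (auto simp: case_prod_unfold)
    qed (use e in auto)
    then have D: "((\<lambda>z. f (Q z)) has_derivative
        (\<lambda>(tx, ty). (\<Sum>i<j. p i (c t0) * c' i) * tx + p j (c t0) * ty)) (at (t0, c t0 j))"
      using AB e by (simp add: Qt0 case_prod_unfold at_within_open[OF _ open_Times])
    have "((\<lambda>t. (t, c t j)) has_derivative (\<lambda>h. (h, c' j * h))) (at t0)"
      using c[OF j] by (auto intro!: derivative_eq_intros simp: has_field_derivative_def)
    from has_derivative_compose[OF this D]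
    have "((\<lambda>t. f (Q (t, c t j))) has_derivative
        (\<lambda>h. (\<Sum>i<j. p i (c t0) * c' i) * h + p j (c t0) * (c' j * h))) (at t0)"
      by simp
    moreover have "Q (t, c t j) = q (Suc j) t" for t by (auto simp: Q_def q_def less_Suc_eq)
    moreover have "(\<lambda>h. (\<Sum>i<j. p i (c t0) * c' i) * h + p j (c t0) * (c' j * h)) =
        (*) (\<Sum>i<Suc j. p i (c t0) * c' i)" by (auto simp: algebra_simps)
    ultimately show ?case by (simp add: has_field_derivative_def)
  qed
  from this[of m] have "((\<lambda>t. f (q m t)) has_field_derivative (\<Sum>j<m. p j (c t0) * c' j)) (at t0)"
    by simp
  moreover have "eventually (\<lambda>t. f (q m t) = f (c t)) (nhds t0)"
    using eventually_nhds_in_open[OF I(1,2)]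
  proof eventually_elim
    case (elim t)
    then have "q m t = c t" using c0 I(2) by (force simp: q_def)
    then show ?case by simp
  qed
  ultimately show ?thesis using DERIV_cong_ev[OF refl _ refl] by metis
qed

lemma open_line:
  assumes S: "openin (Euclidean_space n) S" and x: "x \<in> S" and i: "i < n"
  obtains I where "open I" "x i \<in> I" "\<And>t. t \<in> I \<Longrightarrow> x(i := t) \<in> S"
  using eventually_line_in_open[OF assms] unfolding eventually_nhds by blast

lemma C_k_compose:
  assumes S: "openin (Euclidean_space n) S" and T: "openin (Euclidean_space m) T"
    and f: "C_k_on k m T f"
    and g: "\<And>j. j < m \<Longrightarrow> C_k_on k n S (\<lambda>x. g x j)" and gT: "\<And>x. x \<in> S \<Longrightarrow> g x \<in> T"
  shows "C_k_on k n S (\<lambda>x. f (g x))"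
  using f g
proof (induction k arbitrary: f)
  have TE: "T \<subseteq> Eset m" using T by (rule openin_Euclidean_subset)
  have gc: "continuous_on S g" if "\<And>j. j < m \<Longrightarrow> C_k_on k n S (\<lambda>x. g x j)" for k
  proof (rule continuous_on_coordinatewise_then_product)
    fix j
    show "continuous_on S (\<lambda>x. g x j)"
    proof (cases "j < m")
      case True
      then show ?thesis using C_k_continuous[OF S that] by simp
    next
      case False
      then have "g x j = 0" if "x \<in> S" for x using gT[OF that] TE by auto
      then show ?thesis by (metis (no_types, lifting) continuous_on_const continuous_on_cong)
    qed
  qed
  have fc: "continuous_on S (\<lambda>x. f (g x))"
    if "continuous_on T f" "\<And>j. j < m \<Longrightarrow> C_k_on k n S (\<lambda>x. g x j)" for f k
    by (rule continuous_on_compose2[OF that(1) gc[OF that(2)]]) (use gT in auto)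
  {
    case 0
    then show ?case using fc[of f 0] C_0_iff[OF T] C_0_iff[OF S] by blast
  next
    case (Suc k)
    show ?case
    proof (rule C_Suc_I[OF S, where g = "\<lambda>i x. \<Sum>j<m. partial j f (g x) * partial i (\<lambda>x. g x j) x"])
      show "continuous_on S (\<lambda>x. f (g x))" using fc[OF C_k_continuous[OF T Suc.prems(1)] Suc.prems(2)] .
    next
      fix i assume i: "i < n"
      show "C_k_on k n S (\<lambda>x. \<Sum>j<m. partial j f (g x) * partial i (\<lambda>x. g x j) x)"
      proof (rule C_k_sum[OF S], rule C_k_mult[OF S])
        fix j assume j: "j \<in> {..<m}"
        show "C_k_on k n S (\<lambda>x. partial j f (g x))"
          by (rule Suc.IH) (use C_Suc_D(2)[OF T Suc.prems(1)] j C_k_Suc_imp[OF S Suc.prems(2)] in auto)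
        show "C_k_on k n S (partial i (\<lambda>x. g x j))"
          using C_Suc_D(2)[OF S Suc.prems(2) i] j by simp
      qed
    next
      fix i x assume i: "i < n" and x: "x \<in> S"
      obtain I where I: "open I" "x i \<in> I" "\<And>t. t \<in> I \<Longrightarrow> x(i := t) \<in> S"
        using open_line[OF S x i] by blast
      have "((\<lambda>t. f (g (x(i := t)))) has_field_derivative
          (\<Sum>j<m. partial j f (g (x(i := x i))) * partial i (\<lambda>x. g x j) x)) (at (x i))"
      proof (rule has_derivative_along_curve[OF T, where I = I])
        show "((\<lambda>t. f (y(j := t))) has_field_derivative partial j f y) (at (y j))" if "j < m" "y \<in> T" for j y
          using C_Suc_D(1)[OF T Suc.prems(1) that] .
        show "continuous_on T (partial j f)" if "j < m" for j
          using C_k_continuous[OF T C_Suc_D(2)[OF T Suc.prems(1) that]] .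
        show "continuous_on I (\<lambda>t. g (x(i := t)))"
          by (rule continuous_on_compose2[OF gc[OF Suc.prems(2)]
                continuous_on_subset[OF continuous_on_fun_upd]]) (use I in auto)
        show "((\<lambda>t. g (x(i := t)) j) has_field_derivative partial i (\<lambda>x. g x j) x) (at (x i))" if "j < m" for j
          using C_Suc_D(1)[OF S Suc.prems(2)[OF that] i x] by (simp del: fun_upd_apply)
      qed (use I gT in \<open>auto simp del: fun_upd_apply\<close>)
      then show "((\<lambda>t. f (g (x(i := t)))) has_field_derivative
          (\<Sum>j<m. partial j f (g x) * partial i (\<lambda>x. g x j) x)) (at (x i))" by simp
    qed
  }
qed

subsection \<open>Integrals with a parameter\<close>

text \<open>The powers of \<open>t\<close> are what differentiation under the integral sign produces.\<close>

lemma C_k_segment_integral: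
  assumes S: "openin (Euclidean_space n) S"
    and star: "\<And>x t. x \<in> S \<Longrightarrow> t \<in> {0..1::real} \<Longrightarrow> (\<lambda>i. p i + t * (x i - p i)) \<in> S"
    and f: "C_k_on k n S f"
  shows "C_k_on k n S (\<lambda>x. integral {0..1} (\<lambda>t. t ^ m * f (\<lambda>i. p i + t * (x i - p i))))"
  using f
proof (induction k arbitrary: f m)
  define g where "g x t = (\<lambda>i. p i + t * (x i - p i))" for x :: "nat \<Rightarrow> real" and t
  have gc: "continuous_on (S \<times> {0..1}) (\<lambda>z. g (fst z) (snd z))"
    unfolding g_def
    by (intro continuous_on_coordinatewise_then_product continuous_intros
        continuous_on_product_then_coordinatewise[OF continuous_on_fst[OF continuous_on_id]])
  have fc: "continuous_on (S \<times> {0..1}) (\<lambda>(x, t). t ^ m * f (g x t))" if "continuous_on S f" for f m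
    unfolding case_prod_unfold
    by (intro continuous_intros continuous_on_compose2[OF that gc]) (use star in \<open>auto simp: g_def\<close>)
  have ic: "continuous_on S (\<lambda>x. integral {0..1} (\<lambda>t. t ^ m * f (g x t)))" if "continuous_on S f" for f m
    using integral_continuous_on_param[of S 0 1 "\<lambda>x t. t ^ m * f (g x t)"] fc[OF that, of m]
    by (simp add: cbox_interval)
  {
    case 0
    then show ?case using ic[of f m] C_0_iff[OF S] by (simp only: g_def)
  next
    case (Suc k)
    show ?case
    proof (rule C_Suc_I[OF S, where g = "\<lambda>i x. integral {0..1} (\<lambda>t. t ^ Suc m * partial i f (\<lambda>i. p i + t * (x i - p i)))"])
      show "continuous_on S (\<lambda>x. integral {0..1} (\<lambda>t. t ^ m * f (\<lambda>i. p i + t * (x i - p i))))"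
        using ic[OF C_k_continuous[OF S Suc.prems], of m] by (simp only: g_def)
      show "C_k_on k n S (\<lambda>x. integral {0..1} (\<lambda>t. t ^ Suc m * partial i f (\<lambda>i. p i + t * (x i - p i))))"
        if "i < n" for i by (rule Suc.IH[OF C_Suc_D(2)[OF S Suc.prems that]])
    next
      fix i x assume i: "i < n" and x: "x \<in> S"
      obtain I where I: "open I" "x i \<in> I" "\<And>t. t \<in> I \<Longrightarrow> x(i := t) \<in> S"
        using open_line[OF S x i] by blast
      obtain e where e: "e > 0" "ball (x i) e \<subseteq> I" using I(1,2) open_contains_ball by blast
      let ?U = "ball (x i) e"
      have US: "x(i := s) \<in> S" if "s \<in> ?U" for s using that e I(3) by blast
      have gline: "g (x(i := s)) t = (g (x(i := s0)) t)(i := p i + t * (s - p i))" for s s0 t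
        by (auto simp: g_def)
      have D: "((\<lambda>s. f (g (x(i := s)) t)) has_field_derivative
            partial i f (g (x(i := s0)) t) * t) (at s0)" if "s0 \<in> ?U" "t \<in> {0..1}" for s0 t
      proof -
        let ?y = "g (x(i := s0)) t"
        have yS: "?y \<in> S" using star[OF US[OF that(1)] that(2)] by (simp add: g_def)
        have "((\<lambda>s. p i + t * (s - p i)) has_field_derivative t) (at s0)"
          by (auto intro!: derivative_eq_intros)
        moreover have "((\<lambda>v. f (?y(i := v))) has_field_derivative partial i f ?y) (at (p i + t * (s0 - p i)))"
          using C_Suc_D(1)[OF S Suc.prems i yS] unfolding g_def by (simp del: fun_upd_apply add: fun_upd_same)
        ultimately have "((\<lambda>s. f (?y(i := p i + t * (s - p i)))) has_field_derivative partial i f ?y * t) (at s0)"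
          using DERIV_chain2 by fast
        then show ?thesis by (simp only: gline[of _ t s0, symmetric])
      qed
      have pc: "continuous_on S (partial i f)"
        using C_k_continuous[OF S C_Suc_D(2)[OF S Suc.prems i]] .
      have uc: "continuous_on (?U \<times> {0..1::real}) (\<lambda>z. (x(i := fst z), snd z))"
        by (intro continuous_intros
            continuous_on_compose2[OF continuous_on_fun_upd continuous_on_fst[OF continuous_on_id]]) auto
      have "((\<lambda>s. integral (cbox 0 1) (\<lambda>t. t ^ m * f (g (x(i := s)) t))) has_field_derivative
          integral (cbox 0 1) (\<lambda>t. t ^ Suc m * partial i f (g (x(i := x i)) t))) (at (x i) within ?U)"
      proof (rule leibniz_rule_field_derivative)
        fix s t assume st: "s \<in> ?U" "t \<in> cbox (0::real) 1"
        have "((\<lambda>s. t ^ m * f (g (x(i := s)) t)) has_field_derivative t ^ m * (partial i f (g (x(i := s)) t) * t)) (at s)"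
          using D[of s t] st by (intro DERIV_cmult) (simp add: cbox_interval)
        then show "((\<lambda>s. t ^ m * f (g (x(i := s)) t)) has_field_derivative
            t ^ Suc m * partial i f (g (x(i := s)) t)) (at s within ?U)"
          by (simp add: has_field_derivative_at_within mult_ac)
      next
        fix s assume s: "s \<in> ?U"
        have "continuous_on {0..1} (\<lambda>t. (\<lambda>(x, t). t ^ m * f (g x t)) (x(i := s), t))"
          by (rule continuous_on_compose2[OF fc[OF C_k_continuous[OF S Suc.prems], of m]])
             (use US[OF s] in \<open>auto intro!: continuous_intros\<close>)
        then show "(\<lambda>t. t ^ m * f (g (x(i := s)) t)) integrable_on cbox 0 1"
          by (simp add: cbox_interval integrable_continuous_interval)
      next
        have "continuous_on (?U \<times> {0..1}) (\<lambda>z. (\<lambda>(x, t). t ^ Suc m * partial i f (g x t)) (x(i := fst z), snd z))"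
          by (rule continuous_on_compose2[OF fc[OF pc, of "Suc m"] uc]) (use US in auto)
        then show "continuous_on (?U \<times> cbox 0 1) (\<lambda>(s, t). t ^ Suc m * partial i f (g (x(i := s)) t))"
          by (simp add: cbox_interval case_prod_unfold)
      qed (use e in auto)
      then show "((\<lambda>s. integral {0..1} (\<lambda>t. t ^ m * f (\<lambda>j. p j + t * ((x(i := s)) j - p j)))) has_field_derivative
          integral {0..1} (\<lambda>t. t ^ Suc m * partial i f (\<lambda>i. p i + t * (x i - p i)))) (at (x i))"
        unfolding at_within_open[OF centre_in_ball[THEN iffD2, OF e(1)] open_ball]
        by (simp only: cbox_interval g_def fun_upd_triv)
    qed
  }
qed

subsection \<open>A bump function\<close>

text \<open>
  For \<open>m = 0\<close> this is the standard smooth function that vanishes to infinite order at \<open>0\<close>; the other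
  members are what its derivatives are made of.
\<close>

definition flat_exp :: "nat \<Rightarrow> real \<Rightarrow> real" where
  "flat_exp m t = (if t > 0 then inverse t ^ m * exp (- inverse t) else 0)"

lemma flat_exp_tendsto_0: "(flat_exp m \<longlongrightarrow> 0) (at 0)"
proof -
  have "((\<lambda>t. inverse t ^ m / exp (inverse t)) \<longlongrightarrow> 0) (at_right (0::real))"
    by (rule filterlim_compose[OF tendsto_power_div_exp_0 filterlim_inverse_at_top_right])
  then have "(flat_exp m \<longlongrightarrow> 0) (at_right 0)"
    by (rule Lim_transform_eventually)
       (auto simp: eventually_at_right_less flat_exp_def exp_minus divide_inverse
          intro!: eventually_mono[OF eventually_at_right_less])
  moreover have "(flat_exp m \<longlongrightarrow> 0) (at_left 0)"
    by (rule Lim_transform_eventually[OF tendsto_const])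
       (auto simp: flat_exp_def eventually_at_filter)
  ultimately show ?thesis by (simp add: filterlim_split_at)
qed

lemma flat_exp_has_derivative:
  "(flat_exp m has_field_derivative (- real m) * flat_exp (Suc m) t + flat_exp (Suc (Suc m)) t) (at t)"
proof (cases "t = 0")
  case True
  have "((\<lambda>h. flat_exp m h / h) \<longlongrightarrow> 0) (at 0)"
    by (rule Lim_transform_eventually[OF flat_exp_tendsto_0[of "Suc m"]])
       (auto simp: flat_exp_def divide_inverse intro!: always_eventually)
  then show ?thesis by (simp add: True DERIV_def flat_exp_def)
next
  case False
  show ?thesis
  proof (cases "t > 0")
    case True
    have "((\<lambda>t. inverse t ^ m * exp (- inverse t)) has_field_derivative
        (- real m) * flat_exp (Suc m) t + flat_exp (Suc (Suc m)) t) (at t)"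
    proof (cases m)
      case 0
      then show ?thesis using True
        by (auto intro!: derivative_eq_intros simp: flat_exp_def power2_eq_square)
    next
      case (Suc l)
      have "((\<lambda>t. inverse t ^ Suc l * exp (- inverse t)) has_field_derivative
          (real (Suc l) * inverse t ^ l * (- (inverse t * inverse t))) * exp (- inverse t) +
          exp (- inverse t) * (inverse t * inverse t) * inverse t ^ Suc l) (at t)"
        using True by (auto intro!: derivative_eq_intros simp: power2_eq_square simp del: power_Suc)
      then show ?thesis
        unfolding Suc by (rule DERIV_cong) (use True in \<open>simp add: Suc flat_exp_def algebra_simps\<close>)
    qed
    moreover have "eventually (\<lambda>t. inverse t ^ m * exp (- inverse t) = flat_exp m t) (nhds t)"
      using eventually_nhds_in_open[of "{0<..}" t] True
      by (auto simp: flat_exp_def elim!: eventually_mono)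
    ultimately show ?thesis using DERIV_cong_ev[OF refl _ refl] by metis
  next
    assume "\<not> t > 0"
    then have t: "t < 0" using False by simp
    have "eventually (\<lambda>t. 0 = flat_exp m t) (nhds t)"
      using eventually_nhds_in_open[of "{..<0}" t] t
      by (auto simp: flat_exp_def elim!: eventually_mono)
    then show ?thesis
      using DERIV_cong_ev[OF refl _ refl, of "\<lambda>_. 0" "flat_exp m" t 0] t by (simp add: flat_exp_def)
  qed
qed

lemma C_k_flat_exp:
  assumes S: "openin (Euclidean_space n) S" and f: "C_k_on k n S f"
  shows "C_k_on k n S (\<lambda>x. flat_exp m (f x))"
  by (rule C_k_compose_family[where h = flat_exp and J = UNIV
      and h' = "\<lambda>m t. (- real m) * flat_exp (Suc m) t + flat_exp (Suc (Suc m)) t", OF S _ flat_exp_has_derivative])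
     (use f in \<open>auto intro!: C_k_diff[OF S] C_k_mult[OF S] C_k_const[OF S]\<close>)


subsection \<open>Smooth functions of all orders\<close>

lemma C_inf_cong:
  "openin (Euclidean_space n) S \<Longrightarrow> (\<And>y. y \<in> S \<Longrightarrow> f y = g y) \<Longrightarrow> C_inf_on n S f \<Longrightarrow> C_inf_on n S g"
  unfolding C_inf_on_def using C_k_cong by blast

lemma C_inf_subset:
  "openin (Euclidean_space n) S \<Longrightarrow> openin (Euclidean_space n) T \<Longrightarrow> T \<subseteq> S \<Longrightarrow> C_inf_on n S f \<Longrightarrow> C_inf_on n T f"
  unfolding C_inf_on_def using C_k_subset by blast

lemma C_inf_local:
  assumes "openin (Euclidean_space n) S"
    and "\<And>x. x \<in> S \<Longrightarrow> \<exists>T. openin (Euclidean_space n) T \<and> x \<in> T \<and> T \<subseteq> S \<and> C_inf_on n T f"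
  shows "C_inf_on n S f"
  unfolding C_inf_on_def
proof
  fix k
  show "C_k_on k n S f"
  proof (rule C_k_local[OF assms(1)])
    fix x assume "x \<in> S"
    from assms(2)[OF this] obtain T where
      "openin (Euclidean_space n) T" "x \<in> T" "T \<subseteq> S" "C_inf_on n T f" by blast
    then show "\<exists>T. openin (Euclidean_space n) T \<and> x \<in> T \<and> T \<subseteq> S \<and> C_k_on k n T f"
      unfolding C_inf_on_def by metis
  qed
qed

lemma C_inf_continuous: "openin (Euclidean_space n) S \<Longrightarrow> C_inf_on n S f \<Longrightarrow> continuous_on S f"
  unfolding C_inf_on_def using C_k_continuous by blast

lemma C_inf_partial: "openin (Euclidean_space n) S \<Longrightarrow> C_inf_on n S f \<Longrightarrow> i < n \<Longrightarrow> C_inf_on n S (partial i f)"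
  unfolding C_inf_on_def using C_Suc_D(2) by blast

lemma C_inf_has_partial:
  "openin (Euclidean_space n) S \<Longrightarrow> C_inf_on n S f \<Longrightarrow> i < n \<Longrightarrow> x \<in> S \<Longrightarrow>
    ((\<lambda>t. f (x(i := t))) has_field_derivative partial i f x) (at (x i))"
  unfolding C_inf_on_def using C_Suc_D(1) by blast

lemma C_inf_const: "openin (Euclidean_space n) S \<Longrightarrow> C_inf_on n S (\<lambda>x. c)"
  unfolding C_inf_on_def using C_k_const by blast

lemma C_inf_coord: "openin (Euclidean_space n) S \<Longrightarrow> C_inf_on n S (\<lambda>x. x j)"
  unfolding C_inf_on_def using C_k_coord by blast

lemma C_inf_add: "openin (Euclidean_space n) S \<Longrightarrow> C_inf_on n S f \<Longrightarrow> C_inf_on n S g \<Longrightarrow> C_inf_on n S (\<lambda>x. f x + g x)"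
  unfolding C_inf_on_def using C_k_add by blast

lemma C_inf_mult: "openin (Euclidean_space n) S \<Longrightarrow> C_inf_on n S f \<Longrightarrow> C_inf_on n S g \<Longrightarrow> C_inf_on n S (\<lambda>x. f x * g x)"
  unfolding C_inf_on_def using C_k_mult by blast

lemma C_inf_minus: "openin (Euclidean_space n) S \<Longrightarrow> C_inf_on n S f \<Longrightarrow> C_inf_on n S (\<lambda>x. - f x)"
  unfolding C_inf_on_def using C_k_minus by blast

lemma C_inf_diff: "openin (Euclidean_space n) S \<Longrightarrow> C_inf_on n S f \<Longrightarrow> C_inf_on n S g \<Longrightarrow> C_inf_on n S (\<lambda>x. f x - g x)"
  unfolding C_inf_on_def using C_k_diff by blast

lemma C_inf_sum:
  "openin (Euclidean_space n) S \<Longrightarrow> (\<And>j. j \<in> J \<Longrightarrow> C_inf_on n S (f j)) \<Longrightarrow> C_inf_on n S (\<lambda>x. \<Sum>j\<in>J. f j x)"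
  by (simp add: C_inf_on_def C_k_sum)

lemma C_inf_power: "openin (Euclidean_space n) S \<Longrightarrow> C_inf_on n S f \<Longrightarrow> C_inf_on n S (\<lambda>x. f x ^ m)"
  by (induction m) (auto intro: C_inf_const C_inf_mult)

lemma C_inf_exp: "openin (Euclidean_space n) S \<Longrightarrow> C_inf_on n S f \<Longrightarrow> C_inf_on n S (\<lambda>x. exp (f x))"
  by (auto simp: C_inf_on_def intro!: C_k_exp)

lemma C_inf_ln:
  assumes "openin (Euclidean_space n) S" "C_inf_on n S f" "\<And>x. x \<in> S \<Longrightarrow> f x > 0"
  shows "C_inf_on n S (\<lambda>x. ln (f x))"
  unfolding C_inf_on_def
proof
  show "C_k_on k n S (\<lambda>x. ln (f x))" for k
    by (rule C_k_ln[OF assms(1) _ assms(3)]) (use assms(2) in \<open>simp_all add: C_inf_on_def\<close>)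
qed

lemma C_inf_inverse:
  assumes "openin (Euclidean_space n) S" "C_inf_on n S g" "\<And>x. x \<in> S \<Longrightarrow> g x \<noteq> 0"
  shows "C_inf_on n S (\<lambda>x. inverse (g x))"
  unfolding C_inf_on_def
proof
  show "C_k_on k n S (\<lambda>x. inverse (g x))" for k
    by (rule C_k_inverse[OF assms(1) _ assms(3)]) (use assms(2) in \<open>simp_all add: C_inf_on_def\<close>)
qed

lemma C_inf_divide:
  assumes "openin (Euclidean_space n) S" "C_inf_on n S f" "C_inf_on n S g" "\<And>x. x \<in> S \<Longrightarrow> g x \<noteq> 0"
  shows "C_inf_on n S (\<lambda>x. f x / g x)"
  unfolding divide_inverse by (rule C_inf_mult[OF assms(1,2) C_inf_inverse[OF assms(1,3,4)]])

lemma C_inf_powr: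
  assumes S: "openin (Euclidean_space n) S" and "C_inf_on n S f" "\<And>x. x \<in> S \<Longrightarrow> f x > 0"
  shows "C_inf_on n S (\<lambda>x. f x powr a)"
proof (rule C_inf_cong[OF S, of "\<lambda>x. exp (a * ln (f x))"])
  show "exp (a * ln (f x)) = f x powr a" if "x \<in> S" for x
    using assms(3)[OF that] by (simp add: powr_def)
qed (intro C_inf_exp C_inf_mult C_inf_const C_inf_ln assms)

lemma C_inf_sqrt:
  assumes S: "openin (Euclidean_space n) S" and "C_inf_on n S f" "\<And>x. x \<in> S \<Longrightarrow> f x > 0"
  shows "C_inf_on n S (\<lambda>x. sqrt (f x))"
proof (rule C_inf_cong[OF S _ C_inf_powr[OF assms, of "1/2"]])
  show "f x powr (1/2) = sqrt (f x)" if "x \<in> S" for x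
    using assms(3)[OF that] by (simp add: powr_half_sqrt)
qed auto

lemma C_inf_flat_exp:
  "openin (Euclidean_space n) S \<Longrightarrow> C_inf_on n S f \<Longrightarrow> C_inf_on n S (\<lambda>x. flat_exp m (f x))"
  by (auto simp: C_inf_on_def intro!: C_k_flat_exp)

lemma C_inf_compose:
  "openin (Euclidean_space n) S \<Longrightarrow> openin (Euclidean_space m) T \<Longrightarrow> C_inf_on m T f \<Longrightarrow>
   (\<And>j. j < m \<Longrightarrow> C_inf_on n S (\<lambda>x. g x j)) \<Longrightarrow> (\<And>x. x \<in> S \<Longrightarrow> g x \<in> T) \<Longrightarrow> C_inf_on n S (\<lambda>x. f (g x))"
  unfolding C_inf_on_def using C_k_compose by blast

lemmas C_inf_intros =
  C_inf_const C_inf_coord C_inf_add C_inf_mult C_inf_minus C_inf_diff C_inf_sum C_inf_power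
  C_inf_exp C_inf_ln C_inf_divide C_inf_powr C_inf_sqrt


subsection \<open>Hadamard's lemma\<close>

lemma Euclidean_ball_subset:
  assumes W: "openin (Euclidean_space n) W" and p: "p \<in> W"
  obtains R where "R > 0" "{x \<in> Eset n. (\<Sum>i<n. (x i - p i)\<^sup>2) < R\<^sup>2} \<subseteq> W"
proof -
  obtain U where U: "open U" "W = Eset n \<inter> U"
    using W unfolding Euclidean_space_top_of_set openin_open by blast
  have "openin (product_topology (\<lambda>_. euclidean) (UNIV::nat set)) U"
    using U(1) by (simp add: euclidean_product_topology)
  then obtain V where V: "\<And>i. open (V i)" "p \<in> Pi\<^sub>E UNIV V" "Pi\<^sub>E UNIV V \<subseteq> U" "finite {i. V i \<noteq> UNIV}"
    using p U(2) unfolding openin_product_topology_alt by fastforce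
  have "\<exists>e>0. ball (p i) e \<subseteq> V i" for i
    using V(1)[of i] V(2) open_contains_ball by (metis PiE_mem UNIV_I)
  then obtain e where e: "\<And>i. e i > 0" "\<And>i. ball (p i) (e i) \<subseteq> V i" by metis
  define J where "J = {i. V i \<noteq> UNIV}"
  define R where "R = Min (insert 1 (e ` J))"
  have fin: "finite (insert 1 (e ` J))" using V(4) by (simp add: J_def)
  have R: "R > 0" using fin e(1) by (simp add: R_def)
  have Re: "R \<le> e i" if "i \<in> J" for i unfolding R_def by (rule Min_le[OF fin]) (use that in auto)
  have "x \<in> W" if x: "x \<in> Eset n" "(\<Sum>i<n. (x i - p i)\<^sup>2) < R\<^sup>2" for x
  proof -
    have "x i \<in> V i" for i
    proof (cases "i \<in> J")
      case False
      then show ?thesis by (simp add: J_def)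
    next
      case J: True
      show ?thesis
      proof (cases "i < n")
        case True
        have "(x i - p i)\<^sup>2 \<le> (\<Sum>i<n. (x i - p i)\<^sup>2)"
          by (rule member_le_sum) (use True in auto)
        then have "(x i - p i)\<^sup>2 < R\<^sup>2" using x(2) by linarith
        then have "\<bar>x i - p i\<bar> < R" using R by (metis abs_square_less_1 abs_le_square_iff abs_of_pos linorder_not_less)
        then have "x i \<in> ball (p i) (e i)" using Re[OF J] by (simp add: dist_real_def)
        then show ?thesis using e(2) by blast
      next
        case False
        then have "x i = p i" using x(1) p U(2) by auto
        then show ?thesis using V(2) by auto
      qed
    qed
    then have "x \<in> U" using V(3) by auto
    then show ?thesis using U(2) x(1) by blast
  qed
  then show thesis using that[OF R] by blast
qed

text \<open>
  The remainder factors \<open>h i\<close> are integrals of the partial derivatives along segments.  They exist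
  on a ball only; multiplied by the bump function \<open>\<theta>\<close> they extend to all of \<open>W\<close>, which is what
  makes the lemma applicable to derivations of the algebra of globally defined functions.
\<close>

lemma localized_Hadamard:
  assumes W: "openin (Euclidean_space n) W" and f: "C_inf_on n W f" and p: "p \<in> W"
  obtains \<theta> h where "C_inf_on n W \<theta>" "\<And>i. i < n \<Longrightarrow> C_inf_on n W (h i)" "\<theta> p \<noteq> 0"
    "\<And>i. i < n \<Longrightarrow> h i p = \<theta> p * partial i f p"
    "\<And>x. x \<in> W \<Longrightarrow> \<theta> x * (f x - f p) = (\<Sum>i<n. (x i - p i) * h i x)"
proof -
  define q where "q x = (\<Sum>i<n. (x i - p i)\<^sup>2)" for x :: "nat \<Rightarrow> real"
  obtain R where R: "R > 0" "{x \<in> Eset n. q x < R\<^sup>2} \<subseteq> W"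
    using Euclidean_ball_subset[OF W p] unfolding q_def by blast
  have WE: "W \<subseteq> Eset n" using W by (rule openin_Euclidean_subset)
  define B where "B = {x \<in> W. q x < R\<^sup>2}"
  have qs: "C_inf_on n W q" unfolding q_def by (intro C_inf_intros W)
  have qc: "continuous_on W q" using C_inf_continuous[OF W qs] .
  have Bo: "openin (Euclidean_space n) B"
    unfolding B_def using openin_Euclidean_preimage[OF W qc, of "{..<R\<^sup>2}"] by simp
  have BW: "B \<subseteq> W" by (auto simp: B_def)
  define s where "s x t = (\<lambda>i. p i + t * (x i - p i))" for x t and i :: nat
  have q0: "q x \<ge> 0" for x unfolding q_def by (intro sum_nonneg) auto
  have qs_t: "q (s x t) = t\<^sup>2 * q x" for x t
    unfolding q_def s_def by (simp add: power_mult_distrib sum_distrib_left)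
  have sB_iff: "s x t \<in> B \<longleftrightarrow> t\<^sup>2 * q x < R\<^sup>2" if "x \<in> B" for x t
  proof -
    have "x \<in> Eset n" "p \<in> Eset n" using that p WE BW by blast+
    then have "s x t \<in> Eset n" by (simp add: s_def)
    then show ?thesis using R(2) by (auto simp: B_def qs_t)
  qed
  have star: "s x t \<in> B" if "x \<in> B" "t \<in> {0..1}" for x t
  proof -
    have "t\<^sup>2 \<le> 1" using that(2) by (simp add: power_le_one)
    then have "t\<^sup>2 * q x \<le> q x" using q0[of x] by (simp add: mult_left_le_one_le)
    then show ?thesis using that(1) sB_iff[OF that(1)] by (auto simp: B_def)
  qed
  have pB: "p \<in> B" using p R(1) by (simp add: B_def q_def)
  have fB: "C_inf_on n B (partial i f)" if "i < n" for i
    using C_inf_subset[OF W Bo BW C_inf_partial[OF W f that]] .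
  define g where "g i x = integral {0..1} (\<lambda>t. partial i f (s x t))" for i x
  have gs: "C_inf_on n B (g i)" if "i < n" for i
  proof -
    have "C_k_on k n B (\<lambda>x. integral {0..1} (\<lambda>t. t ^ 0 * partial i f (\<lambda>i. p i + t * (x i - p i))))" for k
      by (rule C_k_segment_integral[OF Bo]) (use star fB[OF that] in \<open>auto simp: C_inf_on_def s_def\<close>)
    then show ?thesis unfolding C_inf_on_def g_def s_def by simp
  qed
  have gp: "g i p = partial i f p" for i by (simp add: g_def s_def)
  have fg: "f x - f p = (\<Sum>i<n. (x i - p i) * g i x)" if x: "x \<in> B" for x
  proof -
    have sc: "continuous_on UNIV (s x)"
      unfolding s_def by (intro continuous_on_coordinatewise_then_product continuous_intros)
    have pc: "continuous_on {0..1} (\<lambda>t. partial i f (s x t))" if "i < n" for i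
      by (rule continuous_on_compose2[OF C_inf_continuous[OF Bo fB[OF that]] continuous_on_subset[OF sc]])
         (use star[OF x] in auto)
    have "((\<lambda>t. f (s x t)) has_vector_derivative (\<Sum>i<n. partial i f (s x t) * (x i - p i))) (at t within {0..1})"
      if t: "t \<in> {0..1}" for t
    proof -
      have "((\<lambda>t. f (s x t)) has_field_derivative (\<Sum>i<n. partial i f (s x t) * (x i - p i))) (at t)"
      proof (rule has_derivative_along_curve[OF Bo, where I = "{t. t\<^sup>2 * q x < R\<^sup>2}"])
        show "((\<lambda>t. f (y(j := t))) has_field_derivative partial j f y) (at (y j))" if "j < n" "y \<in> B" for j y
          using C_inf_has_partial[OF W f that(1)] that(2) BW by blast
        show "continuous_on B (partial j f)" if "j < n" for j using C_inf_continuous[OF Bo fB[OF that]] .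
        show "open {t. t\<^sup>2 * q x < R\<^sup>2}" by (intro open_Collect_less continuous_intros)
        show "continuous_on {t. t\<^sup>2 * q x < R\<^sup>2} (s x)" by (rule continuous_on_subset[OF sc]) simp
        show "((\<lambda>t. s x t j) has_field_derivative x j - p j) (at t)" for j
          unfolding s_def by (auto intro!: derivative_eq_intros)
      qed (use star[OF x t] sB_iff[OF x] in auto)
      then show ?thesis
        using has_real_derivative_iff_has_vector_derivative has_vector_derivative_at_within by blast
    qed
    then have "((\<lambda>t. \<Sum>i<n. partial i f (s x t) * (x i - p i)) has_integral f (s x 1) - f (s x 0)) {0..1}"
      by (intro fundamental_theorem_of_calculus) auto
    moreover have "integral {0..1} (\<lambda>t. \<Sum>i<n. partial i f (s x t) * (x i - p i)) = (\<Sum>i<n. (x i - p i) * g i x)"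
    proof -
      have "integral {0..1} (\<lambda>t. \<Sum>i<n. partial i f (s x t) * (x i - p i)) =
          (\<Sum>i<n. integral {0..1} (\<lambda>t. partial i f (s x t) * (x i - p i)))"
        by (rule integral_sum) (auto intro!: integrable_continuous_interval continuous_intros pc)
      then show ?thesis by (simp add: g_def mult.commute)
    qed
    ultimately have "(\<Sum>i<n. (x i - p i) * g i x) = f (s x 1) - f (s x 0)"
      by (simp add: integral_unique)
    moreover have "s x 1 = x" "s x 0 = p" by (simp_all add: s_def)
    ultimately show ?thesis by simp
  qed
  define r where "r = R / 2"
  have r: "r > 0" "r\<^sup>2 < R\<^sup>2" using R(1) by (auto simp: r_def power2_eq_square)
  define \<theta> where "\<theta> x = flat_exp 0 (r\<^sup>2 - q x)" for x
  define h where "h i x = (if x \<in> B then \<theta> x * g i x else 0)" for i x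
  have chi0: "\<theta> x = 0" if "q x \<ge> r\<^sup>2" for x using that by (simp add: \<theta>_def flat_exp_def)
  have chis: "C_inf_on n W \<theta>" unfolding \<theta>_def by (intro C_inf_flat_exp C_inf_diff C_inf_const W qs)
  have hs: "C_inf_on n W (h i)" if i: "i < n" for i
  proof (rule C_inf_local[OF W])
    fix x assume x: "x \<in> W"
    show "\<exists>T. openin (Euclidean_space n) T \<and> x \<in> T \<and> T \<subseteq> W \<and> C_inf_on n T (h i)"
    proof (cases "q x < R\<^sup>2")
      case True
      have "C_inf_on n B (h i)"
        by (rule C_inf_cong[OF Bo _ C_inf_mult[OF Bo C_inf_subset[OF W Bo BW chis] gs[OF i]]]) (simp add: h_def)
      then show ?thesis using Bo BW x True by (intro exI[of _ B]) (auto simp: B_def)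
    next
      case False
      let ?T = "{x \<in> W. q x \<in> {r\<^sup>2<..}}"
      have To: "openin (Euclidean_space n) ?T" by (rule openin_Euclidean_preimage[OF W qc]) auto
      have "C_inf_on n ?T (h i)"
        by (rule C_inf_cong[OF To _ C_inf_const[OF To, of 0]]) (auto simp: h_def chi0)
      then show ?thesis using To x False r by (intro exI[of _ ?T]) auto
    qed
  qed
  show thesis
  proof (rule that[OF chis hs])
    have "q p = 0" by (simp add: q_def)
    then show "\<theta> p \<noteq> 0" using r by (simp add: \<theta>_def flat_exp_def)
    show "h i p = \<theta> p * partial i f p" for i by (simp add: h_def pB gp)
    show "\<theta> x * (f x - f p) = (\<Sum>i<n. (x i - p i) * h i x)" if x: "x \<in> W" for x
    proof (cases "x \<in> B")
      case True
      then show ?thesis by (simp add: h_def fg[OF True] sum_distrib_left mult_ac)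
    next
      case False
      then have "\<theta> x = 0" using x r by (intro chi0) (simp add: B_def)
      then show ?thesis using False by (simp add: h_def)
    qed
  qed
qed


section \<open>Manifolds made of sheets\<close>

text \<open>
  All manifolds needed here are disjoint unions of copies of one open set \<open>W\<close> of Euclidean
  space, with the copies as charts.  On such a manifold the coordinates are globally defined
  functions, and so are the partial derivatives.
\<close>

locale sheeted_manifold =
  fixes M :: "'a manifold" and sheet :: "'a \<Rightarrow> 's" and co :: "'a \<Rightarrow> nat \<Rightarrow> real"
    and C :: "'s set" and W :: "(nat \<Rightarrow> real) set" and pt :: "'s \<Rightarrow> (nat \<Rightarrow> real) \<Rightarrow> 'a"
  assumes W_open: "openin (Euclidean_space (mdim M)) W"
    and atlas: "matlas M = (\<lambda>c. ({p \<in> points M. sheet p = c}, co)) ` C"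
    and pt_in: "\<And>c x. c \<in> C \<Longrightarrow> x \<in> W \<Longrightarrow> pt c x \<in> points M"
    and sheet_pt: "\<And>c x. c \<in> C \<Longrightarrow> x \<in> W \<Longrightarrow> sheet (pt c x) = c"
    and co_pt: "\<And>c x. c \<in> C \<Longrightarrow> x \<in> W \<Longrightarrow> co (pt c x) = x"
    and sheet_in: "\<And>p. p \<in> points M \<Longrightarrow> sheet p \<in> C"
    and co_in: "\<And>p. p \<in> points M \<Longrightarrow> co p \<in> W"
    and pt_co: "\<And>p. p \<in> points M \<Longrightarrow> pt (sheet p) (co p) = p"
    and charts: "\<And>c. c \<in> C \<Longrightarrow> is_chart (mdim M) (mtop M) {p \<in> points M. sheet p = c} co"
begin

abbreviation "N \<equiv> mdim M"
abbreviation "SF \<equiv> smooth_funs M"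
abbreviation "VF \<equiv> vfields M"
abbreviation "sh c \<equiv> {p \<in> points M. sheet p = c}"

lemma image_co: "c \<in> C \<Longrightarrow> co ` sh c = W"
proof
  assume c: "c \<in> C"
  show "W \<subseteq> co ` sh c"
  proof
    fix x assume "x \<in> W"
    then have "pt c x \<in> sh c" "co (pt c x) = x" using c pt_in sheet_pt co_pt by auto
    then show "x \<in> co ` sh c" by force
  qed
qed (auto simp: co_in)

lemma inj_co: "inj_on co (sh c)"
proof (rule inj_onI)
  fix p q assume "p \<in> sh c" "q \<in> sh c" "co p = co q"
  then show "p = q" using pt_co[of p] pt_co[of q] by simp
qed

lemma inv_into_co:
  assumes "c \<in> C" "x \<in> W"
  shows "inv_into (sh c) co x = pt c x"
  using inv_into_f_f[OF inj_co, of "pt c x" c] pt_in[OF assms] sheet_pt[OF assms] co_pt[OF assms] by simp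

lemma smooth_funs_iff:
  "f \<in> SF \<longleftrightarrow> (\<forall>c\<in>C. C_inf_on N W (\<lambda>x. f (pt c x))) \<and> (\<forall>p. p \<notin> points M \<longrightarrow> f p = 0)"
proof -
  have "C_inf_on N (co ` sh c) (\<lambda>x. f (inv_into (sh c) co x)) \<longleftrightarrow> C_inf_on N W (\<lambda>x. f (pt c x))" if "c \<in> C" for c
    unfolding image_co[OF that]
    using C_inf_cong[OF W_open, of "\<lambda>x. f (inv_into (sh c) co x)" "\<lambda>x. f (pt c x)"]
      C_inf_cong[OF W_open, of "\<lambda>x. f (pt c x)" "\<lambda>x. f (inv_into (sh c) co x)"] inv_into_co[OF that]
    by auto
  then show ?thesis unfolding smooth_funs_def atlas by auto
qed

lemma smooth_fun_off: "f \<in> SF \<Longrightarrow> p \<notin> points M \<Longrightarrow> f p = 0"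
  by (simp add: smooth_funs_iff)

lemma smooth_fun_C_inf: "f \<in> SF \<Longrightarrow> c \<in> C \<Longrightarrow> C_inf_on N W (\<lambda>x. f (pt c x))"
  by (simp add: smooth_funs_iff)

definition cst :: "real \<Rightarrow> 'a \<Rightarrow> real" where
  "cst a p = (if p \<in> points M then a else 0)"

definition coord :: "nat \<Rightarrow> 'a \<Rightarrow> real" where
  "coord i p = (if p \<in> points M then co p i else 0)"

definition pd :: "nat \<Rightarrow> ('a \<Rightarrow> real) \<Rightarrow> 'a \<Rightarrow> real" where
  "pd i f p = (if p \<in> points M then partial i (\<lambda>x. f (pt (sheet p) x)) (co p) else 0)"

lemma pd_pt: "c \<in> C \<Longrightarrow> x \<in> W \<Longrightarrow> pd i f (pt c x) = partial i (\<lambda>x. f (pt c x)) x"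
  by (simp add: pd_def pt_in sheet_pt co_pt)

lemma smooth_funI:
  assumes "\<And>c. c \<in> C \<Longrightarrow> C_inf_on N W (g c)" "\<And>c x. c \<in> C \<Longrightarrow> x \<in> W \<Longrightarrow> f (pt c x) = g c x"
    "\<And>p. p \<notin> points M \<Longrightarrow> f p = 0"
  shows "f \<in> SF"
  unfolding smooth_funs_iff using assms C_inf_cong[OF W_open, of "g _"] by (metis (no_types, lifting))

lemma cst_smooth [intro]: "cst a \<in> SF"
  by (rule smooth_funI[where g = "\<lambda>_ _. a"]) (auto simp: cst_def pt_in C_inf_const W_open)

lemma coord_smooth [intro]: "coord i \<in> SF"
  by (rule smooth_funI[where g = "\<lambda>_ x. x i"]) (auto simp: coord_def pt_in co_pt C_inf_coord W_open)

lemma add_smooth [intro]: "f \<in> SF \<Longrightarrow> g \<in> SF \<Longrightarrow> (\<lambda>p. f p + g p) \<in> SF"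
  by (simp add: smooth_funs_iff C_inf_add[OF W_open])

lemma mult_smooth [intro]: "f \<in> SF \<Longrightarrow> g \<in> SF \<Longrightarrow> (\<lambda>p. f p * g p) \<in> SF"
  by (simp add: smooth_funs_iff C_inf_mult[OF W_open])

lemma cmult_smooth [intro]: "f \<in> SF \<Longrightarrow> (\<lambda>p. a * f p) \<in> SF"
  by (simp add: smooth_funs_iff C_inf_mult[OF W_open C_inf_const[OF W_open]])

lemma diff_smooth [intro]: "f \<in> SF \<Longrightarrow> g \<in> SF \<Longrightarrow> (\<lambda>p. f p - g p) \<in> SF"
  by (simp add: smooth_funs_iff C_inf_diff[OF W_open])

lemma sum_smooth [intro]: "(\<And>j. j \<in> J \<Longrightarrow> f j \<in> SF) \<Longrightarrow> (\<lambda>p. \<Sum>j\<in>J. f j p) \<in> SF"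
  by (auto simp: smooth_funs_iff intro!: C_inf_sum W_open)

lemma zero_smooth: "(\<lambda>p. 0) \<in> SF"
  by (simp add: smooth_funs_iff C_inf_const[OF W_open])

lemma pd_smooth [intro]: "f \<in> SF \<Longrightarrow> i < N \<Longrightarrow> pd i f \<in> SF"
proof (rule smooth_funI[where g = "\<lambda>c. partial i (\<lambda>x. f (pt c x))"])
  show "pd i f p = 0" if "p \<notin> points M" for p using that by (simp add: pd_def)
qed (auto simp: pd_pt intro: C_inf_partial[OF W_open] smooth_fun_C_inf)

lemma has_pd:
  assumes "f \<in> SF" "i < N" "c \<in> C" "x \<in> W"
  shows "((\<lambda>t. f (pt c (x(i := t)))) has_field_derivative pd i f (pt c x)) (at (x i))"
  using C_inf_has_partial[OF W_open smooth_fun_C_inf[OF assms(1,3)] assms(2,4)]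
  by (simp add: pd_pt[OF assms(3,4)])

lemma pd_eqI:
  assumes "p \<in> points M"
    and "((\<lambda>t. f (pt (sheet p) ((co p)(i := t)))) has_field_derivative d) (at (co p i))"
  shows "pd i f p = d"
  using assms partial_eqI[of "\<lambda>x. f (pt (sheet p) x)" "co p" i d] by (simp add: pd_def)

lemma has_pd_at:
  assumes "f \<in> SF" "i < N" "p \<in> points M"
  shows "((\<lambda>t. f (pt (sheet p) ((co p)(i := t)))) has_field_derivative pd i f p) (at (co p i))"
  using has_pd[OF assms(1,2) sheet_in[OF assms(3)] co_in[OF assms(3)]] by (simp add: pt_co[OF assms(3)])

lemma pd_add: "f \<in> SF \<Longrightarrow> g \<in> SF \<Longrightarrow> i < N \<Longrightarrow> pd i (\<lambda>p. f p + g p) = (\<lambda>p. pd i f p + pd i g p)"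
proof
  fix p assume *: "f \<in> SF" "g \<in> SF" "i < N"
  show "pd i (\<lambda>p. f p + g p) p = pd i f p + pd i g p"
  proof (cases "p \<in> points M")
    case True
    show ?thesis by (rule pd_eqI[OF True DERIV_add[OF has_pd_at[OF *(1,3) True] has_pd_at[OF *(2,3) True]]])
  qed (simp add: pd_def)
qed

lemma pd_mult: "f \<in> SF \<Longrightarrow> g \<in> SF \<Longrightarrow> i < N \<Longrightarrow> pd i (\<lambda>p. f p * g p) = (\<lambda>p. f p * pd i g p + g p * pd i f p)"
proof
  fix p assume *: "f \<in> SF" "g \<in> SF" "i < N"
  show "pd i (\<lambda>p. f p * g p) p = f p * pd i g p + g p * pd i f p"
  proof (cases "p \<in> points M")
    case True
    have "pd i (\<lambda>p. f p * g p) p = pd i f p * g (pt (sheet p) ((co p)(i := co p i))) +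
        pd i g p * f (pt (sheet p) ((co p)(i := co p i)))"
      by (rule pd_eqI[OF True DERIV_mult[OF has_pd_at[OF *(1,3) True] has_pd_at[OF *(2,3) True]]])
    then show ?thesis by (simp add: pt_co[OF True] mult.commute)
  qed (simp add: pd_def)
qed

lemma pd_cst: "i < N \<Longrightarrow> pd i (cst a) = (\<lambda>p. 0)"
proof
  fix p assume i: "i < N"
  show "pd i (cst a) p = 0"
  proof (cases "p \<in> points M")
    case True
    have "partial i (\<lambda>x. cst a (pt (sheet p) x)) (co p) = partial i (\<lambda>x. a) (co p)"
      by (rule partial_cong[OF W_open co_in[OF True] i]) (simp add: cst_def pt_in sheet_in True)
    then show ?thesis using True by (simp add: pd_def partial_def)
  qed (simp add: pd_def)
qed

lemma pd_coord: "i < N \<Longrightarrow> pd i (coord j) = cst (if i = j then 1 else 0)"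
proof
  fix p assume i: "i < N"
  show "pd i (coord j) p = cst (if i = j then 1 else 0) p"
  proof (cases "p \<in> points M")
    case True
    have "partial i (\<lambda>x. coord j (pt (sheet p) x)) (co p) = partial i (\<lambda>x. x j) (co p)"
      by (rule partial_cong[OF W_open co_in[OF True] i]) (simp add: coord_def pt_in co_pt sheet_in True)
    also have "\<dots> = (if i = j then 1 else 0)"
      by (rule partial_eqI) (auto intro!: derivative_eq_intros)
    finally show ?thesis using True by (simp add: pd_def cst_def)
  qed (simp add: pd_def cst_def)
qed

lemma pd_cmult: "f \<in> SF \<Longrightarrow> i < N \<Longrightarrow> pd i (\<lambda>p. a * f p) = (\<lambda>p. a * pd i f p)"
proof
  fix p assume *: "f \<in> SF" "i < N"
  show "pd i (\<lambda>p. a * f p) p = a * pd i f p"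
  proof (cases "p \<in> points M")
    case True
    show ?thesis by (rule pd_eqI[OF True DERIV_cmult[OF has_pd_at[OF *(1,2) True]]])
  qed (simp add: pd_def)
qed


subsection \<open>Vector fields\<close>

lemma vfieldI:
  assumes "\<And>f. f \<in> SF \<Longrightarrow> X f \<in> SF"
    and "\<And>f g. f \<in> SF \<Longrightarrow> g \<in> SF \<Longrightarrow> X (\<lambda>p. f p + g p) = (\<lambda>p. X f p + X g p)"
    and "\<And>c f. f \<in> SF \<Longrightarrow> X (\<lambda>p. c * f p) = (\<lambda>p. c * X f p)"
    and "\<And>f g. f \<in> SF \<Longrightarrow> g \<in> SF \<Longrightarrow> X (\<lambda>p. f p * g p) = (\<lambda>p. f p * X g p + g p * X f p)"
    and "\<And>f. f \<notin> SF \<Longrightarrow> X f = (\<lambda>p. 0)"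
  shows "X \<in> VF"
  using assms by (simp add: vfields_def plus_fun_def times_fun_def zero_fun_def)

lemma
  assumes "X \<in> VF"
  shows vf_smooth: "f \<in> SF \<Longrightarrow> X f \<in> SF"
    and vf_add: "f \<in> SF \<Longrightarrow> g \<in> SF \<Longrightarrow> X (\<lambda>p. f p + g p) = (\<lambda>p. X f p + X g p)"
    and vf_cmult: "f \<in> SF \<Longrightarrow> X (\<lambda>p. c * f p) = (\<lambda>p. c * X f p)"
    and vf_mult: "f \<in> SF \<Longrightarrow> g \<in> SF \<Longrightarrow> X (\<lambda>p. f p * g p) = (\<lambda>p. f p * X g p + g p * X f p)"
    and vf_off: "f \<notin> SF \<Longrightarrow> X f = (\<lambda>p. 0)"
  using assms by (auto simp: vfields_def plus_fun_def times_fun_def zero_fun_def)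

text \<open>The constant \<open>1\<close> is idempotent, so the Leibniz rule gives \<open>X 1 = 2 X 1\<close>.\<close>

lemma vf_cst: "X \<in> VF \<Longrightarrow> X (cst a) = (\<lambda>p. 0)"
proof -
  assume X: "X \<in> VF"
  have "X (cst 1) p = 0" for p
  proof (cases "p \<in> points M")
    case True
    have "(\<lambda>p. cst 1 p * cst 1 p) = cst 1" by (auto simp: cst_def)
    then have "X (cst 1) = (\<lambda>p. cst 1 p * X (cst 1) p + cst 1 p * X (cst 1) p)"
      using vf_mult[OF X cst_smooth[of 1] cst_smooth[of 1]] by simp
    then have "X (cst 1) p = cst 1 p * X (cst 1) p + cst 1 p * X (cst 1) p" by (rule fun_cong)
    then show ?thesis using True by (simp add: cst_def)
  next
    case False
    then show ?thesis using smooth_fun_off[OF vf_smooth[OF X cst_smooth]] by simp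
  qed
  moreover have "(\<lambda>p. a * cst 1 p) = cst a" by (auto simp: cst_def)
  ultimately show ?thesis using vf_cmult[OF X cst_smooth[of 1], of a] by simp
qed

lemma vf_diff: "X \<in> VF \<Longrightarrow> f \<in> SF \<Longrightarrow> g \<in> SF \<Longrightarrow> X (\<lambda>p. f p - g p) = (\<lambda>p. X f p - X g p)"
  using vf_add[of X f "\<lambda>p. (-1) * g p"] vf_cmult[of X g "-1"] cmult_smooth[of g "-1"] by simp

lemma vf_sum:
  assumes X: "X \<in> VF" and f: "\<And>j. j \<in> J \<Longrightarrow> f j \<in> SF"
  shows "X (\<lambda>p. \<Sum>j\<in>J. f j p) = (\<lambda>p. \<Sum>j\<in>J. X (f j) p)"
  using f
proof (induction J rule: infinite_finite_induct)
  have z: "X (\<lambda>p. 0) = (\<lambda>p. 0)" using vf_cmult[OF X zero_smooth, of 0] by simp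
  {
    case (infinite A)
    then show ?case using z by simp
  next
    case empty
    then show ?case using z by simp
  next
    case (insert j A)
    then show ?case using vf_add[OF X, of "f j" "\<lambda>p. \<Sum>j\<in>A. f j p"] by (simp add: sum_smooth)
  }
qed

text \<open>
  Apply \<open>X\<close> to the identity of the localized Hadamard lemma at \<open>p\<close> and evaluate there: all terms
  with an undifferentiated factor vanishing at \<open>p\<close> drop out, and the bump function cancels.
\<close>

theorem vf_expand:
  assumes X: "X \<in> VF" and f: "f \<in> SF"
  shows "X f = (\<lambda>p. \<Sum>i<N. X (coord i) p * pd i f p)"
proof
  fix p
  show "X f p = (\<Sum>i<N. X (coord i) p * pd i f p)"
  proof (cases "p \<in> points M")
    case False
    then show ?thesis using smooth_fun_off[OF vf_smooth[OF X f]] by (simp add: pd_def)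
  next
    case p: True
    define c where "c = sheet p"
    have c: "c \<in> C" using sheet_in[OF p] by (simp add: c_def)
    define F where "F x = f (pt c x)" for x
    have x0: "co p \<in> W" using co_in[OF p] .
    have Fp: "F (co p) = f p" using pt_co[OF p] by (simp add: F_def c_def)
    obtain th h where th: "C_inf_on N W th" "\<And>i. i < N \<Longrightarrow> C_inf_on N W (h i)" "th (co p) \<noteq> 0"
      "\<And>i. i < N \<Longrightarrow> h i (co p) = th (co p) * partial i F (co p)"
      "\<And>x. x \<in> W \<Longrightarrow> th x * (F x - F (co p)) = (\<Sum>i<N. (x i - co p i) * h i x)"
      using localized_Hadamard[OF W_open _ x0, of F] smooth_fun_C_inf[OF f c] unfolding F_def by blast
    \<comment> \<open>Extension by zero to the other sheets makes local data global.\<close>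
    define lift where "lift u q = (if q \<in> sh c then u (co q) else 0)" for u :: "(nat \<Rightarrow> real) \<Rightarrow> real" and q
    have lift_smooth: "lift u \<in> SF" if "C_inf_on N W u" for u
      by (rule smooth_funI[where g = "\<lambda>d. if d = c then u else (\<lambda>_. 0)"])
         (use that in \<open>auto simp: lift_def pt_in sheet_pt co_pt C_inf_const W_open\<close>)
    define t where "t = lift th"
    define k where "k i = lift (h i)" for i
    have ts: "t \<in> SF" and ks: "\<And>i. i < N \<Longrightarrow> k i \<in> SF"
      using th lift_smooth by (auto simp: t_def k_def)
    have fs: "(\<lambda>q. f q - cst (f p) q) \<in> SF" by (intro diff_smooth f cst_smooth)
    have cs: "(\<lambda>q. coord i q - cst (co p i) q) \<in> SF" for i by (intro diff_smooth coord_smooth cst_smooth)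
    have eq: "(\<lambda>q. t q * (f q - cst (f p) q)) = (\<lambda>q. \<Sum>i<N. (coord i q - cst (co p i) q) * k i q)"
    proof
      fix q
      show "t q * (f q - cst (f p) q) = (\<Sum>i<N. (coord i q - cst (co p i) q) * k i q)"
      proof (cases "q \<in> sh c")
        case True
        then have "F (co q) = f q" using pt_co[of q] by (simp add: F_def)
        then show ?thesis using th(5)[OF co_in, of q] True Fp
          by (simp add: t_def k_def lift_def coord_def cst_def)
      qed (auto simp: t_def k_def lift_def)
    qed
    have "X (\<lambda>q. t q * (f q - cst (f p) q)) p = t p * X f p"
      using vf_mult[OF X ts fs] vf_diff[OF X f cst_smooth] vf_cst[OF X] p by (simp add: cst_def)
    moreover have "X (\<lambda>q. \<Sum>i<N. (coord i q - cst (co p i) q) * k i q) p = (\<Sum>i<N. k i p * X (coord i) p)"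
    proof -
      have "X (\<lambda>q. (coord i q - cst (co p i) q) * k i q) p = k i p * X (coord i) p" if "i < N" for i
        using vf_mult[OF X cs ks[OF that]] vf_diff[OF X coord_smooth cst_smooth] vf_cst[OF X] p
        by (simp add: cst_def coord_def)
      then show ?thesis
        by (subst vf_sum[OF X]) (auto intro!: mult_smooth cs ks)
    qed
    ultimately have "t p * X f p = (\<Sum>i<N. k i p * X (coord i) p)" using eq by simp
    moreover have "t p = th (co p)" using p by (simp add: t_def lift_def c_def)
    moreover have "k i p = th (co p) * pd i f p" if "i < N" for i
      using th(4)[OF that] p by (simp add: k_def lift_def c_def pd_def F_def[abs_def])
    ultimately have "th (co p) * X f p = th (co p) * (\<Sum>i<N. X (coord i) p * pd i f p)"
      by (simp add: sum_distrib_left mult_ac)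
    then show ?thesis using th(3) by simp
  qed
qed

lemma vf_eqI:
  assumes "X \<in> VF" "Y \<in> VF" "\<And>i. i < N \<Longrightarrow> X (coord i) = Y (coord i)"
  shows "X = Y"
proof
  fix f show "X f = Y f"
    using vf_expand[OF assms(1), of f] vf_expand[OF assms(2), of f] vf_off[OF assms(1)] vf_off[OF assms(2)] assms(3)
    by (cases "f \<in> SF") simp_all
qed

definition vf_of :: "(nat \<Rightarrow> 'a \<Rightarrow> real) \<Rightarrow> 'a vfield" where
  "vf_of u f = (if f \<in> SF then (\<lambda>p. \<Sum>i<N. u i p * pd i f p) else (\<lambda>p. 0))"

lemma vf_of:
  assumes u: "\<And>i. i < N \<Longrightarrow> u i \<in> SF"
  shows "vf_of u \<in> VF"
proof (rule vfieldI)
  show "vf_of u f \<in> SF" if "f \<in> SF" for f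
    unfolding vf_of_def if_P[OF that] using that u by (intro sum_smooth mult_smooth pd_smooth) auto
  show "vf_of u (\<lambda>p. f p + g p) = (\<lambda>p. vf_of u f p + vf_of u g p)" if "f \<in> SF" "g \<in> SF" for f g
    using that by (auto simp: vf_of_def pd_add add_smooth sum.distrib algebra_simps)
  show "vf_of u (\<lambda>p. c * f p) = (\<lambda>p. c * vf_of u f p)" if "f \<in> SF" for f c
    using that by (auto simp: vf_of_def pd_cmult cmult_smooth sum_distrib_left algebra_simps)
  show "vf_of u (\<lambda>p. f p * g p) = (\<lambda>p. f p * vf_of u g p + g p * vf_of u f p)" if "f \<in> SF" "g \<in> SF" for f g
    using that by (auto simp: vf_of_def pd_mult mult_smooth sum_distrib_left sum.distrib algebra_simps)
qed (auto simp: vf_of_def)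

lemma vf_of_coord: "j < N \<Longrightarrow> u j \<in> SF \<Longrightarrow> vf_of u (coord j) = u j"
proof
  fix p assume j: "j < N" and u: "u j \<in> SF"
  have "(\<Sum>i<N. u i p * pd i (coord j) p) = (\<Sum>i<N. if i = j then u i p * cst 1 p else 0)"
    by (rule sum.cong) (auto simp: pd_coord cst_def)
  then show "vf_of u (coord j) p = u j p"
    using j smooth_fun_off[OF u] by (auto simp: vf_of_def coord_smooth cst_def)
qed

lemma vf_plus: "X \<in> VF \<Longrightarrow> Y \<in> VF \<Longrightarrow> X + Y \<in> VF"
  by (rule vfieldI) (auto simp: vf_smooth vf_add vf_cmult vf_mult vf_off algebra_simps plus_fun_def)

lemma vf_fscale: "f \<in> SF \<Longrightarrow> X \<in> VF \<Longrightarrow> fscale f X \<in> VF"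
  by (rule vfieldI) (auto simp: fscale_def vf_smooth vf_add vf_cmult vf_mult vf_off algebra_simps times_fun_def)

lemma lie_bracket_apply: "lie_bracket X Y f = (\<lambda>p. X (Y f) p - Y (X f) p)"
  by (simp add: lie_bracket_def fun_diff_def)

lemma vf_lie_bracket:
  assumes X: "X \<in> VF" and Y: "Y \<in> VF"
  shows "lie_bracket X Y \<in> VF"
proof (rule vfieldI)
  note simps = lie_bracket_apply vf_smooth[OF X] vf_smooth[OF Y] vf_add[OF X] vf_add[OF Y]
    vf_cmult[OF X] vf_cmult[OF Y] vf_mult[OF X] vf_mult[OF Y] mult_smooth
  show "lie_bracket X Y f \<in> SF" if "f \<in> SF" for f
    using that by (auto simp: lie_bracket_apply intro!: diff_smooth vf_smooth[OF X] vf_smooth[OF Y])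
  show "lie_bracket X Y (\<lambda>p. f p + g p) = (\<lambda>p. lie_bracket X Y f p + lie_bracket X Y g p)"
    if "f \<in> SF" "g \<in> SF" for f g using that by (simp add: simps algebra_simps)
  show "lie_bracket X Y (\<lambda>p. c * f p) = (\<lambda>p. c * lie_bracket X Y f p)" if "f \<in> SF" for f c
    using that by (simp add: simps algebra_simps)
  show "lie_bracket X Y (\<lambda>p. f p * g p) = (\<lambda>p. f p * lie_bracket X Y g p + g p * lie_bracket X Y f p)"
    if "f \<in> SF" "g \<in> SF" for f g using that by (simp add: simps algebra_simps)
  show "lie_bracket X Y f = (\<lambda>p. 0)" if "f \<notin> SF" for f
    using that vf_cmult[OF X zero_smooth, of 0] vf_cmult[OF Y zero_smooth, of 0]
    by (simp add: lie_bracket_apply vf_off[OF X] vf_off[OF Y])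
qed

lemma sheet_open: "c \<in> C \<Longrightarrow> openin (mtop M) (sh c)"
  using charts by (simp add: is_chart_def)

end


context sheeted_manifold
begin

subsection \<open>Diffeomorphisms acting on functions, vector fields and connections\<close>

lemma openin_co_image:
  assumes c: "c \<in> C" and A: "openin (mtop M) A" "A \<subseteq> sh c"
  shows "openin (Euclidean_space N) (co ` A)"
proof -
  have "openin (subtopology (mtop M) (sh c)) A"
    using A unfolding openin_subtopology by (intro exI[of _ A]) auto
  moreover have "homeomorphic_map (subtopology (mtop M) (sh c)) (subtopology (Euclidean_space N) W) co"
    using charts[OF c] by (simp add: is_chart_def image_co[OF c])
  ultimately have "openin (subtopology (Euclidean_space N) W) (co ` A)"
    using homeomorphic_imp_open_map open_map_def by blast
  then show ?thesis using W_open openin_trans_full by blast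
qed

lemma pull_smooth:
  assumes phi: "smooth_map M M \<phi>" and f: "f \<in> SF"
  shows "pull_fun M \<phi> f \<in> SF"
proof (rule smooth_funI[where g = "\<lambda>c x. f (\<phi> (pt c x))"])
  have cont: "continuous_map (mtop M) (mtop M) \<phi>" using phi by (simp add: smooth_map_def)
  then have phi_in: "\<phi> p \<in> points M" if "p \<in> points M" for p
    using that by (auto simp: continuous_map_def)
  fix c assume c: "c \<in> C"
  show "C_inf_on N W (\<lambda>x. f (\<phi> (pt c x)))"
  proof (rule C_inf_local[OF W_open])
    fix x assume x: "x \<in> W"
    define d where "d = sheet (\<phi> (pt c x))"
    have d: "d \<in> C" using sheet_in phi_in pt_in c x by (simp add: d_def)
    define T where "T = co ` (sh c \<inter> \<phi> -` sh d)"
    have "openin (mtop M) {p \<in> points M. \<phi> p \<in> sh d}"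
      using openin_continuous_map_preimage[OF cont sheet_open[OF d]] .
    then have "openin (mtop M) (sh c \<inter> {p \<in> points M. \<phi> p \<in> sh d})"
      using sheet_open[OF c] by (rule openin_Int[rotated])
    moreover have "sh c \<inter> {p \<in> points M. \<phi> p \<in> sh d} = sh c \<inter> \<phi> -` sh d" by auto
    ultimately have To: "openin (Euclidean_space N) T"
      unfolding T_def using c by (intro openin_co_image) auto
    have TW: "T \<subseteq> W" by (auto simp: T_def co_in)
    have T_D: "sheet (\<phi> (pt c y)) = d" if "y \<in> T" for y
      using that by (auto simp: T_def pt_co)
    have "pt c x \<in> sh c \<inter> \<phi> -` sh d" using c x by (auto simp: pt_in sheet_pt phi_in d_def)
    then have xT: "x \<in> T" unfolding T_def using co_pt[OF c x] by force
    have "C_inf_on N T (\<lambda>y. f (\<phi> (pt c y)))"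
    proof (rule C_inf_cong[OF To])
      show "C_inf_on N T (\<lambda>y. f (pt d (co (\<phi> (pt c y)))))"
      proof (rule C_inf_compose[OF To W_open smooth_fun_C_inf[OF f d]])
        fix j assume j: "j < N"
        have "(sh c, co) \<in> matlas M" "(sh d, co) \<in> matlas M" using c d by (auto simp: atlas)
        then have "C_inf_on N T (\<lambda>x. co (\<phi> (inv_into (sh c) co x)) j)"
          using phi j unfolding smooth_map_def T_def by fastforce
        then show "C_inf_on N T (\<lambda>x. co (\<phi> (pt c x)) j)"
          by (rule C_inf_cong[OF To, rotated]) (use TW inv_into_co[OF c] in auto)
      qed (use TW c in \<open>auto intro!: co_in phi_in pt_in\<close>)
      show "f (pt d (co (\<phi> (pt c y)))) = f (\<phi> (pt c y))" if "y \<in> T" for y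
        using pt_co[of "\<phi> (pt c y)"] phi_in[OF pt_in[OF c]] T_D[OF that] TW that by auto
    qed
    then show "\<exists>T. openin (Euclidean_space N) T \<and> x \<in> T \<and> T \<subseteq> W \<and> C_inf_on N T (\<lambda>x. f (\<phi> (pt c x)))"
      using To xT TW by blast
  qed
qed (auto simp: pull_fun_def pt_in)

lemma
  assumes "diffeo M \<phi>"
  shows diffeo_in: "p \<in> points M \<Longrightarrow> \<phi> p \<in> points M"
    and diffeo_inv_in: "p \<in> points M \<Longrightarrow> inv_into (points M) \<phi> p \<in> points M"
    and diffeo_inv_left: "p \<in> points M \<Longrightarrow> inv_into (points M) \<phi> (\<phi> p) = p"
    and diffeo_inv_right: "p \<in> points M \<Longrightarrow> \<phi> (inv_into (points M) \<phi> p) = p"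
    and pull_diffeo: "f \<in> SF \<Longrightarrow> pull_fun M \<phi> f \<in> SF"
    and pull_diffeo_inv: "f \<in> SF \<Longrightarrow> pull_fun M (inv_into (points M) \<phi>) f \<in> SF"
proof -
  have bij: "bij_betw \<phi> (points M) (points M)" using assms by (simp add: diffeo_def Bij_def)
  show "p \<in> points M \<Longrightarrow> \<phi> p \<in> points M" using bij by (rule bij_betw_apply)
  show "p \<in> points M \<Longrightarrow> inv_into (points M) \<phi> p \<in> points M"
    using bij_betw_apply[OF bij_betw_inv_into[OF bij]] .
  show "p \<in> points M \<Longrightarrow> inv_into (points M) \<phi> (\<phi> p) = p" using bij by (rule bij_betw_inv_into_left)
  show "p \<in> points M \<Longrightarrow> \<phi> (inv_into (points M) \<phi> p) = p" using bij by (rule bij_betw_inv_into_right)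
  show "f \<in> SF \<Longrightarrow> pull_fun M \<phi> f \<in> SF" "f \<in> SF \<Longrightarrow> pull_fun M (inv_into (points M) \<phi>) f \<in> SF"
    using assms pull_smooth by (auto simp: diffeo_def)
qed

lemma push_field_apply:
  assumes "f \<in> SF"
  shows "push_field M \<phi> X f = pull_fun M (inv_into (points M) \<phi>) (X (pull_fun M \<phi> f))"
  using assms by (simp add: push_field_def)

lemma push_field_vf:
  assumes phi: "diffeo M \<phi>" and X: "X \<in> VF"
  shows "push_field M \<phi> X \<in> VF"
proof (rule vfieldI)
  let ?\<psi> = "inv_into (points M) \<phi>"
  note app = push_field_apply[of _ \<phi> X]
  have s: "\<And>f. f \<in> SF \<Longrightarrow> pull_fun M \<phi> f \<in> SF" using pull_diffeo[OF phi] .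
  have add: "pull_fun M \<theta> (\<lambda>p. f p + g p) = (\<lambda>p. pull_fun M \<theta> f p + pull_fun M \<theta> g p)" for \<theta> f g
    by (auto simp: pull_fun_def)
  have mult: "pull_fun M \<theta> (\<lambda>p. f p * g p) = (\<lambda>p. pull_fun M \<theta> f p * pull_fun M \<theta> g p)" for \<theta> f g
    by (auto simp: pull_fun_def)
  have cmult: "pull_fun M \<theta> (\<lambda>p. c * f p) = (\<lambda>p. c * pull_fun M \<theta> f p)" for \<theta> f c
    by (auto simp: pull_fun_def)
  show "push_field M \<phi> X f \<in> SF" if "f \<in> SF" for f
    unfolding app[OF that] using that by (intro pull_diffeo_inv[OF phi] vf_smooth[OF X] s)
  show "push_field M \<phi> X (\<lambda>p. f p + g p) = (\<lambda>p. push_field M \<phi> X f p + push_field M \<phi> X g p)"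
    if "f \<in> SF" "g \<in> SF" for f g
    using that by (simp add: app add_smooth add vf_add[OF X] s)
  show "push_field M \<phi> X (\<lambda>p. c * f p) = (\<lambda>p. c * push_field M \<phi> X f p)" if "f \<in> SF" for f c
    using that by (simp add: app cmult_smooth cmult vf_cmult[OF X] s)
  show "push_field M \<phi> X (\<lambda>p. f p * g p) = (\<lambda>p. f p * push_field M \<phi> X g p + g p * push_field M \<phi> X f p)"
    if "f \<in> SF" "g \<in> SF" for f g
  proof
    fix p
    show "push_field M \<phi> X (\<lambda>p. f p * g p) p = f p * push_field M \<phi> X g p + g p * push_field M \<phi> X f p"
    proof (cases "p \<in> points M")
      case True
      then show ?thesis
        using that diffeo_inv_in[OF phi True] diffeo_inv_right[OF phi True]
        by (simp add: app mult_smooth mult vf_mult[OF X] s) (simp add: pull_fun_def)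
    next
      case False
      then show ?thesis using that by (simp add: app mult_smooth pull_fun_def)
    qed
  qed
  show "push_field M \<phi> X f = (\<lambda>p. 0)" if "f \<notin> SF" for f
    using that by (simp add: push_field_def zero_fun_def)
qed

lemma pull_push:
  assumes phi: "diffeo M \<phi>" and X: "X \<in> VF" and f: "f \<in> SF"
  shows "pull_fun M \<phi> (push_field M \<phi> X f) = X (pull_fun M \<phi> f)"
proof
  fix p
  show "pull_fun M \<phi> (push_field M \<phi> X f) p = X (pull_fun M \<phi> f) p"
  proof (cases "p \<in> points M")
    case True
    have "pull_fun M \<phi> (push_field M \<phi> X f) p = push_field M \<phi> X f (\<phi> p)"
      using True by (simp add: pull_fun_def[of M \<phi> "push_field M \<phi> X f"])
    also have "\<dots> = X (pull_fun M \<phi> f) p"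
      using diffeo_in[OF phi True] diffeo_inv_left[OF phi True]
      by (simp add: push_field_apply[OF f] pull_fun_def[of M "inv_into (points M) \<phi>"])
    finally show ?thesis .
  next
    case False
    then show ?thesis
      using smooth_fun_off[OF vf_smooth[OF X pull_diffeo[OF phi f]]] by (simp add: pull_fun_def)
  qed
qed

text \<open>The functions with vanishing Hessian; \<open>D X Y h - X (Y h)\<close> is the Hessian up to sign.\<close>

definition affine_fun :: "('a vfield \<Rightarrow> 'a vfield \<Rightarrow> 'a vfield) \<Rightarrow> ('a \<Rightarrow> real) \<Rightarrow> bool" where
  "affine_fun D h \<longleftrightarrow> h \<in> SF \<and> (\<forall>X\<in>VF. \<forall>Y\<in>VF. D X Y h = X (Y h))"

lemma preserves_imp_affine_pull:
  assumes phi: "diffeo M \<phi>" and pres: "preserves_connection M D \<phi>"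
    and D: "\<And>X Y. X \<in> VF \<Longrightarrow> Y \<in> VF \<Longrightarrow> D X Y \<in> VF" and h: "affine_fun D h"
  shows "affine_fun D (pull_fun M \<phi> h)"
  unfolding affine_fun_def
proof (intro conjI ballI)
  have hs: "h \<in> SF" using h by (simp add: affine_fun_def)
  then show "pull_fun M \<phi> h \<in> SF" by (rule pull_diffeo[OF phi])
  fix X Y assume X: "X \<in> VF" and Y: "Y \<in> VF"
  let ?p = "push_field M \<phi>"
  note pX = push_field_vf[OF phi X] and pY = push_field_vf[OF phi Y]
  have "D X Y (pull_fun M \<phi> h) = pull_fun M \<phi> (?p (D X Y) h)"
    using pull_push[OF phi D[OF X Y] hs] by simp
  also have "?p (D X Y) h = D (?p X) (?p Y) h" using pres X Y by (simp add: preserves_connection_def)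
  also have "\<dots> = ?p X (?p Y h)" using h pX pY by (simp add: affine_fun_def)
  also have "pull_fun M \<phi> \<dots> = X (pull_fun M \<phi> (?p Y h))" using pull_push[OF phi X vf_smooth[OF pY hs]] .
  also have "pull_fun M \<phi> (?p Y h) = Y (pull_fun M \<phi> h)" using pull_push[OF phi Y hs] .
  finally show "D X Y (pull_fun M \<phi> h) = X (Y (pull_fun M \<phi> h))" .
qed

text \<open>
  On affine functions the connection is composition of derivations, which every diffeomorphism
  respects; so only the supply of affine functions matters.
\<close>

lemma preservesI_affine:
  assumes phi: "diffeo M \<phi>" and D: "\<And>X Y. X \<in> VF \<Longrightarrow> Y \<in> VF \<Longrightarrow> D X Y \<in> VF"
    and h: "\<And>h. h \<in> H \<Longrightarrow> affine_fun D h" "\<And>h. h \<in> H \<Longrightarrow> affine_fun D (pull_fun M \<phi> h)"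
    and sep: "\<And>Z Z'. Z \<in> VF \<Longrightarrow> Z' \<in> VF \<Longrightarrow> (\<And>h. h \<in> H \<Longrightarrow> Z h = Z' h) \<Longrightarrow> Z = Z'"
  shows "preserves_connection M D \<phi>"
  unfolding preserves_connection_def
proof (intro ballI sep)
  fix X Y assume X: "X \<in> VF" and Y: "Y \<in> VF"
  let ?p = "push_field M \<phi>"
  note pX = push_field_vf[OF phi X] and pY = push_field_vf[OF phi Y]
  show "?p (D X Y) \<in> VF" "D (?p X) (?p Y) \<in> VF"
    using push_field_vf[OF phi D[OF X Y]] D[OF pX pY] by auto
  fix g assume g: "g \<in> H"
  have gs: "g \<in> SF" using h(1)[OF g] by (simp add: affine_fun_def)
  have "D (?p X) (?p Y) g = ?p X (?p Y g)" using h(1)[OF g] pX pY by (simp add: affine_fun_def)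
  also have "\<dots> = pull_fun M (inv_into (points M) \<phi>) (X (Y (pull_fun M \<phi> g)))"
    using push_field_apply[OF vf_smooth[OF pY gs]] pull_push[OF phi Y gs] by simp
  also have "\<dots> = ?p (D X Y) g"
    using h(2)[OF g] X Y by (simp add: push_field_apply[OF gs] affine_fun_def)
  finally show "?p (D X Y) g = D (?p X) (?p Y) g" by simp
qed


subsection \<open>The flat connection of a sheeted manifold\<close>

text \<open>The coordinate fields are parallel for this connection.\<close>

definition flat_conn :: "'a vfield \<Rightarrow> 'a vfield \<Rightarrow> 'a vfield" where
  "flat_conn X Y = vf_of (\<lambda>i. X (Y (coord i)))"

lemma flat_conn_vf: "X \<in> VF \<Longrightarrow> Y \<in> VF \<Longrightarrow> flat_conn X Y \<in> VF"
  unfolding flat_conn_def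
  by (rule vf_of, rule vf_smooth, assumption, rule vf_smooth, assumption, rule coord_smooth)

lemma flat_conn_coord:
  "X \<in> VF \<Longrightarrow> Y \<in> VF \<Longrightarrow> i < N \<Longrightarrow> flat_conn X Y (coord i) = X (Y (coord i))"
  unfolding flat_conn_def by (simp add: vf_of_coord vf_smooth coord_smooth)

lemma fscale_apply: "fscale f X g = (\<lambda>p. f p * X g p)"
  by (simp add: fscale_def times_fun_def)

lemma vf_plus_apply: "(X + Y) g = (\<lambda>p. X g p + Y g p)" for X Y :: "'a vfield"
  by (simp add: plus_fun_def)

lemma plus_real_fun: "f + g = (\<lambda>p. f p + g p)" for f g :: "'a \<Rightarrow> real"
  by (simp add: plus_fun_def)

lemmas flat_conn_simps =
  vf_plus_apply fscale_apply flat_conn_coord vf_plus vf_fscale vf_smooth vf_add vf_mult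
  coord_smooth flat_conn_vf algebra_simps plus_real_fun

lemma linear_connection_flat_conn: "linear_connection M flat_conn"
  unfolding linear_connection_def
proof (intro conjI ballI)
  fix X X' Y assume *: "X \<in> VF" "X' \<in> VF" "Y \<in> VF"
  show "flat_conn (X + X') Y = flat_conn X Y + flat_conn X' Y"
    using * by (intro vf_eqI vf_plus flat_conn_vf) (simp_all add: flat_conn_simps)
next
  fix X Y Y' assume *: "X \<in> VF" "Y \<in> VF" "Y' \<in> VF"
  show "flat_conn X (Y + Y') = flat_conn X Y + flat_conn X Y'"
    using * by (intro vf_eqI vf_plus flat_conn_vf) (simp_all add: flat_conn_simps)
next
  fix f X Y assume *: "f \<in> SF" "X \<in> VF" "Y \<in> VF"
  show "flat_conn (fscale f X) Y = fscale f (flat_conn X Y)"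
    using * by (intro vf_eqI vf_plus vf_fscale flat_conn_vf) (simp_all add: flat_conn_simps)
  show "flat_conn X (fscale f Y) = fscale (X f) Y + fscale f (flat_conn X Y)"
    using * by (intro vf_eqI vf_plus vf_fscale flat_conn_vf vf_smooth[OF *(2)]) (simp_all add: flat_conn_simps)
qed (rule flat_conn_vf)

lemma torsion_free_flat_conn: "torsion_free M flat_conn"
  unfolding torsion_free_def
proof (intro ballI)
  fix X Y assume *: "X \<in> VF" "Y \<in> VF"
  have "flat_conn X Y = flat_conn Y X + lie_bracket X Y"
    using * by (intro vf_eqI vf_plus flat_conn_vf vf_lie_bracket)
      (simp_all add: flat_conn_coord plus_real_fun lie_bracket_apply)
  then show "flat_conn X Y - flat_conn Y X - lie_bracket X Y = 0" by simp
qed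

lemma flat_flat_conn: "flat M flat_conn"
  unfolding flat_def
proof (intro ballI)
  fix X Y Z assume *: "X \<in> VF" "Y \<in> VF" "Z \<in> VF"
  have "flat_conn X (flat_conn Y Z) = flat_conn Y (flat_conn X Z) + flat_conn (lie_bracket X Y) Z"
    using * by (intro vf_eqI vf_plus flat_conn_vf vf_lie_bracket)
      (simp_all add: flat_conn_coord plus_real_fun lie_bracket_apply flat_conn_vf vf_lie_bracket)
  then show "flat_conn X (flat_conn Y Z) - flat_conn Y (flat_conn X Z) - flat_conn (lie_bracket X Y) Z = 0"
    by simp
qed

text \<open>Expanding \<open>Y h\<close> in partial derivatives, the second derivatives are the only obstruction.\<close>

lemma affine_flat_conn:
  assumes h: "h \<in> SF" and hess: "\<And>i j. i < N \<Longrightarrow> j < N \<Longrightarrow> pd j (pd i h) = (\<lambda>p. 0)"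
  shows "affine_fun flat_conn h"
  unfolding affine_fun_def
proof (intro conjI ballI h)
  fix X Y assume X: "X \<in> VF" and Y: "Y \<in> VF"
  have Xpd: "X (pd i h) = (\<lambda>p. 0)" if "i < N" for i
    by (subst vf_expand[OF X pd_smooth[OF h that]]) (simp add: hess that)
  have "X (Y h) = X (\<lambda>p. \<Sum>i<N. Y (coord i) p * pd i h p)" using vf_expand[OF Y h] by simp
  also have "\<dots> = (\<lambda>p. \<Sum>i<N. X (\<lambda>p. Y (coord i) p * pd i h p) p)"
    using h by (intro vf_sum[OF X] mult_smooth vf_smooth[OF Y] coord_smooth pd_smooth) auto
  also have "\<dots> = (\<lambda>p. \<Sum>i<N. X (Y (coord i)) p * pd i h p)"
    using h by (intro ext sum.cong)
      (simp_all add: vf_mult[OF X vf_smooth[OF Y coord_smooth] pd_smooth] Xpd)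
  finally show "flat_conn X Y h = X (Y h)" using h by (simp add: flat_conn_def vf_of_def)
qed

lemma affine_flat_conn_coord: "i < N \<Longrightarrow> affine_fun flat_conn (coord i)"
  by (rule affine_flat_conn) (auto simp: pd_coord pd_cst)

lemma smooth_manifold_sheeted:
  assumes "Hausdorff_space (mtop M)" "second_countable (mtop M)"
  shows "smooth_manifold M"
proof -
  have "C_inf_on N (co ` (sh c \<inter> sh d)) (\<lambda>x. co (inv_into (sh c) co x) i)" if "c \<in> C" "d \<in> C" for c d i
  proof (cases "c = d")
    case True
    then have "co ` (sh c \<inter> sh d) = W" using image_co[OF that(1)] by simp
    then show ?thesis
      using C_inf_cong[OF W_open _ C_inf_coord[OF W_open, of i]] inv_into_co[OF that(1)] co_pt[OF that(1)] by simp
  next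
    case False
    then have e: "co ` (sh c \<inter> sh d) = {}" by auto
    have o: "openin (Euclidean_space N) {}" by simp
    show ?thesis unfolding e by (rule C_inf_cong[OF o _ C_inf_const[OF o]]) auto
  qed
  moreover have "(\<Union>c\<in>C. sh c) = points M" using sheet_in by auto
  ultimately show ?thesis
    unfolding smooth_manifold_def atlas using assms charts by auto
qed

lemma smooth_mapI_sheets:
  assumes cont: "continuous_map (mtop M) (mtop M) \<phi>"
    and sheet: "\<And>c x. c \<in> C \<Longrightarrow> x \<in> W \<Longrightarrow> sheet (\<phi> (pt c x)) = \<tau> c"
    and smooth: "\<And>c i. c \<in> C \<Longrightarrow> i < N \<Longrightarrow> C_inf_on N W (\<lambda>x. co (\<phi> (pt c x)) i)"
  shows "smooth_map M M \<phi>"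
proof -
  have "C_inf_on N (co ` (sh c \<inter> \<phi> -` sh d)) (\<lambda>x. co (\<phi> (inv_into (sh c) co x)) i)"
    if c: "c \<in> C" and d: "d \<in> C" and i: "i < N" for c d i
  proof (cases "d = \<tau> c")
    case True
    have "\<phi> p \<in> sh d" if "p \<in> sh c" for p
    proof -
      have "\<phi> p \<in> points M" using cont that by (auto simp: continuous_map_def)
      then show ?thesis using sheet[OF c co_in, of p] that pt_co[of p] True by auto
    qed
    then have "sh c \<inter> \<phi> -` sh d = sh c" by auto
    then have e: "co ` (sh c \<inter> \<phi> -` sh d) = W" using image_co[OF c] by simp
    show ?thesis unfolding e
      by (rule C_inf_cong[OF W_open _ smooth[OF c i]]) (simp add: inv_into_co[OF c])
  next
    case False
    have "sh c \<inter> \<phi> -` sh d = {}"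
    proof -
      have "\<phi> p \<notin> sh d" if "p \<in> sh c" for p
        using sheet[OF c co_in, of p] that pt_co[of p] False by auto
      then show ?thesis by auto
    qed
    then have e: "co ` (sh c \<inter> \<phi> -` sh d) = {}" by simp
    have o: "openin (Euclidean_space N) {}" by simp
    show ?thesis unfolding e by (rule C_inf_cong[OF o _ C_inf_const[OF o]]) auto
  qed
  then show ?thesis unfolding smooth_map_def atlas using cont by auto
qed

text \<open>The coefficients may differ from sheet to sheet.\<close>

lemma affine_flat_conn_if_affine_in_coordinates:
  assumes off: "\<And>p. p \<notin> points M \<Longrightarrow> h p = 0"
    and aff: "\<And>c. c \<in> C \<Longrightarrow> \<exists>a b. \<forall>x\<in>W. h (pt c x) = a + (\<Sum>l<N. b l * x l)"
  shows "affine_fun flat_conn h"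
proof -
  have "\<forall>c\<in>C. \<exists>ab. \<forall>x\<in>W. h (pt c x) = fst ab + (\<Sum>l<N. snd ab l * x l)"
    using aff by (metis fst_conv snd_conv)
  then obtain ab where ab: "\<And>c x. c \<in> C \<Longrightarrow> x \<in> W \<Longrightarrow> h (pt c x) = fst (ab c) + (\<Sum>l<N. snd (ab c) l * x l)"
    by metis
  have lin_smooth: "C_inf_on N W (\<lambda>x. fst (ab c) + (\<Sum>l<N. snd (ab c) l * x l))" for c
    by (intro C_inf_add C_inf_sum C_inf_mult C_inf_const C_inf_coord W_open)
  have hs: "h \<in> SF"
    by (rule smooth_funI[OF lin_smooth ab off])
  have pd1: "pd i h (pt c x) = snd (ab c) i" if c: "c \<in> C" and x: "x \<in> W" and i: "i < N" for i c x
  proof -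
    have "pd i h (pt c x) = partial i (\<lambda>x. fst (ab c) + (\<Sum>l<N. snd (ab c) l * x l)) x"
      unfolding pd_pt[OF c x] by (rule partial_cong[OF W_open x i]) (rule ab[OF c])
    also have "\<dots> = snd (ab c) i"
    proof (rule partial_eqI)
      have "((\<lambda>t. fst (ab c) + (\<Sum>l<N. snd (ab c) l * (x(i := t)) l)) has_field_derivative
          0 + (\<Sum>l<N. snd (ab c) l * (if l = i then 1 else 0))) (at (x i))"
        by (intro DERIV_add DERIV_const DERIV_sum DERIV_cmult) (auto simp: fun_upd_def)
      moreover have "(\<Sum>l<N. snd (ab c) l * (if l = i then 1 else 0)) = snd (ab c) i"
        using i by (simp add: if_distrib cong: if_cong)
      ultimately show "((\<lambda>t. fst (ab c) + (\<Sum>l<N. snd (ab c) l * (x(i := t)) l)) has_field_derivative snd (ab c) i) (at (x i))"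
        by simp
    qed
    finally show ?thesis .
  qed
  show ?thesis
  proof (rule affine_flat_conn[OF hs])
    fix i j assume ij: "i < N" "j < N"
    show "pd j (pd i h) = (\<lambda>p. 0)"
    proof
      fix p
      show "pd j (pd i h) p = 0"
      proof (cases "p \<in> points M")
        case True
        have "partial j (\<lambda>x. pd i h (pt (sheet p) x)) (co p) = partial j (\<lambda>x. snd (ab (sheet p)) i) (co p)"
          by (rule partial_cong[OF W_open co_in[OF True] ij(2)]) (simp add: pd1 sheet_in[OF True] ij)
        then show ?thesis using True by (simp add: pd_def[of j] partial_def)
      qed (simp add: pd_def)
    qed
  qed
qed

end


section \<open>The affine group of the line as a manifold\<close>

abbreviation "GM \<equiv> Aff_line_manifold"

definition gco :: "real \<times> real \<Rightarrow> nat \<Rightarrow> real" where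
  "gco = (\<lambda>(a, b) i. if i = 0 then a else if i = 1 then b else 0)"

definition gW :: "(nat \<Rightarrow> real) set" where
  "gW = {x \<in> Eset 2. x 0 \<noteq> 0}"

lemma mdim_GM [simp]: "mdim GM = 2"
  by (simp add: Aff_line_manifold_def)

lemma points_GM: "points GM = {p. fst p \<noteq> 0}"
  by (auto simp: Aff_line_manifold_def)

lemma mtop_GM: "mtop GM = top_of_set {p. fst p \<noteq> 0}"
  by (auto simp: Aff_line_manifold_def case_prod_unfold)

lemma Eset_2_eqI: "x \<in> Eset 2 \<Longrightarrow> y \<in> Eset 2 \<Longrightarrow> x 0 = y 0 \<Longrightarrow> x (Suc 0) = y (Suc 0) \<Longrightarrow> x = y"
proof
  fix i assume *: "x \<in> Eset 2" "y \<in> Eset 2" "x 0 = y 0" "x (Suc 0) = y (Suc 0)"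
  consider "i = 0" | "i = Suc 0" | "i \<ge> 2" by linarith
  then show "x i = y i" by cases (use * in auto)
qed

lemma gco_simps [simp]: "gco p 0 = fst p" "gco p (Suc 0) = snd p" "gco p \<in> Eset 2"
  by (auto simp: gco_def case_prod_unfold)

lemma gco_pair: "x \<in> Eset 2 \<Longrightarrow> gco (x 0, x (Suc 0)) = x"
  by (rule Eset_2_eqI) (use gco_simps(3) in auto)

lemma continuous_on_gco: "continuous_on A gco"
proof (rule continuous_on_coordinatewise_then_product)
  fix i
  consider "i = 0" | "i = Suc 0" | "i \<ge> 2" by linarith
  then show "continuous_on A (\<lambda>p. gco p i)"
    by cases (auto simp: gco_def case_prod_unfold intro!: continuous_intros)
qed

lemma openin_Eset_2: "open (S :: (real \<times> real) set) \<Longrightarrow> openin (Euclidean_space 2) {x \<in> Eset 2. (x 0, x (Suc 0)) \<in> S}"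
proof -
  assume S: "open S"
  have c: "continuous_on (Eset 2) (\<lambda>x. (x 0, x (Suc 0)))"
    by (intro continuous_on_Pair continuous_on_product_then_coordinatewise[OF continuous_on_id])
  have "openin (Euclidean_space 2) (Eset 2)" by (simp add: Euclidean_space_top_of_set)
  from openin_Euclidean_preimage[OF this c S] show ?thesis .
qed

lemma gW_alt: "gW = {x \<in> Eset 2. (x 0, x (Suc 0)) \<in> {p. fst p \<noteq> 0}}"
  by (simp add: gW_def)

lemma open_fst_nonzero: "open {p :: real \<times> real. fst p \<noteq> 0}"
  by (intro open_Collect_neq continuous_intros)

lemma gW_open: "openin (Euclidean_space 2) gW"
  unfolding gW_alt by (intro openin_Eset_2 open_fst_nonzero)

lemma gco_image: "gco ` {p. fst p \<noteq> 0} = gW"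
proof
  show "gW \<subseteq> gco ` {p. fst p \<noteq> 0}"
  proof
    fix x assume x: "x \<in> gW"
    then have "x = gco (x 0, x (Suc 0))" by (simp add: gW_def gco_pair)
    then show "x \<in> gco ` {p. fst p \<noteq> 0}" using x by (intro image_eqI) (auto simp: gW_def)
  qed
qed (use gco_simps(3) in \<open>auto simp: gW_def\<close>)

lemma gco_chart: "is_chart 2 (mtop GM) {p. fst p \<noteq> 0} gco"
proof -
  have sub: "subtopology (Euclidean_space 2) gW = top_of_set gW"
    by (rule subtopology_Euclidean_eq[OF gW_open])
  have "continuous_on {p. fst p \<noteq> 0} gco" by (rule continuous_on_gco)
  moreover have "continuous_on gW (\<lambda>x. (x 0, x (Suc 0)))"
    by (intro continuous_on_Pair continuous_on_product_then_coordinatewise[OF continuous_on_id])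
  ultimately have "homeomorphic_maps (top_of_set {p. fst p \<noteq> 0}) (top_of_set gW) gco (\<lambda>x. (x 0, x (Suc 0)))"
    unfolding homeomorphic_maps_def using gco_image by (auto simp: gW_def gco_pair)
  then have "homeomorphic_map (mtop GM) (subtopology (Euclidean_space 2) gW) gco"
    unfolding sub mtop_GM by (meson homeomorphic_map_maps)
  moreover have "subtopology (mtop GM) {p. fst p \<noteq> 0} = mtop GM"
    by (simp add: mtop_GM subtopology_subtopology)
  moreover have "openin (mtop GM) {p. fst p \<noteq> 0}" by (simp add: mtop_GM)
  ultimately show ?thesis using gW_open by (simp add: is_chart_def gco_image)
qed

interpretation G: sheeted_manifold GM "\<lambda>_. ()" gco UNIV gW "\<lambda>_ x. (x 0, x (Suc 0))"
proof
  show "openin (Euclidean_space (mdim GM)) gW" by (simp add: gW_open)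
  show "matlas GM = (\<lambda>c. ({p \<in> points GM. () = c}, gco)) ` UNIV"
    unfolding points_GM by (auto simp: Aff_line_manifold_def gco_def case_prod_unfold)
  show "is_chart (mdim GM) (mtop GM) {p \<in> points GM. () = c} gco" for c
    using gco_chart by (simp add: points_GM)
qed (use gco_simps(3) in \<open>auto simp: points_GM gW_def gco_pair\<close>)

lemma less_2: "i < (2::nat) \<longleftrightarrow> i = 0 \<or> i = Suc 0"
  by auto

lemma sum_2: "(\<Sum>i<2. f i) = f 0 + f (Suc 0)" for f :: "nat \<Rightarrow> 'b::comm_monoid_add"
  by (simp add: numeral_2_eq_2)

lemma G_smooth_iff: "f \<in> G.SF \<longleftrightarrow> C_inf_on 2 gW (\<lambda>x. f (x 0, x (Suc 0))) \<and> (\<forall>p. fst p = 0 \<longrightarrow> f p = 0)"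
  by (simp add: G.smooth_funs_iff points_GM)

lemma G_pd_0: "a \<noteq> 0 \<Longrightarrow> ((\<lambda>t. f (t, b)) has_field_derivative d) (at a) \<Longrightarrow> G.pd 0 f (a, b) = d"
  by (rule G.pd_eqI) (simp_all add: points_GM)

lemma G_pd_1: "a \<noteq> 0 \<Longrightarrow> ((\<lambda>t. f (a, t)) has_field_derivative d) (at b) \<Longrightarrow> G.pd (Suc 0) f (a, b) = d"
  by (rule G.pd_eqI) (simp_all add: points_GM)

lemma G_has_pd_0: "f \<in> G.SF \<Longrightarrow> a \<noteq> 0 \<Longrightarrow> ((\<lambda>t. f (t, b)) has_field_derivative G.pd 0 f (a, b)) (at a)"
  using G.has_pd_at[of f 0 "(a, b)"] by (simp add: points_GM)

lemma G_has_pd_1: "f \<in> G.SF \<Longrightarrow> a \<noteq> 0 \<Longrightarrow> ((\<lambda>t. f (a, t)) has_field_derivative G.pd (Suc 0) f (a, b)) (at b)"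
  using G.has_pd_at[of f "Suc 0" "(a, b)"] by (simp add: points_GM)

lemma G_cst: "G.cst c p = (if fst p \<noteq> 0 then c else 0)"
  by (simp add: G.cst_def points_GM)

lemma G_coord: "G.coord 0 p = fst p" "G.coord (Suc 0) p = (if fst p \<noteq> 0 then snd p else 0)"
  by (simp_all add: G.coord_def points_GM)


subsection \<open>Diffeomorphisms in coordinates\<close>

lemma G_smooth_mapI:
  assumes "\<And>p. fst p \<noteq> 0 \<Longrightarrow> fst (\<phi> p) \<noteq> 0"
    and s: "C_inf_on 2 gW (\<lambda>x. fst (\<phi> (x 0, x (Suc 0))))" "C_inf_on 2 gW (\<lambda>x. snd (\<phi> (x 0, x (Suc 0))))"
  shows "smooth_map GM GM \<phi>"
proof -
  have "continuous_on {p. fst p \<noteq> 0} (\<lambda>p. u (\<phi> p))" if "C_inf_on 2 gW (\<lambda>x. u (\<phi> (x 0, x (Suc 0))))"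
    for u :: "real \<times> real \<Rightarrow> real"
  proof -
    have "continuous_on {p. fst p \<noteq> 0} (\<lambda>p. u (\<phi> (gco p 0, gco p (Suc 0))))"
      by (rule continuous_on_compose2[OF C_inf_continuous[OF gW_open that] continuous_on_gco])
         (use gco_image in blast)
    then show ?thesis by simp
  qed
  from continuous_on_Pair[OF this[OF s(1)] this[OF s(2)]]
  have cont: "continuous_map (mtop GM) (mtop GM) \<phi>"
    unfolding mtop_GM using assms(1) by auto
  have "C_inf_on 2 gW (\<lambda>x. gco (\<phi> (inv_into {p. fst p \<noteq> 0} gco x)) i)" if "i < 2" for i
  proof (rule C_inf_cong[OF gW_open])
    show "C_inf_on 2 gW (\<lambda>x. gco (\<phi> (x 0, x (Suc 0))) i)" using that s by (auto simp: less_2)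
    show "gco (\<phi> (x 0, x (Suc 0))) i = gco (\<phi> (inv_into {p. fst p \<noteq> 0} gco x)) i" if "x \<in> gW" for x
      using G.inv_into_co[OF _ that, of "()"] by (simp add: points_GM)
  qed
  moreover have "gco ` ({p. fst p \<noteq> 0} \<inter> \<phi> -` {p. fst p \<noteq> 0}) = gW"
    using assms(1) gco_image by (metis (mono_tags, lifting) Int_absorb2 mem_Collect_eq subsetI vimageI)
  ultimately show ?thesis
    using cont unfolding smooth_map_def G.atlas by (simp add: points_GM)
qed

lemma G_diffeoI:
  assumes ext: "\<phi> \<in> extensional {p. fst p \<noteq> 0}"
    and inP: "\<And>p. fst p \<noteq> 0 \<Longrightarrow> fst (\<phi> p) \<noteq> 0" "\<And>p. fst p \<noteq> 0 \<Longrightarrow> fst (\<psi> p) \<noteq> 0"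
    and inv: "\<And>p. fst p \<noteq> 0 \<Longrightarrow> \<psi> (\<phi> p) = p" "\<And>p. fst p \<noteq> 0 \<Longrightarrow> \<phi> (\<psi> p) = p"
    and s: "C_inf_on 2 gW (\<lambda>x. fst (\<phi> (x 0, x (Suc 0))))" "C_inf_on 2 gW (\<lambda>x. snd (\<phi> (x 0, x (Suc 0))))"
      "C_inf_on 2 gW (\<lambda>x. fst (\<psi> (x 0, x (Suc 0))))" "C_inf_on 2 gW (\<lambda>x. snd (\<psi> (x 0, x (Suc 0))))"
  shows "diffeo GM \<phi>" "\<And>p. fst p \<noteq> 0 \<Longrightarrow> inv_into (points GM) \<phi> p = \<psi> p"
proof -
  have bij: "bij_betw \<phi> {p. fst p \<noteq> 0} {p. fst p \<noteq> 0}"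
    by (rule bij_betwI[where g = \<psi>]) (use inP inv in auto)
  show eq: "inv_into (points GM) \<phi> p = \<psi> p" if "fst p \<noteq> 0" for p
  proof -
    have "inv_into {p. fst p \<noteq> 0} \<phi> (\<phi> (\<psi> p)) = \<psi> p"
      using inv_into_f_f[OF bij_betw_imp_inj_on[OF bij], of "\<psi> p"] inP(2)[OF that] by simp
    then show ?thesis using inv(2)[OF that] by (simp add: points_GM)
  qed
  have gx: "fst (x 0, x (Suc 0)) \<noteq> 0" if "x \<in> gW" for x :: "nat \<Rightarrow> real" using that by (simp add: gW_def)
  have "smooth_map GM GM (inv_into (points GM) \<phi>)"
    by (rule G_smooth_mapI)
       (use inP eq C_inf_cong[OF gW_open _ s(3)] C_inf_cong[OF gW_open _ s(4)] gx in auto)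
  then show "diffeo GM \<phi>"
    unfolding diffeo_def Bij_def using ext bij G_smooth_mapI[OF inP(1) s(1,2)] by (simp add: points_GM)
qed


subsection \<open>Left translations and the left invariant frame\<close>

lemma carrier_Aff_line: "carrier Aff_line = {p. fst p \<noteq> 0}"
  by (auto simp: Aff_line_def)

lemma left_translation_Aff:
  "fst p \<noteq> 0 \<Longrightarrow> left_translation Aff_line g p = (fst g * fst p, fst g * snd p + snd g)"
  by (auto simp: left_translation_def Aff_line_def case_prod_unfold)

lemma left_translation_diffeo:
  assumes g: "fst g \<noteq> 0"
  shows "diffeo GM (left_translation Aff_line g)"
proof (rule G_diffeoI(1)[where \<psi> = "\<lambda>p. (fst p / fst g, (snd p - snd g) / fst g)"])
  have e: "\<And>x. x \<in> gW \<Longrightarrow> left_translation Aff_line g (x 0, x (Suc 0)) = (fst g * x 0, fst g * x (Suc 0) + snd g)"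
    by (simp add: gW_def left_translation_Aff)
  show "left_translation Aff_line g \<in> extensional {p. fst p \<noteq> 0}"
    by (simp add: left_translation_def carrier_Aff_line)
  show "C_inf_on 2 gW (\<lambda>x. fst (left_translation Aff_line g (x 0, x (Suc 0))))"
    by (rule C_inf_cong[OF gW_open, of "\<lambda>x. fst g * x 0"]) (auto simp: e intro!: C_inf_intros gW_open)
  show "C_inf_on 2 gW (\<lambda>x. snd (left_translation Aff_line g (x 0, x (Suc 0))))"
    by (rule C_inf_cong[OF gW_open, of "\<lambda>x. fst g * x (Suc 0) + snd g"]) (auto simp: e intro!: C_inf_intros gW_open)
  show "C_inf_on 2 gW (\<lambda>x. fst (fst (x 0, x (Suc 0)) / fst g, (snd (x 0, x (Suc 0)) - snd g) / fst g))"
    "C_inf_on 2 gW (\<lambda>x. snd (fst (x 0, x (Suc 0)) / fst g, (snd (x 0, x (Suc 0)) - snd g) / fst g))"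
    using g by (auto intro!: C_inf_intros gW_open)
qed (use g in \<open>auto simp: left_translation_Aff\<close>)

lemma pull_left_translation:
  "pull_fun GM (left_translation Aff_line g) (G.coord 0) = (\<lambda>p. fst g * G.coord 0 p)"
  "fst g \<noteq> 0 \<Longrightarrow> pull_fun GM (left_translation Aff_line g) (G.coord (Suc 0)) =
     (\<lambda>p. fst g * G.coord (Suc 0) p + G.cst (snd g) p)"
  by (auto simp: pull_fun_def points_GM G_coord G_cst left_translation_Aff)

text \<open>\<open>E 0\<close> is \<open>a \<partial>/\<partial>a\<close> and \<open>E 1\<close> is \<open>a \<partial>/\<partial>b\<close>.\<close>

definition E :: "nat \<Rightarrow> (real \<times> real) vfield" where
  "E j = G.vf_of (\<lambda>i. if i = j then G.coord 0 else (\<lambda>p. 0))"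

lemma E_vf: "E j \<in> G.VF"
  unfolding E_def by (rule G.vf_of) (auto simp: G.zero_smooth G.coord_smooth)

lemma E_apply: "f \<in> G.SF \<Longrightarrow> j < 2 \<Longrightarrow> E j f = (\<lambda>p. fst p * G.pd j f p)"
  unfolding E_def G.vf_of_def by (auto simp: G_coord sum_2 less_2)

lemma E_coord:
  "E 0 (G.coord 0) = G.coord 0" "E 0 (G.coord (Suc 0)) = (\<lambda>p. 0)"
  "E (Suc 0) (G.coord 0) = (\<lambda>p. 0)" "E (Suc 0) (G.coord (Suc 0)) = G.coord 0"
  by (auto simp: E_apply G.coord_smooth G.pd_coord G_cst G_coord fun_eq_iff)

text \<open>Since the coefficients are functions, every vector field has this form.\<close>

definition lc :: "(real \<times> real \<Rightarrow> real) \<Rightarrow> (real \<times> real \<Rightarrow> real) \<Rightarrow> (real \<times> real) vfield" where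
  "lc u v = fscale u (E 0) + fscale v (E (Suc 0))"

lemma lc_apply: "lc u v f = (\<lambda>p. u p * E 0 f p + v p * E (Suc 0) f p)"
  by (simp add: lc_def G.vf_plus_apply G.fscale_apply G.plus_real_fun)

lemma lc_vf: "u \<in> G.SF \<Longrightarrow> v \<in> G.SF \<Longrightarrow> lc u v \<in> G.VF"
  unfolding lc_def by (intro G.vf_plus G.vf_fscale E_vf)

lemma G_vf_eqI:
  "X \<in> G.VF \<Longrightarrow> Y \<in> G.VF \<Longrightarrow> X (G.coord 0) = Y (G.coord 0) \<Longrightarrow> X (G.coord (Suc 0)) = Y (G.coord (Suc 0)) \<Longrightarrow> X = Y"
  by (rule G.vf_eqI) (auto simp: less_2)

lemma inverse_coord_smooth: "(\<lambda>p. inverse (fst p)) \<in> G.SF"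
  unfolding G_smooth_iff fst_conv
  by (rule conjI, rule C_inf_inverse[OF gW_open C_inf_coord[OF gW_open]]) (auto simp: gW_def)

lemma ex_lc:
  assumes X: "X \<in> G.VF"
  obtains u v where "u \<in> G.SF" "v \<in> G.SF" "X = lc u v"
proof -
  let ?u = "\<lambda>p. inverse (fst p) * X (G.coord 0) p" and ?v = "\<lambda>p. inverse (fst p) * X (G.coord (Suc 0)) p"
  have s: "?u \<in> G.SF" "?v \<in> G.SF"
    using G.mult_smooth[OF inverse_coord_smooth G.vf_smooth[OF X G.coord_smooth]] by auto
  have off: "X (G.coord j) p = 0" if "fst p = 0" for j p
    using G.smooth_fun_off[OF G.vf_smooth[OF X G.coord_smooth], of p] that by (simp add: points_GM)
  have "X = lc ?u ?v"
    by (rule G_vf_eqI[OF X lc_vf[OF s]]) (auto simp: lc_apply E_coord G_coord off fun_eq_iff field_simps)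
  then show thesis using that s by blast
qed

lemma lie_bracket_E: "lie_bracket (E 0) (E (Suc 0)) = E (Suc 0)"
proof -
  have "E j (\<lambda>p. 0) = (\<lambda>p. 0)" for j using G.vf_cmult[OF E_vf G.zero_smooth, of j 0] by simp
  then show ?thesis
    by (intro G_vf_eqI G.vf_lie_bracket E_vf) (simp_all add: G.lie_bracket_apply E_coord)
qed

lemma push_left_translation_E:
  assumes g: "fst g \<noteq> 0" and j: "j < 2"
  shows "push_field GM (left_translation Aff_line g) (E j) = E j"
proof (rule G_vf_eqI[OF G.push_field_vf[OF left_translation_diffeo[OF g] E_vf] E_vf])
  note d = left_translation_diffeo[OF g]
  have *: "push_field GM (left_translation Aff_line g) (E j) f q = E j f q"
    if f: "f \<in> G.SF" and h: "E j (pull_fun GM (left_translation Aff_line g) f) = (\<lambda>p. fst g * E j f p)"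
      and lin: "\<And>p. fst p \<noteq> 0 \<Longrightarrow> E j f (left_translation Aff_line g p) = fst g * E j f p" for f q
  proof (cases "q \<in> points GM")
    case True
    let ?p = "inv_into (points GM) (left_translation Aff_line g) q"
    have p: "?p \<in> points GM" "left_translation Aff_line g ?p = q"
      using G.diffeo_inv_in[OF d True] G.diffeo_inv_right[OF d True] .
    have "push_field GM (left_translation Aff_line g) (E j) f q = fst g * E j f ?p"
      using True by (simp add: G.push_field_apply[OF f] h pull_fun_def[of GM "inv_into _ _"])
    also have "\<dots> = E j f q" using lin[of ?p] p by (simp add: points_GM)
    finally show ?thesis .
  next
    case False
    then show ?thesis
      using G.smooth_fun_off[OF G.vf_smooth[OF E_vf f]] by (simp add: G.push_field_apply[OF f] pull_fun_def)
  qed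
  have E0: "E j (\<lambda>p. fst g * G.coord 0 p) = (\<lambda>p. fst g * E j (G.coord 0) p)"
    by (rule G.vf_cmult[OF E_vf G.coord_smooth])
  have E1: "E j (\<lambda>p. fst g * G.coord (Suc 0) p + G.cst (snd g) p) = (\<lambda>p. fst g * E j (G.coord (Suc 0)) p)"
    by (simp add: G.vf_add[OF E_vf G.cmult_smooth[OF G.coord_smooth] G.cst_smooth]
        G.vf_cmult[OF E_vf G.coord_smooth] G.vf_cst[OF E_vf])
  have L: "E j (G.coord k) (left_translation Aff_line g p) = fst g * E j (G.coord k) p"
    if "k < 2" "fst p \<noteq> 0" for k p
    using that j by (auto simp: less_2 E_coord G_coord left_translation_Aff)
  show "push_field GM (left_translation Aff_line g) (E j) (G.coord 0) = E j (G.coord 0)"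
    by (rule ext, rule *) (use L E0 in \<open>auto simp: pull_left_translation G.coord_smooth\<close>)
  show "push_field GM (left_translation Aff_line g) (E j) (G.coord (Suc 0)) = E j (G.coord (Suc 0))"
    by (rule ext, rule *) (use L E1 g in \<open>auto simp: pull_left_translation G.coord_smooth\<close>)
qed

text \<open>Translating the value at the unit shows that the coefficients are constant.\<close>

lemma left_invariant_field:
  assumes Z: "Z \<in> G.VF"
    and inv: "\<And>g. fst g \<noteq> 0 \<Longrightarrow> push_field GM (left_translation Aff_line g) Z = Z"
  shows "Z = lc (G.cst (Z (G.coord 0) (1, 0))) (G.cst (Z (G.coord (Suc 0)) (1, 0)))"
proof -
  have at: "Z f g = Z (pull_fun GM (left_translation Aff_line g) f) (1, 0)" if g: "fst g \<noteq> 0" and f: "f \<in> G.SF" for f g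
  proof -
    have "pull_fun GM (left_translation Aff_line g) (Z f) (1, 0) = Z (pull_fun GM (left_translation Aff_line g) f) (1, 0)"
      using G.pull_push[OF left_translation_diffeo[OF g] Z f] inv[OF g] by simp
    then show ?thesis by (simp add: pull_fun_def points_GM left_translation_Aff)
  qed
  have off: "Z (G.coord j) p = 0" if "fst p = 0" for j p
    using G.smooth_fun_off[OF G.vf_smooth[OF Z G.coord_smooth], of p] that by (simp add: points_GM)
  have 0: "Z (G.coord 0) g = fst g * Z (G.coord 0) (1, 0)" for g
  proof (cases "fst g = 0")
    case False
    show ?thesis
      by (subst at[OF False G.coord_smooth])
         (simp add: pull_left_translation G.vf_cmult[OF Z G.coord_smooth])
  qed (simp add: off)
  have 1: "Z (G.coord (Suc 0)) g = fst g * Z (G.coord (Suc 0)) (1, 0)" for g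
  proof (cases "fst g = 0")
    case False
    show ?thesis
      by (subst at[OF False G.coord_smooth])
         (simp add: pull_left_translation False G.vf_cmult[OF Z G.coord_smooth]
          G.vf_cst[OF Z] G.vf_add[OF Z G.cmult_smooth[OF G.coord_smooth] G.cst_smooth])
  qed (simp add: off)
  show ?thesis
  proof (rule G_vf_eqI[OF Z lc_vf[OF G.cst_smooth G.cst_smooth]])
    show "Z (G.coord 0) = lc (G.cst (Z (G.coord 0) (1, 0))) (G.cst (Z (G.coord (Suc 0)) (1, 0))) (G.coord 0)"
    proof
      show "Z (G.coord 0) g = lc (G.cst (Z (G.coord 0) (1, 0))) (G.cst (Z (G.coord (Suc 0)) (1, 0))) (G.coord 0) g" for g
        using 0[of g] by (simp add: lc_apply E_coord G_cst G_coord)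
    qed
    show "Z (G.coord (Suc 0)) = lc (G.cst (Z (G.coord 0) (1, 0))) (G.cst (Z (G.coord (Suc 0)) (1, 0))) (G.coord (Suc 0))"
    proof
      show "Z (G.coord (Suc 0)) g = lc (G.cst (Z (G.coord 0) (1, 0))) (G.cst (Z (G.coord (Suc 0)) (1, 0))) (G.coord (Suc 0)) g" for g
        using 1[of g] by (simp add: lc_apply E_coord G_cst G_coord)
    qed
  qed
qed


section \<open>Functions on the half plane\<close>

definition gH :: "(nat \<Rightarrow> real) set" where
  "gH = {x \<in> Eset 2. 0 < x 0}"

definition hsmooth :: "(real \<times> real \<Rightarrow> real) \<Rightarrow> bool" where
  "hsmooth u \<longleftrightarrow> C_inf_on 2 gH (\<lambda>x. u (x 0, x (Suc 0)))"

text \<open>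
  Left translation by \<open>(-1, 0)\<close> exchanges the two components of the affine group, so everything
  left invariant is determined on the half plane \<open>a > 0\<close>.
\<close>

definition ext :: "(real \<times> real \<Rightarrow> real) \<Rightarrow> real \<times> real \<Rightarrow> real" where
  "ext u p = (if fst p > 0 then u p else if fst p < 0 then u (- fst p, - snd p) else 0)"

lemma gH_open: "openin (Euclidean_space 2) gH"
proof -
  have "open {p :: real \<times> real. 0 < fst p}" by (intro open_Collect_less continuous_intros)
  from openin_Eset_2[OF this] show ?thesis by (simp add: gH_def)
qed

lemma ext_smooth:
  assumes u: "hsmooth u"
  shows "ext u \<in> G.SF"
  unfolding G_smooth_iff
proof
  have "openin (Euclidean_space 2) {x \<in> Eset 2. (x 0, x (Suc 0)) \<in> {p. fst p < 0}}"
    by (intro openin_Eset_2 open_Collect_less continuous_intros)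
  then have No: "openin (Euclidean_space 2) {x \<in> Eset 2. x 0 < 0}" by simp
  have 1: "C_inf_on 2 gH (\<lambda>x. ext u (x 0, x (Suc 0)))"
    by (rule C_inf_cong[OF gH_open _ u[unfolded hsmooth_def]]) (simp add: ext_def gH_def)
  have 2: "C_inf_on 2 {x \<in> Eset 2. x 0 < 0} (\<lambda>x. ext u (x 0, x (Suc 0)))"
  proof (rule C_inf_cong[OF No])
    show "C_inf_on 2 {x \<in> Eset 2. x 0 < 0} (\<lambda>x. u ((\<lambda>i. - x i) 0, (\<lambda>i. - x i) (Suc 0)))"
      by (rule C_inf_compose[OF No gH_open u[unfolded hsmooth_def]])
         (auto intro!: C_inf_minus C_inf_coord No[simplified] simp: gH_def)
  qed (auto simp: ext_def)
  show "C_inf_on 2 gW (\<lambda>x. ext u (x 0, x (Suc 0)))"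
  proof (rule C_inf_local[OF gW_open])
    fix x assume x: "x \<in> gW"
    show "\<exists>T. openin (Euclidean_space 2) T \<and> x \<in> T \<and> T \<subseteq> gW \<and> C_inf_on 2 T (\<lambda>x. ext u (x 0, x (Suc 0)))"
    proof (cases "x 0 > 0")
      case True
      then show ?thesis using x 1 gH_open by (intro exI[of _ gH]) (auto simp: gW_def gH_def)
    next
      case False
      then show ?thesis using x 2 No by (intro exI[of _ "{x \<in> Eset 2. x 0 < 0}"]) (auto simp: gW_def)
    qed
  qed
qed (simp add: ext_def)

lemma E_ext_0:
  assumes u: "hsmooth u"
    and d: "\<And>a b. a > 0 \<Longrightarrow> ((\<lambda>t. u (t, b)) has_field_derivative v (a, b) / a) (at a)"
  shows "E 0 (ext u) = ext v"
proof
  fix p :: "real \<times> real"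
  obtain a b where p: "p = (a, b)" by (cases p)
  consider "a > 0" | "a < 0" | "a = 0" by linarith
  then show "E 0 (ext u) p = ext v p"
  proof cases
    case 1
    have "((\<lambda>t. ext u (t, b)) has_field_derivative v (a, b) / a) (at a)"
      using d[OF 1, of b]
      by (rule has_field_derivative_transform_within_open[of _ _ _ "{0<..}"]) (use 1 in \<open>auto simp: ext_def\<close>)
    then have "G.pd 0 (ext u) (a, b) = v (a, b) / a" using 1 by (intro G_pd_0) auto
    then show ?thesis using 1 by (simp add: p E_apply ext_smooth[OF u] ext_def)
  next
    case 2
    have "((\<lambda>t. u (- t, - b)) has_field_derivative v (- a, - b) / (- a) * (- 1)) (at a)"
      by (rule DERIV_chain2[where g = uminus, OF d]) (use 2 in \<open>auto intro!: derivative_eq_intros\<close>)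
    then have "((\<lambda>t. ext u (t, b)) has_field_derivative v (- a, - b) / (- a) * (- 1)) (at a)"
      by (rule has_field_derivative_transform_within_open[of _ _ _ "{..<0}"]) (use 2 in \<open>auto simp: ext_def\<close>)
    then have "G.pd 0 (ext u) (a, b) = v (- a, - b) / (- a) * (- 1)" using 2 by (intro G_pd_0) auto
    then show ?thesis using 2 by (simp add: p E_apply ext_smooth[OF u] ext_def)
  next
    case 3
    then show ?thesis by (simp add: p E_apply ext_smooth[OF u] ext_def)
  qed
qed

lemma E_ext_1:
  assumes u: "hsmooth u"
    and d: "\<And>a b. a > 0 \<Longrightarrow> ((\<lambda>t. u (a, t)) has_field_derivative v (a, b) / a) (at b)"
  shows "E (Suc 0) (ext u) = ext v"
proof
  fix p :: "real \<times> real"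
  obtain a b where p: "p = (a, b)" by (cases p)
  consider "a > 0" | "a < 0" | "a = 0" by linarith
  then show "E (Suc 0) (ext u) p = ext v p"
  proof cases
    case 1
    have "((\<lambda>t. ext u (a, t)) has_field_derivative v (a, b) / a) (at b)"
      using d[OF 1, of b] 1 by (simp add: ext_def)
    then have "G.pd (Suc 0) (ext u) (a, b) = v (a, b) / a" using 1 by (intro G_pd_1) auto
    then show ?thesis using 1 by (simp add: p E_apply ext_smooth[OF u] ext_def)
  next
    case 2
    have "((\<lambda>t. u (- a, - t)) has_field_derivative v (- a, - b) / (- a) * (- 1)) (at b)"
      by (rule DERIV_chain2[where g = uminus, OF d]) (use 2 in \<open>auto intro!: derivative_eq_intros\<close>)
    then have "((\<lambda>t. ext u (a, t)) has_field_derivative v (- a, - b) / (- a) * (- 1)) (at b)"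
      using 2 by (simp add: ext_def)
    then have "G.pd (Suc 0) (ext u) (a, b) = v (- a, - b) / (- a) * (- 1)" using 2 by (intro G_pd_1) auto
    then show ?thesis using 2 by (simp add: p E_apply ext_smooth[OF u] ext_def)
  next
    case 3
    then show ?thesis by (simp add: p E_apply ext_smooth[OF u] ext_def)
  qed
qed


section \<open>Flat left invariant structures as left symmetric products\<close>

locale flat_structure =
  fixes D :: "(real \<times> real) vfield \<Rightarrow> (real \<times> real) vfield \<Rightarrow> (real \<times> real) vfield"
  assumes str: "flat_left_invariant_affine_structure Aff_line GM D"
begin

lemma conn: "linear_connection GM D"
  using str by (simp add: flat_left_invariant_affine_structure_def)

lemma D_vf: "X \<in> G.VF \<Longrightarrow> Y \<in> G.VF \<Longrightarrow> D X Y \<in> G.VF"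
  using conn by (simp add: linear_connection_def)

lemma D_lc_left:
  assumes "u \<in> G.SF" "v \<in> G.SF" "Y \<in> G.VF"
  shows "D (lc u v) Y f = (\<lambda>p. u p * D (E 0) Y f p + v p * D (E (Suc 0)) Y f p)"
proof -
  have "D (lc u v) Y = fscale u (D (E 0) Y) + fscale v (D (E (Suc 0)) Y)"
    using conn assms E_vf unfolding lc_def linear_connection_def by (simp add: G.vf_fscale)
  then show ?thesis by (simp add: G.vf_plus_apply G.fscale_apply G.plus_real_fun)
qed

lemma D_lc_right:
  assumes "u \<in> G.SF" "v \<in> G.SF" "X \<in> G.VF"
  shows "D X (lc u v) f = (\<lambda>p. X u p * E 0 f p + u p * D X (E 0) f p + (X v p * E (Suc 0) f p + v p * D X (E (Suc 0)) f p))"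
proof -
  have "D X (lc u v) = (fscale (X u) (E 0) + fscale u (D X (E 0))) + (fscale (X v) (E (Suc 0)) + fscale v (D X (E (Suc 0))))"
    using conn assms E_vf unfolding lc_def linear_connection_def by (simp add: G.vf_fscale)
  then show ?thesis by (simp add: G.vf_plus_apply G.fscale_apply G.plus_real_fun)
qed

text \<open>The structure constants of the product \<open>E i \<cdot> E j = D (E i) (E j)\<close> on the Lie algebra.\<close>

definition \<Gamma> :: "nat \<Rightarrow> nat \<Rightarrow> nat \<Rightarrow> real" where
  "\<Gamma> i j k = D (E i) (E j) (G.coord k) (1, 0)"

lemma D_E_E:
  assumes "i < 2" "j < 2"
  shows "D (E i) (E j) = lc (G.cst (\<Gamma> i j 0)) (G.cst (\<Gamma> i j (Suc 0)))"
  unfolding \<Gamma>_def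
proof (rule left_invariant_field[OF D_vf[OF E_vf E_vf]])
  fix g :: "real \<times> real" assume g: "fst g \<noteq> 0"
  then have "preserves_connection GM D (left_translation Aff_line g)"
    using str unfolding flat_left_invariant_affine_structure_def carrier_Aff_line by blast
  then show "push_field GM (left_translation Aff_line g) (D (E i) (E j)) = D (E i) (E j)"
    using E_vf by (simp add: preserves_connection_def push_left_translation_E[OF g] assms)
qed

lemma D_E_lc_cst:
  assumes i: "i < 2"
  shows "D (E i) (lc (G.cst u) (G.cst v)) (G.coord k) (1, 0) = u * \<Gamma> i 0 k + v * \<Gamma> i (Suc 0) k"
  by (simp add: D_lc_right[OF G.cst_smooth G.cst_smooth E_vf] G.vf_cst[OF E_vf] G_cst \<Gamma>_def)

text \<open>
  Evaluating torsion and curvature on the frame at the unit gives polynomial equations for the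
  structure constants: the product is left symmetric with commutator \<open>[E 0, E 1] = E 1\<close>.
\<close>

lemma torsion_eq:
  "\<Gamma> 0 (Suc 0) 0 = \<Gamma> (Suc 0) 0 0" "\<Gamma> 0 (Suc 0) (Suc 0) = \<Gamma> (Suc 0) 0 (Suc 0) + 1"
proof -
  have "D (E 0) (E (Suc 0)) - D (E (Suc 0)) (E 0) - E (Suc 0) = 0"
    using str E_vf lie_bracket_E
    by (metis flat_left_invariant_affine_structure_def torsion_free_def)
  then have "(D (E 0) (E (Suc 0)) - D (E (Suc 0)) (E 0) - E (Suc 0)) (G.coord k) (1, 0) = 0" for k by simp
  then have "\<Gamma> 0 (Suc 0) k - \<Gamma> (Suc 0) 0 k - E (Suc 0) (G.coord k) (1, 0) = 0" for k
    by (simp add: \<Gamma>_def)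
  from this[of 0] this[of "Suc 0"]
  show "\<Gamma> 0 (Suc 0) 0 = \<Gamma> (Suc 0) 0 0" "\<Gamma> 0 (Suc 0) (Suc 0) = \<Gamma> (Suc 0) 0 (Suc 0) + 1"
    by (simp_all add: E_coord G_coord)
qed

lemma flat_eq:
  assumes j: "j < 2"
  shows "\<Gamma> (Suc 0) j 0 * \<Gamma> 0 0 k + \<Gamma> (Suc 0) j (Suc 0) * \<Gamma> 0 (Suc 0) k
    - (\<Gamma> 0 j 0 * \<Gamma> (Suc 0) 0 k + \<Gamma> 0 j (Suc 0) * \<Gamma> (Suc 0) (Suc 0) k) - \<Gamma> (Suc 0) j k = 0"
proof -
  have "flat GM D" using str by (simp add: flat_left_invariant_affine_structure_def)
  then have "D (E 0) (D (E (Suc 0)) (E j)) - D (E (Suc 0)) (D (E 0) (E j)) - D (lie_bracket (E 0) (E (Suc 0))) (E j) = 0"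
    using E_vf unfolding flat_def by blast
  then have "(D (E 0) (D (E (Suc 0)) (E j)) - D (E (Suc 0)) (D (E 0) (E j)) - D (E (Suc 0)) (E j)) (G.coord k) (1, 0) = 0"
    by (simp add: lie_bracket_E)
  moreover have "D (E 0) (D (E (Suc 0)) (E j)) (G.coord k) (1, 0) =
      \<Gamma> (Suc 0) j 0 * \<Gamma> 0 0 k + \<Gamma> (Suc 0) j (Suc 0) * \<Gamma> 0 (Suc 0) k"
    using D_E_E[OF _ j, of "Suc 0"] D_E_lc_cst[of 0] by simp
  moreover have "D (E (Suc 0)) (D (E 0) (E j)) (G.coord k) (1, 0) =
      \<Gamma> 0 j 0 * \<Gamma> (Suc 0) 0 k + \<Gamma> 0 j (Suc 0) * \<Gamma> (Suc 0) (Suc 0) k"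
    using D_E_E[OF _ j, of 0] D_E_lc_cst[of "Suc 0"] by simp
  moreover have "D (E (Suc 0)) (E j) (G.coord k) (1, 0) = \<Gamma> (Suc 0) j k" by (simp add: \<Gamma>_def)
  ultimately show ?thesis by simp
qed

text \<open>The difference of the two sides is bilinear over the smooth functions in the fields.\<close>

lemma affine_frameI:
  assumes f: "f \<in> G.SF"
    and fr: "\<And>i j. i < 2 \<Longrightarrow> j < 2 \<Longrightarrow> E i (E j f) = D (E i) (E j) f"
  shows "G.affine_fun D f"
  unfolding G.affine_fun_def
proof (intro conjI f ballI)
  fix X Y assume X: "X \<in> G.VF" and Y: "Y \<in> G.VF"
  obtain u v where uv: "u \<in> G.SF" "v \<in> G.SF" "Y = lc u v" using ex_lc[OF Y] .
  obtain w z where wz: "w \<in> G.SF" "z \<in> G.SF" "X = lc w z" using ex_lc[OF X] .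
  have Es: "E j f \<in> G.SF" for j using G.vf_smooth[OF E_vf f] .
  have XE: "X (E j f) = D X (E j) f" if "j < 2" for j
    using that fr unfolding wz(3) D_lc_left[OF wz(1,2) E_vf] lc_apply by simp
  have "X (Y f) = X (\<lambda>p. u p * E 0 f p + v p * E (Suc 0) f p)" by (simp add: uv(3) lc_apply)
  also have "\<dots> = (\<lambda>p. (u p * X (E 0 f) p + E 0 f p * X u p) + (v p * X (E (Suc 0) f) p + E (Suc 0) f p * X v p))"
    by (simp add: G.vf_add[OF X] G.vf_mult[OF X] uv Es G.mult_smooth)
  also have "\<dots> = D X Y f"
    unfolding uv(3) D_lc_right[OF uv(1,2) X] by (simp add: XE algebra_simps)
  finally show "D X Y f = X (Y f)" by simp
qed

text \<open>
  With \<open>u' j = E j u\<close>, the hypotheses say that the second derivatives of \<open>u\<close> along the frame are those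
  prescribed by the connection.
\<close>

lemma affine_extI:
  assumes s: "hsmooth u" "hsmooth (u' 0)" "hsmooth (u' (Suc 0))"
    and d0: "\<And>a b. a > 0 \<Longrightarrow> ((\<lambda>t. u (t, b)) has_field_derivative u' 0 (a, b) / a) (at a)"
    and d1: "\<And>a b. a > 0 \<Longrightarrow> ((\<lambda>t. u (a, t)) has_field_derivative u' (Suc 0) (a, b) / a) (at b)"
    and d2: "\<And>j a b. j < 2 \<Longrightarrow> a > 0 \<Longrightarrow> ((\<lambda>t. u' j (t, b)) has_field_derivative
        (\<Gamma> 0 j 0 * u' 0 (a, b) + \<Gamma> 0 j (Suc 0) * u' (Suc 0) (a, b)) / a) (at a)"
      "\<And>j a b. j < 2 \<Longrightarrow> a > 0 \<Longrightarrow> ((\<lambda>t. u' j (a, t)) has_field_derivative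
        (\<Gamma> (Suc 0) j 0 * u' 0 (a, b) + \<Gamma> (Suc 0) j (Suc 0) * u' (Suc 0) (a, b)) / a) (at b)"
  shows "G.affine_fun D (ext u) \<and> E 0 (ext u) = ext (u' 0) \<and> E (Suc 0) (ext u) = ext (u' (Suc 0))"
proof (intro conjI)
  have sj: "hsmooth (u' j)" if "j < 2" for j using s that by (auto simp: less_2)
  show E0: "E 0 (ext u) = ext (u' 0)" using s d0 by (intro E_ext_0) auto
  show E1: "E (Suc 0) (ext u) = ext (u' (Suc 0))" using s d1 by (intro E_ext_1) auto
  have Ej: "E j (ext u) = ext (u' j)" if "j < 2" for j using that E0 E1 by (auto simp: less_2)
  define w where "w i j p = \<Gamma> i j 0 * u' 0 p + \<Gamma> i j (Suc 0) * u' (Suc 0) p" for i j p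
  have "E 0 (ext (u' j)) = ext (w 0 j)" if "j < 2" for j
    by (rule E_ext_0[OF sj[OF that]]) (use d2(1)[OF that] in \<open>simp add: w_def\<close>)
  moreover have "E (Suc 0) (ext (u' j)) = ext (w (Suc 0) j)" if "j < 2" for j
    by (rule E_ext_1[OF sj[OF that]]) (use d2(2)[OF that] in \<open>simp add: w_def\<close>)
  ultimately have EE: "E i (ext (u' j)) = ext (w i j)" if "i < 2" "j < 2" for i j
    using that by (auto simp: less_2)
  show "G.affine_fun D (ext u)"
  proof (rule affine_frameI[OF ext_smooth[OF s(1)]])
    fix i j :: nat assume ij: "i < 2" "j < 2"
    show "E i (E j (ext u)) = D (E i) (E j) (ext u)"
      unfolding Ej[OF ij(2)] EE[OF ij] D_E_E[OF ij] lc_apply E0 E1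
      by (auto simp: ext_def w_def G_cst fun_eq_iff)
  qed
qed

end


section \<open>Developing maps\<close>

text \<open>
  If \<open>F1\<close> and \<open>F2\<close> are in addition affine functions, they are coordinates in which the connection
  becomes that of the plane.
\<close>

definition developing_pair ::
    "(real \<times> real) set \<Rightarrow> (real \<times> real \<Rightarrow> real) \<Rightarrow> (real \<times> real \<Rightarrow> real) \<Rightarrow> (real \<times> real \<Rightarrow> real \<times> real) \<Rightarrow> bool" where
  "developing_pair \<Omega> F1 F2 K \<longleftrightarrow> open \<Omega> \<and> hsmooth F1 \<and> hsmooth F2 \<and>
     (\<forall>p. 0 < fst p \<longrightarrow> (F1 p, F2 p) \<in> \<Omega> \<and> K (F1 p, F2 p) = p) \<and>
     (\<forall>z\<in>\<Omega>. 0 < fst (K z) \<and> F1 (K z) = fst z \<and> F2 (K z) = snd z) \<and>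
     C_inf_on 2 {x \<in> Eset 2. (x 0, x (Suc 0)) \<in> \<Omega>} (\<lambda>x. fst (K (x 0, x (Suc 0)))) \<and>
     C_inf_on 2 {x \<in> Eset 2. (x 0, x (Suc 0)) \<in> \<Omega>} (\<lambda>x. snd (K (x 0, x (Suc 0))))"

definition half_domain :: "(real \<times> real) set" where
  "half_domain = {z. 0 < fst z}"

definition parabola_domain :: "real \<Rightarrow> (real \<times> real) set" where
  "parabola_domain s = {z. s * (fst z)\<^sup>2 < snd z}"

text \<open>
  Here \<open>z'\<close> stands for \<open>t dz/dt\<close>, so the equation is
  \<open>(t d/dt)\<^sup>2 z = \<alpha> (t d/dt) z + \<beta> t\<^sup>m\<close>.
\<close>

definition euler_ode :: "real \<Rightarrow> real \<Rightarrow> real \<Rightarrow> (real \<Rightarrow> real) \<Rightarrow> (real \<Rightarrow> real) \<Rightarrow> bool" where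
  "euler_ode \<alpha> \<beta> m z z' \<longleftrightarrow>
     (\<forall>t>0. (z has_field_derivative z' t / t) (at t) \<and>
            (z' has_field_derivative (\<alpha> * z' t + \<beta> * t powr m) / t) (at t)) \<and>
     hsmooth (\<lambda>p. z (fst p)) \<and> hsmooth (\<lambda>p. z' (fst p))"

lemma hsmooth_intros:
  "hsmooth (\<lambda>p. c)" "hsmooth fst" "hsmooth snd"
  "hsmooth u \<Longrightarrow> hsmooth v \<Longrightarrow> hsmooth (\<lambda>p. u p + v p)"
  "hsmooth u \<Longrightarrow> hsmooth v \<Longrightarrow> hsmooth (\<lambda>p. u p - v p)"
  "hsmooth u \<Longrightarrow> hsmooth v \<Longrightarrow> hsmooth (\<lambda>p. u p * v p)"
  "hsmooth u \<Longrightarrow> hsmooth (\<lambda>p. - u p)" "hsmooth u \<Longrightarrow> hsmooth (\<lambda>p. u p ^ n)"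
  "hsmooth (\<lambda>p. fst p powr c)" "hsmooth (\<lambda>p. ln (fst p))"
  unfolding hsmooth_def
  by (auto intro!: C_inf_intros gH_open) (auto simp: gH_def)

text \<open>
  Powers \<open>t\<^sup>m\<close> are eigenfunctions of \<open>t d/dt\<close>; at resonance, when \<open>m (m - \<alpha>) = 0\<close>, the logarithm
  enters.  Resonance cannot be double because \<open>m = 0\<close> goes with \<open>\<alpha> = -1\<close> and \<open>m = \<alpha>\<close> with \<open>\<alpha> = 1\<close>.
\<close>

lemma euler_ode_solvable:
  assumes "\<nu> = 0 \<or> \<nu> = \<alpha>"
  obtains z z' where "euler_ode \<alpha> \<beta> (1 + \<nu>) z z'"
proof -
  define m where "m = 1 + \<nu>"
  have ex: "euler_ode \<alpha> \<beta> m (\<lambda>t. k * t powr m + l * (ln t * t powr m))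
      (\<lambda>t. (k * m + l) * t powr m + l * m * (ln t * t powr m))"
    if kl: "m * (m - \<alpha>) * k + (2 * m - \<alpha>) * l = \<beta>" and l0: "l * (m * (m - \<alpha>)) = 0" for k l
    unfolding euler_ode_def
  proof (intro conjI allI impI)
    fix t :: real assume t: "t > 0"
    have p: "t powr (m - 1) = t powr m / t" using t by (simp add: powr_diff)
    show "((\<lambda>t. k * t powr m + l * (ln t * t powr m)) has_field_derivative
        ((k * m + l) * t powr m + l * m * (ln t * t powr m)) / t) (at t)"
      using t by (auto intro!: derivative_eq_intros simp: p) (simp add: field_simps)
    have "((\<lambda>t. (k * m + l) * t powr m + l * m * (ln t * t powr m)) has_field_derivative
        ((k * m + l) * m + l * m) * (t powr m / t) + l * m * m * (ln t * (t powr m / t))) (at t)"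
      using t by (auto intro!: derivative_eq_intros simp: p) (simp add: field_simps)
    moreover have "((k * m + l) * m + l * m) * (t powr m / t) + l * m * m * (ln t * (t powr m / t)) =
        (\<alpha> * ((k * m + l) * t powr m + l * m * (ln t * t powr m)) + \<beta> * t powr m) / t"
    proof -
      have "l * m * m = \<alpha> * (l * m)" using l0 by (simp add: algebra_simps)
      then have a: "l * m * m * (ln t * (t powr m / t)) = \<alpha> * (l * m) * (ln t * (t powr m / t))" by simp
      have "(k * m + l) * m + l * m = \<alpha> * (k * m + l) + \<beta>" using kl by (simp add: algebra_simps)
      then show ?thesis using a by (simp add: algebra_simps add_divide_distrib)
    qed
    ultimately show "((\<lambda>t. (k * m + l) * t powr m + l * m * (ln t * t powr m)) has_field_derivative
        (\<alpha> * ((k * m + l) * t powr m + l * m * (ln t * t powr m)) + \<beta> * t powr m) / t) (at t)" by simp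
  qed (intro hsmooth_intros)+
  show thesis
  proof (cases "m * (m - \<alpha>) = 0")
    case False
    then show thesis using that ex[of "\<beta> / (m * (m - \<alpha>))" 0] by (auto simp: m_def)
  next
    case True
    then have "2 * m - \<alpha> \<noteq> 0" using assms by (auto simp: m_def)
    then show thesis using that ex[of 0 "\<beta> / (2 * m - \<alpha>)"] True by (auto simp: m_def)
  qed
qed

context flat_structure
begin

text \<open>
  The case in which left multiplication by \<open>E 1\<close> maps \<open>E 0\<close> to a multiple of \<open>E 1\<close> and kills \<open>E 1\<close>.  The
  affine coordinates are \<open>ln a\<close> or \<open>a\<^sup>\<alpha>\<close>, and \<open>a\<^sup>\<nu> b + z(a)\<close> where \<open>z\<close> solves an Euler equation.
  The first coordinate decides whether the developing image is the plane or a half plane.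
\<close>

lemma developing_pair_nilpotent:
  assumes \<Gamma>: "\<Gamma> (Suc 0) 0 0 = 0" "\<Gamma> (Suc 0) 0 (Suc 0) = \<nu>" "\<Gamma> (Suc 0) (Suc 0) 0 = 0" "\<Gamma> (Suc 0) (Suc 0) (Suc 0) = 0"
    and \<nu>: "\<nu> = 0 \<or> \<nu> = \<Gamma> 0 0 0"
  obtains \<Omega> F1 F2 K where "\<Omega> = UNIV \<or> \<Omega> = half_domain" "developing_pair \<Omega> F1 F2 K"
    "G.affine_fun D (ext F1)" "G.affine_fun D (ext F2)"
    "\<And>p. fst p \<noteq> 0 \<Longrightarrow> E 0 (ext F1) p * E (Suc 0) (ext F2) p - E (Suc 0) (ext F1) p * E 0 (ext F2) p \<noteq> 0"
proof -
  define \<alpha> where "\<alpha> = \<Gamma> 0 0 0"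
  define \<beta> where "\<beta> = \<Gamma> 0 0 (Suc 0)"
  have \<nu>2: "\<nu> * \<nu> = \<alpha> * \<nu>" using \<nu> by (auto simp: \<alpha>_def)
  have \<Gamma>01: "\<Gamma> 0 (Suc 0) 0 = 0" "\<Gamma> 0 (Suc 0) (Suc 0) = 1 + \<nu>" using torsion_eq \<Gamma> by auto
  obtain z z' where z: "euler_ode \<alpha> \<beta> (1 + \<nu>) z z'" using euler_ode_solvable \<nu> \<alpha>_def by metis
  have zd: "(z has_field_derivative z' t / t) (at t)"
    "(z' has_field_derivative (\<alpha> * z' t + \<beta> * t powr (1 + \<nu>)) / t) (at t)" if "t > 0" for t
    using z that by (auto simp: euler_ode_def)
  have zs: "hsmooth (\<lambda>p. z (fst p))" "hsmooth (\<lambda>p. z' (fst p))" using z by (auto simp: euler_ode_def)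
  define F2 where "F2 p = fst p powr \<nu> * snd p + z (fst p)" for p :: "real \<times> real"
  define F2' where "F2' j p = (if j = (0::nat) then \<nu> * (fst p powr \<nu> * snd p) + z' (fst p) else fst p powr (1 + \<nu>))"
    for j and p :: "real \<times> real"
  define xi where "xi t = (if \<alpha> = 0 then ln t else t powr \<alpha>)" for t
  define F1 where "F1 p = xi (fst p)" for p :: "real \<times> real"
  define xi' where "xi' t = (if \<alpha> = 0 then 1 else \<alpha> * t powr \<alpha>)" for t :: real
  define F1' where "F1' j p = (if j = (0::nat) then xi' (fst p) else 0)" for j and p :: "real \<times> real"
  have pw: "a powr (c - 1) = a powr c / a" "a powr (1 + c) = a * a powr c" if "a > 0" for a c :: real
    using that by (simp_all add: powr_diff powr_add)
  have xid: "(xi has_field_derivative xi' t / t) (at t)" "(xi' has_field_derivative \<alpha> * xi' t / t) (at t)"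
    if "t > 0" for t
    unfolding xi_def[abs_def] xi'_def[abs_def]
    using that by (auto intro!: derivative_eq_intros simp: pw)
  have s1: "hsmooth F1" "hsmooth (F1' 0)" "hsmooth (F1' (Suc 0))"
    unfolding F1_def[abs_def] F1'_def[abs_def] xi_def xi'_def
    by (cases "\<alpha> = 0"; auto intro!: hsmooth_intros)+
  have s2: "hsmooth F2" "hsmooth (F2' 0)" "hsmooth (F2' (Suc 0))"
    unfolding F2_def[abs_def] F2'_def[abs_def] by (auto intro!: hsmooth_intros zs)
  have 1: "G.affine_fun D (ext F1) \<and> E 0 (ext F1) = ext (F1' 0) \<and> E (Suc 0) (ext F1) = ext (F1' (Suc 0))"
  proof (rule affine_extI[where u' = F1', OF s1])
    fix a b :: real assume a: "a > 0"
    show "((\<lambda>t. F1 (t, b)) has_field_derivative F1' 0 (a, b) / a) (at a)"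
      using xid(1)[OF a] by (simp add: F1_def F1'_def)
    show "((\<lambda>t. F1 (a, t)) has_field_derivative F1' (Suc 0) (a, b) / a) (at b)"
      by (simp add: F1_def F1'_def)
    fix j :: nat assume j: "j < 2"
    show "((\<lambda>t. F1' j (t, b)) has_field_derivative
        (\<Gamma> 0 j 0 * F1' 0 (a, b) + \<Gamma> 0 j (Suc 0) * F1' (Suc 0) (a, b)) / a) (at a)"
      using xid(2)[OF a] j \<Gamma>01 by (auto simp: less_2 F1'_def \<alpha>_def)
    show "((\<lambda>t. F1' j (a, t)) has_field_derivative
        (\<Gamma> (Suc 0) j 0 * F1' 0 (a, b) + \<Gamma> (Suc 0) j (Suc 0) * F1' (Suc 0) (a, b)) / a) (at b)"
      using j \<Gamma> by (auto simp: less_2 F1'_def)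
  qed
  have 2: "G.affine_fun D (ext F2) \<and> E 0 (ext F2) = ext (F2' 0) \<and> E (Suc 0) (ext F2) = ext (F2' (Suc 0))"
  proof (rule affine_extI[where u' = F2', OF s2])
    fix a b :: real assume a: "a > 0"
    show "((\<lambda>t. F2 (t, b)) has_field_derivative F2' 0 (a, b) / a) (at a)"
      unfolding F2_def F2'_def using a zd[OF a]
      by (auto intro!: derivative_eq_intros simp: pw add_divide_distrib)
    show "((\<lambda>t. F2 (a, t)) has_field_derivative F2' (Suc 0) (a, b) / a) (at b)"
      unfolding F2_def F2'_def using a by (auto intro!: derivative_eq_intros simp: pw)
    fix j :: nat assume j: "j < 2"
    have j0: "((\<lambda>t. F2' 0 (t, b)) has_field_derivative (\<alpha> * F2' 0 (a, b) + \<beta> * F2' (Suc 0) (a, b)) / a) (at a)"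
    proof -
      have d: "((\<lambda>t. F2' 0 (t, b)) has_field_derivative
          \<nu> * (\<nu> * (a powr \<nu> / a) * b) + (\<alpha> * z' a + \<beta> * a powr (1 + \<nu>)) / a) (at a)"
        unfolding F2'_def using a zd(2)[OF a] by (auto intro!: derivative_eq_intros simp: pw)
      have e: "\<nu> * (\<nu> * (a powr \<nu> / a) * b) = \<alpha> * (\<nu> * (a powr \<nu> * b)) / a"
        using \<nu>2 by (metis (no_types, opaque_lifting) mult.assoc mult.commute times_divide_eq_right)
      show ?thesis
        using d unfolding e by (rule DERIV_cong) (simp add: F2'_def distrib_left add_divide_distrib)
    qed
    have j1: "((\<lambda>t. F2' (Suc 0) (t, b)) has_field_derivative (1 + \<nu>) * F2' (Suc 0) (a, b) / a) (at a)"
      unfolding F2'_def using a by (auto intro!: derivative_eq_intros simp: pw)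
    show "((\<lambda>t. F2' j (t, b)) has_field_derivative
        (\<Gamma> 0 j 0 * F2' 0 (a, b) + \<Gamma> 0 j (Suc 0) * F2' (Suc 0) (a, b)) / a) (at a)"
      using j0 j1 j \<Gamma>01 unfolding less_2 \<alpha>_def \<beta>_def by auto
    have "((\<lambda>t. F2' 0 (a, t)) has_field_derivative \<nu> * F2' (Suc 0) (a, b) / a) (at b)"
      unfolding F2'_def using a by (auto intro!: derivative_eq_intros simp: pw)
    moreover have "((\<lambda>t. F2' (Suc 0) (a, t)) has_field_derivative 0) (at b)"
      by (simp add: F2'_def)
    ultimately show "((\<lambda>t. F2' j (a, t)) has_field_derivative
        (\<Gamma> (Suc 0) j 0 * F2' 0 (a, b) + \<Gamma> (Suc 0) j (Suc 0) * F2' (Suc 0) (a, b)) / a) (at b)"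
      using j \<Gamma> unfolding less_2 by auto
  qed
  define eta where "eta x = (if \<alpha> = 0 then exp x else x powr (1 / \<alpha>))" for x
  define \<Omega> where "\<Omega> = (if \<alpha> = 0 then UNIV else half_domain)"
  define K where "K z0 = (eta (fst z0), (snd z0 - z (eta (fst z0))) / eta (fst z0) powr \<nu>)" for z0 :: "real \<times> real"
  have eta_xi: "eta (xi t) = t" if "t > 0" for t using that by (simp add: eta_def xi_def powr_powr)
  have xi_in: "(xi t, y) \<in> \<Omega>" if "t > 0" for t y using that by (simp add: \<Omega>_def xi_def half_domain_def)
  have eta_pos: "eta x > 0" "xi (eta x) = x" if "(x, y) \<in> \<Omega>" for x y
    using that by (auto simp: \<Omega>_def eta_def xi_def half_domain_def powr_powr split: if_splits)
  have \<Omega>o: "open \<Omega>" unfolding \<Omega>_def half_domain_def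
    by (auto intro!: open_Collect_less continuous_intros)
  let ?S = "{x \<in> Eset 2. (x 0, x (Suc 0)) \<in> \<Omega>}"
  have So: "openin (Euclidean_space 2) ?S" by (rule openin_Eset_2[OF \<Omega>o])
  have e_s: "C_inf_on 2 ?S (\<lambda>x. eta (x 0))"
  proof (cases "\<alpha> = 0")
    case True
    then have "eta = exp" by (auto simp: eta_def)
    then show ?thesis using C_inf_exp[OF So C_inf_coord[OF So]] by simp
  next
    case False
    then have e: "eta = (\<lambda>x. x powr (1 / \<alpha>))" by (auto simp: eta_def)
    show ?thesis unfolding e
      by (rule C_inf_powr[OF So C_inf_coord[OF So]]) (use False in \<open>simp add: \<Omega>_def half_domain_def\<close>)
  qed
  have ze_s: "C_inf_on 2 ?S (\<lambda>x. z (eta (x 0)))"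
  proof -
    define g where "g x i = (if i = 0 then eta (x 0) else 0)" for x :: "nat \<Rightarrow> real" and i :: nat
    have "C_inf_on 2 ?S (\<lambda>x. z (fst (g x 0, g x (Suc 0))))"
    proof (rule C_inf_compose[OF So gH_open zs(1)[unfolded hsmooth_def]])
      show "C_inf_on 2 ?S (\<lambda>x. g x j)" for j
        using e_s C_inf_const[OF So] by (cases "j = 0") (simp_all add: g_def)
      show "g x \<in> gH" if "x \<in> ?S" for x
        using eta_pos(1)[of "x 0" "x (Suc 0)"] that by (simp add: g_def gH_def)
    qed
    then show ?thesis by (simp add: g_def)
  qed
  have dev: "developing_pair \<Omega> F1 F2 K"
    unfolding developing_pair_def
  proof (intro conjI \<Omega>o s1(1) s2(1) allI impI ballI)
    fix p :: "real \<times> real" assume p: "0 < fst p"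
    show "(F1 p, F2 p) \<in> \<Omega>" using xi_in[OF p] by (simp add: F1_def)
    show "K (F1 p, F2 p) = p" using p eta_xi[OF p] by (simp add: K_def F1_def F2_def)
  next
    fix q assume "q \<in> \<Omega>"
    then have q: "eta (fst q) > 0" "xi (eta (fst q)) = fst q" using eta_pos[of "fst q" "snd q"] by auto
    show "0 < fst (K q)" "F1 (K q) = fst q" "F2 (K q) = snd q"
      using q by (simp_all add: K_def F1_def F2_def)
  next
    show "C_inf_on 2 ?S (\<lambda>x. fst (K (x 0, x (Suc 0))))" using e_s by (simp add: K_def)
    show "C_inf_on 2 ?S (\<lambda>x. snd (K (x 0, x (Suc 0))))"
      unfolding K_def snd_conv fst_conv
    proof (rule C_inf_divide[OF So])
      show "C_inf_on 2 ?S (\<lambda>x. x (Suc 0) - z (eta (x 0)))" by (rule C_inf_diff[OF So C_inf_coord[OF So] ze_s])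
      show "C_inf_on 2 ?S (\<lambda>x. eta (x 0) powr \<nu>)" by (rule C_inf_powr[OF So e_s]) (use eta_pos in auto)
      show "eta (x 0) powr \<nu> \<noteq> 0" if "x \<in> ?S" for x using eta_pos(1)[of "x 0" "x (Suc 0)"] that by simp
    qed
  qed
  have "\<Omega> = UNIV \<or> \<Omega> = half_domain" by (simp add: \<Omega>_def)
  moreover have "E 0 (ext F1) p * E (Suc 0) (ext F2) p - E (Suc 0) (ext F1) p * E 0 (ext F2) p \<noteq> 0" if "fst p \<noteq> 0" for p
    using 1 2 that by (auto simp: ext_def F1'_def F2'_def xi'_def)
  ultimately show thesis using that dev 1 2 by blast
qed

text \<open>
  In the remaining case \<open>b - \<mu> a\<close> and \<open>a\<^sup>2 + s (b - \<mu> a)\<^sup>2\<close> are affine, and the parabola is where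
  \<open>a\<close> vanishes.
\<close>

lemma developing_pair_parabolic:
  assumes \<Gamma>: "\<Gamma> 0 0 0 = s * \<mu>\<^sup>2 + 2" "\<Gamma> 0 0 (Suc 0) = \<mu> + s * \<mu> ^ 3"
    "\<Gamma> (Suc 0) 0 0 = - s * \<mu>" "\<Gamma> (Suc 0) 0 (Suc 0) = - s * \<mu>\<^sup>2"
    "\<Gamma> (Suc 0) (Suc 0) 0 = s" "\<Gamma> (Suc 0) (Suc 0) (Suc 0) = s * \<mu>"
  obtains F1 F2 K where "developing_pair (parabola_domain s) F1 F2 K"
    "G.affine_fun D (ext F1)" "G.affine_fun D (ext F2)"
    "\<And>p. fst p \<noteq> 0 \<Longrightarrow> E 0 (ext F1) p * E (Suc 0) (ext F2) p - E (Suc 0) (ext F1) p * E 0 (ext F2) p \<noteq> 0"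
proof -
  have \<Gamma>01: "\<Gamma> 0 (Suc 0) 0 = - s * \<mu>" "\<Gamma> 0 (Suc 0) (Suc 0) = 1 - s * \<mu>\<^sup>2" using torsion_eq \<Gamma> by auto
  define F1 where "F1 p = snd p - \<mu> * fst p" for p :: "real \<times> real"
  define F1' where "F1' j p = (if j = (0::nat) then - \<mu> * fst p else fst p)" for j and p :: "real \<times> real"
  define F2 where "F2 p = (fst p)\<^sup>2 + s * (snd p - \<mu> * fst p)\<^sup>2" for p :: "real \<times> real"
  define F2' where "F2' j p = (if j = (0::nat) then 2 * (fst p)\<^sup>2 - 2 * s * \<mu> * (fst p * (snd p - \<mu> * fst p))
    else 2 * s * (fst p * (snd p - \<mu> * fst p)))" for j and p :: "real \<times> real"
  have s1: "hsmooth F1" "hsmooth (F1' 0)" "hsmooth (F1' (Suc 0))"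
    unfolding F1_def[abs_def] F1'_def[abs_def] by (auto intro!: hsmooth_intros)
  have s2: "hsmooth F2" "hsmooth (F2' 0)" "hsmooth (F2' (Suc 0))"
    unfolding F2_def[abs_def] F2'_def[abs_def] by (auto intro!: hsmooth_intros)
  have 1: "G.affine_fun D (ext F1) \<and> E 0 (ext F1) = ext (F1' 0) \<and> E (Suc 0) (ext F1) = ext (F1' (Suc 0))"
  proof (rule affine_extI[where u' = F1', OF s1])
    fix a b :: real assume a: "a > 0"
    show "((\<lambda>t. F1 (t, b)) has_field_derivative F1' 0 (a, b) / a) (at a)"
      "((\<lambda>t. F1 (a, t)) has_field_derivative F1' (Suc 0) (a, b) / a) (at b)"
      unfolding F1_def F1'_def using a by (auto intro!: derivative_eq_intros)
    fix j :: nat assume j: "j < 2"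
    show "((\<lambda>t. F1' j (t, b)) has_field_derivative
        (\<Gamma> 0 j 0 * F1' 0 (a, b) + \<Gamma> 0 j (Suc 0) * F1' (Suc 0) (a, b)) / a) (at a)"
    proof -
      have "((\<lambda>t. F1' j (t, b)) has_field_derivative (if j = 0 then - \<mu> else 1)) (at a)"
        unfolding F1'_def by (cases "j = 0") (auto intro!: derivative_eq_intros)
      moreover have "(\<Gamma> 0 j 0 * F1' 0 (a, b) + \<Gamma> 0 j (Suc 0) * F1' (Suc 0) (a, b)) = (if j = 0 then - \<mu> else 1) * a"
        using j by (auto simp: less_2 \<Gamma> \<Gamma>01 F1'_def algebra_simps power2_eq_square power3_eq_cube)
      ultimately show ?thesis using a by simp
    qed
    have "((\<lambda>t. F1' j (a, t)) has_field_derivative 0) (at b)" by (cases "j = 0") (simp_all add: F1'_def)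
    moreover have "\<Gamma> (Suc 0) j 0 * F1' 0 (a, b) + \<Gamma> (Suc 0) j (Suc 0) * F1' (Suc 0) (a, b) = 0"
      using j by (auto simp: less_2 \<Gamma> F1'_def algebra_simps power2_eq_square)
    ultimately show "((\<lambda>t. F1' j (a, t)) has_field_derivative
        (\<Gamma> (Suc 0) j 0 * F1' 0 (a, b) + \<Gamma> (Suc 0) j (Suc 0) * F1' (Suc 0) (a, b)) / a) (at b)" by simp
  qed
  have 2: "G.affine_fun D (ext F2) \<and> E 0 (ext F2) = ext (F2' 0) \<and> E (Suc 0) (ext F2) = ext (F2' (Suc 0))"
  proof (rule affine_extI[where u' = F2', OF s2])
    fix a b :: real assume a: "a > 0"
    show "((\<lambda>t. F2 (t, b)) has_field_derivative F2' 0 (a, b) / a) (at a)"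
      "((\<lambda>t. F2 (a, t)) has_field_derivative F2' (Suc 0) (a, b) / a) (at b)"
      unfolding F2_def F2'_def using a
      by (auto intro!: derivative_eq_intros) (simp_all add: field_simps power2_eq_square)
    have d00: "((\<lambda>t. F2' 0 (t, b)) has_field_derivative 4 * a - 2 * s * \<mu> * (b - 2 * \<mu> * a)) (at a)"
    proof -
      have "((\<lambda>t. 2 * t\<^sup>2 - 2 * s * \<mu> * (t * (b - \<mu> * t))) has_field_derivative
          2 * (2 * a) - 2 * s * \<mu> * (1 * (b - \<mu> * a) + (0 - \<mu> * 1) * a)) (at a)"
        by (intro derivative_intros DERIV_cmult DERIV_mult DERIV_diff DERIV_const DERIV_ident)
           (auto intro!: derivative_eq_intros)
      then show ?thesis by (simp add: F2'_def algebra_simps)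
    qed
    have d01: "((\<lambda>t. F2' (Suc 0) (t, b)) has_field_derivative 2 * s * (b - 2 * \<mu> * a)) (at a)"
    proof -
      have "((\<lambda>t. 2 * s * (t * (b - \<mu> * t))) has_field_derivative
          2 * s * (1 * (b - \<mu> * a) + (0 - \<mu> * 1) * a)) (at a)"
        by (intro DERIV_cmult DERIV_mult DERIV_diff DERIV_const DERIV_ident)
      then show ?thesis by (simp add: F2'_def algebra_simps)
    qed
    have d10: "((\<lambda>t. F2' 0 (a, t)) has_field_derivative - 2 * s * \<mu> * a) (at b)"
    proof -
      have "((\<lambda>t. 2 * a\<^sup>2 - 2 * s * \<mu> * (a * (t - \<mu> * a))) has_field_derivative
          0 - 2 * s * \<mu> * (a * (1 - 0))) (at b)"
        by (intro DERIV_cmult DERIV_diff DERIV_const DERIV_ident)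
      then show ?thesis by (simp add: F2'_def algebra_simps)
    qed
    have d11: "((\<lambda>t. F2' (Suc 0) (a, t)) has_field_derivative 2 * s * a) (at b)"
    proof -
      have "((\<lambda>t. 2 * s * (a * (t - \<mu> * a))) has_field_derivative 2 * s * (a * (1 - 0))) (at b)"
        by (intro DERIV_cmult DERIV_diff DERIV_const DERIV_ident)
      then show ?thesis by (simp add: F2'_def algebra_simps)
    qed
    fix j :: nat assume j: "j < 2"
    have "\<Gamma> 0 0 0 * F2' 0 (a, b) + \<Gamma> 0 0 (Suc 0) * F2' (Suc 0) (a, b) = (4 * a - 2 * s * \<mu> * (b - 2 * \<mu> * a)) * a"
      "\<Gamma> 0 (Suc 0) 0 * F2' 0 (a, b) + \<Gamma> 0 (Suc 0) (Suc 0) * F2' (Suc 0) (a, b) = (2 * s * (b - 2 * \<mu> * a)) * a"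
      by (simp_all add: \<Gamma> \<Gamma>01 F2'_def) (simp_all add: algebra_simps power2_eq_square power3_eq_cube)
    then show "((\<lambda>t. F2' j (t, b)) has_field_derivative
        (\<Gamma> 0 j 0 * F2' 0 (a, b) + \<Gamma> 0 j (Suc 0) * F2' (Suc 0) (a, b)) / a) (at a)"
      using j d00 d01 a unfolding less_2 by auto
    have "\<Gamma> (Suc 0) 0 0 * F2' 0 (a, b) + \<Gamma> (Suc 0) 0 (Suc 0) * F2' (Suc 0) (a, b) = (- 2 * s * \<mu> * a) * a"
      "\<Gamma> (Suc 0) (Suc 0) 0 * F2' 0 (a, b) + \<Gamma> (Suc 0) (Suc 0) (Suc 0) * F2' (Suc 0) (a, b) = (2 * s * a) * a"
      by (simp_all add: \<Gamma> F2'_def) (simp_all add: algebra_simps power2_eq_square power3_eq_cube)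
    then show "((\<lambda>t. F2' j (a, t)) has_field_derivative
        (\<Gamma> (Suc 0) j 0 * F2' 0 (a, b) + \<Gamma> (Suc 0) j (Suc 0) * F2' (Suc 0) (a, b)) / a) (at b)"
      using j d10 d11 a unfolding less_2 by auto
  qed
  define K where "K z = (sqrt (snd z - s * (fst z)\<^sup>2), fst z + \<mu> * sqrt (snd z - s * (fst z)\<^sup>2))" for z :: "real \<times> real"
  let ?S = "{x \<in> Eset 2. (x 0, x (Suc 0)) \<in> parabola_domain s}"
  have o: "open (parabola_domain s)"
    unfolding parabola_domain_def by (intro open_Collect_less continuous_intros)
  have So: "openin (Euclidean_space 2) ?S" by (rule openin_Eset_2[OF o])
  have sq: "C_inf_on 2 ?S (\<lambda>x. sqrt (x (Suc 0) - s * (x 0)\<^sup>2))"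
  proof (rule C_inf_sqrt[OF So])
    show "C_inf_on 2 ?S (\<lambda>x. x (Suc 0) - s * (x 0)\<^sup>2)"
      by (intro C_inf_diff C_inf_mult C_inf_power C_inf_const C_inf_coord So)
  qed (simp add: parabola_domain_def)
  have dev: "developing_pair (parabola_domain s) F1 F2 K"
    unfolding developing_pair_def
  proof (intro conjI o s1(1) s2(1) allI impI ballI)
    fix p :: "real \<times> real" assume p: "0 < fst p"
    show "(F1 p, F2 p) \<in> parabola_domain s" using p by (simp add: F1_def F2_def parabola_domain_def)
    show "K (F1 p, F2 p) = p" using p by (simp add: K_def F1_def F2_def)
  next
    fix q assume q: "q \<in> parabola_domain s"
    show "0 < fst (K q)" "F1 (K q) = fst q" "F2 (K q) = snd q"
      using q by (simp_all add: K_def F1_def F2_def parabola_domain_def)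
  next
    show "C_inf_on 2 ?S (\<lambda>x. fst (K (x 0, x (Suc 0))))" using sq by (simp add: K_def)
    show "C_inf_on 2 ?S (\<lambda>x. snd (K (x 0, x (Suc 0))))"
      unfolding K_def snd_conv fst_conv
      by (rule C_inf_add[OF So C_inf_coord[OF So] C_inf_mult[OF So C_inf_const[OF So] sq]])
  qed
  have "E 0 (ext F1) p * E (Suc 0) (ext F2) p - E (Suc 0) (ext F1) p * E 0 (ext F2) p \<noteq> 0" if "fst p \<noteq> 0" for p
  proof -
    have j: "F1' 0 q * F2' (Suc 0) q - F1' (Suc 0) q * F2' 0 q = - 2 * fst q ^ 3" for q
      by (simp add: F1'_def F2'_def algebra_simps power2_eq_square power3_eq_cube)
    have "ext (F1' 0) p * ext (F2' (Suc 0)) p - ext (F1' (Suc 0)) p * ext (F2' 0) p \<noteq> 0"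
      unfolding ext_def using that j[of p] j[of "(- fst p, - snd p)"] by (cases "fst p > 0") simp_all
    then show ?thesis using 1 2 by simp
  qed
  then show thesis using that dev 1 2 by blast
qed

text \<open>
  Left multiplication by \<open>E 1\<close> is the commutator of the left multiplications by \<open>E 0\<close> and \<open>E 1\<close>, hence
  nilpotent, and its matrix is given by \<open>x\<close>, \<open>y\<close>, \<open>s\<close>, \<open>t\<close>.  If \<open>s = 0\<close> its kernel contains \<open>E 1\<close>.
  Otherwise the kernel is spanned by \<open>E 0 + \<mu> E 1\<close>, and \<open>\<mu>\<close> and \<open>s\<close> determine all structure
  constants.
\<close>

theorem developing_pair_exists:
  obtains \<Omega> F1 F2 K where "\<Omega> = UNIV \<or> \<Omega> = half_domain \<or> (\<exists>s. s \<noteq> 0 \<and> \<Omega> = parabola_domain s)"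
    "developing_pair \<Omega> F1 F2 K" "G.affine_fun D (ext F1)" "G.affine_fun D (ext F2)"
    "\<And>p. fst p \<noteq> 0 \<Longrightarrow> E 0 (ext F1) p * E (Suc 0) (ext F2) p - E (Suc 0) (ext F1) p * E 0 (ext F2) p \<noteq> 0"
proof -
  define \<alpha> \<beta> where "\<alpha> = \<Gamma> 0 0 0" and "\<beta> = \<Gamma> 0 0 (Suc 0)"
  define x y where "x = \<Gamma> (Suc 0) 0 0" and "y = \<Gamma> (Suc 0) 0 (Suc 0)"
  define s t where "s = \<Gamma> (Suc 0) (Suc 0) 0" and "t = \<Gamma> (Suc 0) (Suc 0) (Suc 0)"
  note defs = \<alpha>_def \<beta>_def x_def y_def s_def t_def
  have 1: "x * y - \<beta> * s = x" and 2: "x * \<beta> + y * y - \<alpha> * y - \<beta> * t = 0"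
    and 3: "s * \<alpha> + t * x - x * x - (y + 1) * s = s" and 4: "s * \<beta> - x * y = t"
    using flat_eq[of 0 0] flat_eq[of 0 "Suc 0"] flat_eq[of "Suc 0" 0] flat_eq[of "Suc 0" "Suc 0"]
    by (simp_all add: torsion_eq defs[symmetric] algebra_simps)
  have tx: "t = - x" using 1 4 by (simp add: mult.commute)
  show thesis
  proof (cases "s = 0")
    case True
    then have x: "x = 0" using 3 tx by simp
    then have t: "t = 0" using tx by simp
    have "y * (y - \<alpha>) = 0" using 2 x t by (simp add: algebra_simps)
    then have "y = 0 \<or> y = \<Gamma> 0 0 0" by (auto simp: \<alpha>_def)
    then show thesis
      using developing_pair_nilpotent[of y] x t True that unfolding defs by metis
  next
    case s: False
    define \<mu> where "\<mu> = - x / s"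
    have x: "x = - s * \<mu>" using s by (simp add: \<mu>_def)
    have "s * (\<beta> + \<mu> * (y - 1)) = 0" using 1 by (simp add: x algebra_simps)
    then have \<beta>: "\<beta> = - \<mu> * (y - 1)" using s by simp
    have "s * (\<alpha> - 2 * s * \<mu>\<^sup>2 - y - 2) = 0"
      using 3 by (simp add: tx x algebra_simps power2_eq_square)
    then have \<alpha>: "\<alpha> = 2 * s * \<mu>\<^sup>2 + y + 2" using s by simp
    have y: "y = - s * \<mu>\<^sup>2"
      using 2 unfolding tx x \<alpha> \<beta> by (simp add: algebra_simps power2_eq_square)
    have "\<alpha> = s * \<mu>\<^sup>2 + 2" "\<beta> = \<mu> + s * \<mu> ^ 3" "t = s * \<mu>"
      unfolding \<alpha> \<beta> tx x y by (simp_all add: algebra_simps power2_eq_square power3_eq_cube)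
    then show thesis
      using developing_pair_parabolic[of s \<mu>] x y s that unfolding defs by metis
  qed
qed

end


section \<open>Affine maps of the plane\<close>

text \<open>
  An affine map is encoded by its six coefficients, the entries of the first two rows of its
  matrix; codes that vanish from index 6 on are determined by the map.
\<close>

definition ap :: "(nat \<Rightarrow> real) \<Rightarrow> real \<times> real \<Rightarrow> real \<times> real" where
  "ap c z = (c 0 * fst z + c 1 * snd z + c 2, c 3 * fst z + c 4 * snd z + c 5)"

definition row :: "real \<Rightarrow> real \<Rightarrow> real \<Rightarrow> real \<Rightarrow> real \<Rightarrow> real \<Rightarrow> nat \<Rightarrow> real" where
  "row a b c d e f = (\<lambda>i. if i = 0 then a else if i = 1 then b else if i = 2 then c
     else if i = 3 then d else if i = 4 then e else if i = 5 then f else 0)"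

definition cdet :: "(nat \<Rightarrow> real) \<Rightarrow> real" where
  "cdet c = c 0 * c 4 - c 1 * c 3"

definition cmul :: "(nat \<Rightarrow> real) \<Rightarrow> (nat \<Rightarrow> real) \<Rightarrow> nat \<Rightarrow> real" where
  "cmul c d = row (c 0 * d 0 + c 1 * d 3) (c 0 * d 1 + c 1 * d 4) (c 0 * d 2 + c 1 * d 5 + c 2)
     (c 3 * d 0 + c 4 * d 3) (c 3 * d 1 + c 4 * d 4) (c 3 * d 2 + c 4 * d 5 + c 5)"

definition cinv :: "(nat \<Rightarrow> real) \<Rightarrow> nat \<Rightarrow> real" where
  "cinv c = row (c 4 / cdet c) (- c 1 / cdet c) ((c 1 * c 5 - c 4 * c 2) / cdet c)
     (- c 3 / cdet c) (c 0 / cdet c) ((c 3 * c 2 - c 0 * c 5) / cdet c)"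

definition cone :: "nat \<Rightarrow> real" where
  "cone = row 1 0 0 0 1 0"

lemma row_simps [simp]:
  "row a b c d e f 0 = a" "row a b c d e f (Suc 0) = b" "row a b c d e f 2 = c" "row a b c d e f 3 = d"
  "row a b c d e f 4 = e" "row a b c d e f 5 = f" "row a b c d e f 1 = b"
  by (simp_all add: row_def)

lemma row_Eset: "row a b c d e f \<in> Eset 6"
  by (simp add: row_def)

lemma Eset_6_eqI:
  assumes "c \<in> Eset 6" "d \<in> Eset 6" "c 0 = d 0" "c 1 = d 1" "c 2 = d 2" "c 3 = d 3" "c 4 = d 4" "c 5 = d 5"
  shows "c = d"
proof
  fix i :: nat
  consider "i = 0" | "i = 1" | "i = 2" | "i = 3" | "i = 4" | "i = 5" | "i \<ge> 6" by linarith
  then show "c i = d i" by cases (use assms in auto)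
qed

lemma ap_cmul: "ap (cmul c d) z = ap c (ap d z)"
  by (simp add: ap_def cmul_def algebra_simps)

lemma ap_cone: "ap cone z = z"
  by (simp add: ap_def cone_def)

lemma cdet_cmul: "cdet (cmul c d) = cdet c * cdet d"
  by (simp add: cdet_def cmul_def algebra_simps)

lemma cdet_cone: "cdet cone = 1"
  by (simp add: cdet_def cone_def)

lemma cmul_cinv:
  assumes "cdet c \<noteq> 0"
  shows "cmul c (cinv c) = cone" "cmul (cinv c) c = cone"
proof -
  define e where "e = inverse (cdet c)"
  have e: "e * (c 0 * c 4 - c 1 * c 3) = 1" using assms by (simp add: e_def cdet_def)
  show "cmul c (cinv c) = cone"
    by (rule Eset_6_eqI; simp only: cmul_def cinv_def cone_def row_simps row_Eset divide_inverse e_def[symmetric])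
       (use e in \<open>algebra | simp add: algebra_simps\<close>)+
  show "cmul (cinv c) c = cone"
    by (rule Eset_6_eqI; simp only: cmul_def cinv_def cone_def row_simps row_Eset divide_inverse e_def[symmetric])
       (use e in \<open>algebra | simp add: algebra_simps\<close>)+
qed

lemma ap_cinv:
  assumes "cdet c \<noteq> 0"
  shows "ap c (ap (cinv c) z) = z" "ap (cinv c) (ap c z) = z"
  using cmul_cinv[OF assms] by (simp_all add: ap_cmul[symmetric] ap_cone)

lemma cdet_cinv: "cdet c \<noteq> 0 \<Longrightarrow> cdet (cinv c) \<noteq> 0"
  using cdet_cmul[of c "cinv c"] cmul_cinv(1)[of c] cdet_cone by auto

definition stabilizer :: "(real \<times> real) set \<Rightarrow> (nat \<Rightarrow> real) set" where
  "stabilizer \<Omega> = {c \<in> Eset 6. cdet c \<noteq> 0 \<and> ap c ` \<Omega> = \<Omega>}"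

lemma stabilizer_cone: "cone \<in> stabilizer \<Omega>"
  using row_Eset by (simp add: stabilizer_def cdet_cone ap_cone cone_def[symmetric]) (simp add: cone_def row_Eset)

lemma stabilizer_cmul: "c \<in> stabilizer \<Omega> \<Longrightarrow> d \<in> stabilizer \<Omega> \<Longrightarrow> cmul c d \<in> stabilizer \<Omega>"
proof -
  assume *: "c \<in> stabilizer \<Omega>" "d \<in> stabilizer \<Omega>"
  have "ap (cmul c d) ` \<Omega> = ap c ` (ap d ` \<Omega>)" by (simp add: ap_cmul image_image)
  moreover have "cmul c d \<in> Eset 6" unfolding cmul_def by (rule row_Eset)
  ultimately show ?thesis using * by (simp add: stabilizer_def cdet_cmul)
qed

lemma stabilizer_cinv: "c \<in> stabilizer \<Omega> \<Longrightarrow> cinv c \<in> stabilizer \<Omega>"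
proof -
  assume *: "c \<in> stabilizer \<Omega>"
  then have nz: "cdet c \<noteq> 0" and im: "ap c ` \<Omega> = \<Omega>" by (simp_all add: stabilizer_def)
  have "ap (cinv c) ` (ap c ` \<Omega>) = \<Omega>" by (simp add: image_image ap_cinv[OF nz])
  then have "ap (cinv c) ` \<Omega> = \<Omega>" unfolding im .
  moreover have "cinv c \<in> Eset 6" unfolding cinv_def by (rule row_Eset)
  ultimately show ?thesis using * cdet_cinv by (simp add: stabilizer_def)
qed

lemma stabilizer_ap: "c \<in> stabilizer \<Omega> \<Longrightarrow> z \<in> \<Omega> \<Longrightarrow> ap c z \<in> \<Omega>"
  by (auto simp: stabilizer_def)

text \<open>A small multiple of a vector in the kernel of the linear part can be added inside \<open>\<Omega>\<close>.\<close>

lemma cdet_nonzero_if_inj: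
  assumes \<Omega>: "open \<Omega>" "\<Omega> \<noteq> {}" and inj: "inj_on (ap c) \<Omega>"
  shows "cdet c \<noteq> 0"
proof
  assume 0: "cdet c = 0"
  have "\<exists>v. v \<noteq> (0, 0) \<and> c 0 * fst v + c 1 * snd v = 0 \<and> c 3 * fst v + c 4 * snd v = 0"
  proof (cases "c 0 = 0 \<and> c 1 = 0")
    case True
    then show ?thesis
      by (cases "c 3 = 0 \<and> c 4 = 0"; intro exI[of _ "if c 3 = 0 \<and> c 4 = 0 then (1, 0) else (- c 4, c 3)"])
         auto
  next
    case False
    then show ?thesis using 0
      by (intro exI[of _ "(- c 1, c 0)"]) (auto simp: cdet_def algebra_simps)
  qed
  then obtain v where v: "v \<noteq> (0, 0)" "c 0 * fst v + c 1 * snd v = 0" "c 3 * fst v + c 4 * snd v = 0" by blast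
  obtain z where z: "z \<in> \<Omega>" using \<Omega>(2) by blast
  have "((\<lambda>t. z + t *\<^sub>R v) \<longlongrightarrow> z + 0 *\<^sub>R v) (at_right 0)" by (intro tendsto_intros)
  then have "((\<lambda>t. z + t *\<^sub>R v) \<longlongrightarrow> z) (at_right 0)" by simp
  then have "eventually (\<lambda>t. z + t *\<^sub>R v \<in> \<Omega>) (at_right (0::real))"
    by (rule topological_tendstoD[OF _ \<Omega>(1) z])
  then have "eventually (\<lambda>t. z + t *\<^sub>R v \<in> \<Omega> \<and> 0 < t) (at_right (0::real))"
    using eventually_at_right_less by (rule eventually_conj)
  then obtain t :: real where t: "z + t *\<^sub>R v \<in> \<Omega>" "0 < t"
    using eventually_happens' trivial_limit_at_right_real by blast
  have "ap c (z + t *\<^sub>R v) = ap c z"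
  proof -
    have "c 0 * (t * fst v) + c 1 * (t * snd v) = t * (c 0 * fst v + c 1 * snd v)"
      "c 3 * (t * fst v) + c 4 * (t * snd v) = t * (c 3 * fst v + c 4 * snd v)" by (simp_all add: algebra_simps)
    then have "c 0 * (t * fst v) + c 1 * (t * snd v) = 0" "c 3 * (t * fst v) + c 4 * (t * snd v) = 0" using v by simp_all
    then show ?thesis by (simp add: ap_def algebra_simps)
  qed
  then have "z + t *\<^sub>R v = z" using inj z t(1) by (meson inj_onD)
  then show False using t(2) v(1) by (simp add: zero_prod_def[symmetric])
qed


section \<open>Affine transformations of a developed structure\<close>

definition comp :: "real \<times> real \<Rightarrow> bool" where
  "comp p \<longleftrightarrow> fst p < 0"

locale developed = flat_structure +
  fixes \<Omega> :: "(real \<times> real) set" and F1 F2 :: "real \<times> real \<Rightarrow> real" and K :: "real \<times> real \<Rightarrow> real \<times> real"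
  assumes dev: "developing_pair \<Omega> F1 F2 K"
    and aff: "G.affine_fun D (ext F1)" "G.affine_fun D (ext F2)"
    and nondeg: "\<And>p. fst p \<noteq> 0 \<Longrightarrow> E 0 (ext F1) p * E (Suc 0) (ext F2) p - E (Suc 0) (ext F1) p * E 0 (ext F2) p \<noteq> 0"
begin

definition F :: "real \<times> real \<Rightarrow> real \<times> real" where
  "F p = (ext F1 p, ext F2 p)"

text \<open>
  The second component is developed through left translation by \<open>(-1, 0)\<close>, which is negation of
  both coordinates; so \<open>comp\<close> and \<open>F\<close> identify the affine group with two copies of \<open>\<Omega>\<close>, and \<open>KK\<close>
  inverts this.
\<close>

definition KK :: "bool \<Rightarrow> real \<times> real \<Rightarrow> real \<times> real" where
  "KK i z = (if i then - K z else K z)"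

lemma F_smooth: "ext F1 \<in> G.SF" "ext F2 \<in> G.SF"
  using aff by (auto simp: G.affine_fun_def)

lemma Omega_open: "open \<Omega>"
  using dev by (simp add: developing_pair_def)

lemma F_in: "fst p \<noteq> 0 \<Longrightarrow> F p \<in> \<Omega>"
proof -
  assume p: "fst p \<noteq> 0"
  have in_Omega: "(F1 q, F2 q) \<in> \<Omega>" if "0 < fst q" for q
    using dev that unfolding developing_pair_def by blast
  show ?thesis
    using p in_Omega[of p] in_Omega[of "(- fst p, - snd p)"]
    by (cases "0 < fst p") (simp_all add: F_def ext_def)
qed

lemma KK_F: "fst p \<noteq> 0 \<Longrightarrow> KK (comp p) (F p) = p"
proof -
  assume p: "fst p \<noteq> 0"
  have K: "K (F1 q, F2 q) = q" if "0 < fst q" for q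
    using dev that unfolding developing_pair_def by blast
  show ?thesis
  proof (cases "0 < fst p")
    case True
    then show ?thesis using K[of p] by (simp add: KK_def comp_def F_def ext_def)
  next
    case False
    then show ?thesis using p K[of "(- fst p, - snd p)"] by (simp add: KK_def comp_def F_def ext_def)
  qed
qed

lemma
  assumes "z \<in> \<Omega>"
  shows fst_KK: "fst (KK i z) \<noteq> 0" and comp_KK: "comp (KK i z) = i" and F_KK: "F (KK i z) = z"
proof -
  have K: "0 < fst (K z)" "F1 (K z) = fst z" "F2 (K z) = snd z"
    using dev assms unfolding developing_pair_def by blast+
  then show "fst (KK i z) \<noteq> 0" "comp (KK i z) = i" "F (KK i z) = z"
    by (auto simp: KK_def comp_def F_def ext_def)
qed

lemma Omega_nonempty: "\<Omega> \<noteq> {}"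
  using F_in[of "(1, 0)"] by auto

text \<open>The two values are linear equations for the two components, with nonzero determinant.\<close>

lemma separating:
  assumes Z: "Z \<in> G.VF" and Z': "Z' \<in> G.VF" and eq: "Z (ext F1) = Z' (ext F1)" "Z (ext F2) = Z' (ext F2)"
  shows "Z = Z'"
proof -
  obtain u v where uv: "u \<in> G.SF" "v \<in> G.SF" "Z = lc u v" using ex_lc[OF Z] .
  obtain w z where wz: "w \<in> G.SF" "z \<in> G.SF" "Z' = lc w z" using ex_lc[OF Z'] .
  have "u p = w p \<and> v p = z p" for p
  proof (cases "fst p = 0")
    case True
    then have "p \<notin> points GM" by (simp add: points_GM)
    then show ?thesis
      using G.smooth_fun_off[OF uv(1)] G.smooth_fun_off[OF uv(2)] G.smooth_fun_off[OF wz(1)] G.smooth_fun_off[OF wz(2)]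
      by simp
  next
    case False
    define a b c d where "a = E 0 (ext F1) p" and "b = E (Suc 0) (ext F1) p"
      and "c = E 0 (ext F2) p" and "d = E (Suc 0) (ext F2) p"
    have J: "a * d - b * c \<noteq> 0" using nondeg[OF False] by (simp add: a_def b_def c_def d_def)
    have 1: "u p * a + v p * b = w p * a + z p * b" "u p * c + v p * d = w p * c + z p * d"
      using fun_cong[OF eq(1), of p] fun_cong[OF eq(2), of p] unfolding uv wz lc_apply a_def b_def c_def d_def
      by auto
    have "(u p - w p) * (a * d - b * c) = 0" "(v p - z p) * (a * d - b * c) = 0"
      using 1 by algebra+
    then show ?thesis using J by simp
  qed
  then show ?thesis using uv wz by (metis ext)
qed

text \<open>Cramer's rule gives the coordinate fields of the coordinates \<open>F1\<close> and \<open>F2\<close>.\<close>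

lemma dual_fields:
  obtains Z1 Z2 where "Z1 \<in> G.VF" "Z2 \<in> G.VF"
    "Z1 (ext F1) = G.cst 1" "Z1 (ext F2) = G.cst 0" "Z2 (ext F1) = G.cst 0" "Z2 (ext F2) = G.cst 1"
proof -
  define J where "J p = E 0 (ext F1) p * E (Suc 0) (ext F2) p - E (Suc 0) (ext F1) p * E 0 (ext F2) p" for p
  note Es = G.vf_smooth[OF E_vf F_smooth(1)] G.vf_smooth[OF E_vf F_smooth(2)]
  have Js: "J \<in> G.SF" unfolding J_def[abs_def] by (intro G.diff_smooth G.mult_smooth Es)
  have Is: "(\<lambda>p. inverse (J p)) \<in> G.SF"
    unfolding G_smooth_iff
  proof
    show "C_inf_on 2 gW (\<lambda>x. inverse (J (x 0, x (Suc 0))))"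
    proof (rule C_inf_inverse[OF gW_open])
      show "J (x 0, x (Suc 0)) \<noteq> 0" if "x \<in> gW" for x
        using nondeg[of "(x 0, x (Suc 0))"] that by (simp add: J_def gW_def)
    qed (use Js in \<open>simp add: G_smooth_iff\<close>)
  qed (use Js in \<open>simp add: G_smooth_iff\<close>)
  define Z1 where "Z1 = lc (\<lambda>p. inverse (J p) * E (Suc 0) (ext F2) p) (\<lambda>p. inverse (J p) * ((-1) * E 0 (ext F2) p))"
  define Z2 where "Z2 = lc (\<lambda>p. inverse (J p) * ((-1) * E (Suc 0) (ext F1) p)) (\<lambda>p. inverse (J p) * E 0 (ext F1) p)"
  have Jn: "J p \<noteq> 0 \<longleftrightarrow> fst p \<noteq> 0" for p
    using nondeg[of p] G.smooth_fun_off[OF Js, of p] by (auto simp: points_GM J_def)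
  have Zs: "Z1 \<in> G.VF" "Z2 \<in> G.VF" unfolding Z1_def Z2_def
    by (intro lc_vf G.mult_smooth Is G.cmult_smooth Es)+
  have J1: "inverse (J p) * J p = G.cst 1 p" for p using Jn[of p] by (simp add: G_cst)
  have "Z1 (ext F1) p = inverse (J p) * J p" "Z1 (ext F2) p = 0" "Z2 (ext F1) p = 0" "Z2 (ext F2) p = inverse (J p) * J p" for p
    unfolding Z1_def Z2_def lc_apply J_def[of p] by (simp_all add: algebra_simps)
  then have "Z1 (ext F1) = G.cst 1" "Z1 (ext F2) = G.cst 0" "Z2 (ext F1) = G.cst 0" "Z2 (ext F2) = G.cst 1"
    unfolding J1 by (auto simp: fun_eq_iff G_cst)
  then show thesis using that Zs by blast
qed

lemma constant_on_component:
  assumes g: "g \<in> G.SF"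
    and z: "\<And>p k. fst p \<noteq> 0 \<Longrightarrow> comp p = i \<Longrightarrow> E 0 g p = 0 \<and> E (Suc 0) g p = 0"
  obtains k where "\<And>p. fst p \<noteq> 0 \<Longrightarrow> comp p = i \<Longrightarrow> g p = k"
proof -
  have pd: "G.pd j g p = 0" if "fst p \<noteq> 0" "comp p = i" "j < 2" for j p
    using z[OF that(1,2)] that E_apply[OF g, of j] by (auto simp: less_2)
  have b: "g (a, y) = g (a, 0)" if "a \<noteq> 0" "comp (a, 0) = i" for a y
  proof -
    have "\<forall>y. ((\<lambda>t. g (a, t)) has_field_derivative 0) (at y)"
      using G_has_pd_1[OF g that(1)] pd[of "(a, _)" "Suc 0"] that by (simp add: comp_def)
    then show ?thesis using DERIV_const_ratio_const DERIV_isconst_all by blast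
  qed
  let ?S = "if i then {..<0::real} else {0<..}"
  have S: "a \<in> ?S \<longleftrightarrow> a \<noteq> 0 \<and> comp (a, 0) = i" for a by (auto simp: comp_def)
  have "((\<lambda>t. g (t, 0)) has_field_derivative 0) (at a within ?S)" if "a \<in> ?S" for a
    using G_has_pd_0[OF g, of a 0] pd[of "(a, 0)" 0] that S[of a] by (auto intro: has_field_derivative_at_within)
  moreover have "convex ?S" by simp
  ultimately obtain k where k: "\<And>a. a \<in> ?S \<Longrightarrow> g (a, 0) = k"
    using has_field_derivative_zero_constant[of ?S "\<lambda>t. g (t, 0)"] by blast
  show thesis
  proof (rule that)
    fix p assume "fst p \<noteq> 0" "comp p = i"
    then show "g p = k" using b[of "fst p" "snd p"] k[of "fst p"] S[of "fst p"] by (simp add: comp_def)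
  qed
qed

text \<open>
  The dual fields are parallel, because \<open>D Z\<^sub>i Z\<^sub>j F\<^sub>k = Z\<^sub>i (Z\<^sub>j F\<^sub>k)\<close> is the derivative of a constant.
  So the derivatives of an affine function along them are locally constant.
\<close>

lemma affine_fun_form:
  assumes f: "G.affine_fun D f"
  obtains \<alpha> \<beta> \<gamma> where "\<And>p. fst p \<noteq> 0 \<Longrightarrow> comp p = i \<Longrightarrow> f p = \<beta> * fst (F p) + \<gamma> * snd (F p) + \<alpha>"
proof -
  obtain Z1 Z2 where Z: "Z1 \<in> G.VF" "Z2 \<in> G.VF"
    "Z1 (ext F1) = G.cst 1" "Z1 (ext F2) = G.cst 0" "Z2 (ext F1) = G.cst 0" "Z2 (ext F2) = G.cst 1"
    using dual_fields .
  have fs: "f \<in> G.SF" using f by (simp add: G.affine_fun_def)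
  have E_Z: "E k h p = E k (ext F1) p * Z1 h p + E k (ext F2) p * Z2 h p" for k h p
  proof -
    have "E k = fscale (E k (ext F1)) Z1 + fscale (E k (ext F2)) Z2"
    proof (rule separating[OF E_vf])
      show "fscale (E k (ext F1)) Z1 + fscale (E k (ext F2)) Z2 \<in> G.VF"
        by (intro G.vf_plus G.vf_fscale Z G.vf_smooth[OF E_vf] F_smooth)
      have off: "E k h p = 0" if "h \<in> G.SF" "fst p = 0" for h p
        using G.smooth_fun_off[OF G.vf_smooth[OF E_vf that(1)]] that(2) by (simp add: points_GM)
      show "E k (ext F1) = (fscale (E k (ext F1)) Z1 + fscale (E k (ext F2)) Z2) (ext F1)"
        "E k (ext F2) = (fscale (E k (ext F1)) Z1 + fscale (E k (ext F2)) Z2) (ext F2)"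
        unfolding G.vf_plus_apply G.fscale_apply Z by (auto simp: G_cst off F_smooth fun_eq_iff)
    qed
    then have "E k h = (fscale (E k (ext F1)) Z1 + fscale (E k (ext F2)) Z2) h" by (rule fun_cong)
    then show ?thesis unfolding G.vf_plus_apply G.fscale_apply by simp
  qed
  have zero: "(\<lambda>f p. 0) \<in> G.VF" by (rule G.vfieldI) (auto simp: G.zero_smooth)
  have DZ: "D X Y = (\<lambda>f p. 0)" if "X \<in> {Z1, Z2}" "Y \<in> {Z1, Z2}" for X Y
  proof -
    have XY: "X \<in> G.VF" "Y \<in> G.VF" using that Z by auto
    have "X (Y (ext F1)) = (\<lambda>p. 0)" "X (Y (ext F2)) = (\<lambda>p. 0)"
      using that Z G.vf_cst[OF XY(1)] by auto
    then show ?thesis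
      using separating[OF D_vf[OF XY] zero] aff XY by (simp add: G.affine_fun_def)
  qed
  have ZZ: "X (Y f) = (\<lambda>p. 0)" if "X \<in> {Z1, Z2}" "Y \<in> {Z1, Z2}" for X Y
  proof -
    have "X \<in> G.VF" "Y \<in> G.VF" using that Z by auto
    then have "X (Y f) = D X Y f" using f by (simp add: G.affine_fun_def)
    then show ?thesis using DZ[OF that] by simp
  qed
  have EZ0: "E k (Y f) p = 0" if "Y \<in> {Z1, Z2}" for k Y p
    using E_Z[of k "Y f" p] ZZ[OF _ that, of Z1] ZZ[OF _ that, of Z2] by simp
  obtain \<beta> where \<beta>: "\<And>p. fst p \<noteq> 0 \<Longrightarrow> comp p = i \<Longrightarrow> Z1 f p = \<beta>"
    using constant_on_component[OF G.vf_smooth[OF Z(1) fs], of i] EZ0[of Z1] by blast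
  obtain \<gamma> where \<gamma>: "\<And>p. fst p \<noteq> 0 \<Longrightarrow> comp p = i \<Longrightarrow> Z2 f p = \<gamma>"
    using constant_on_component[OF G.vf_smooth[OF Z(2) fs], of i] EZ0[of Z2] by blast
  define h where "h p = f p - (\<beta> * ext F1 p + \<gamma> * ext F2 p)" for p
  have hs: "h \<in> G.SF" unfolding h_def[abs_def]
    by (intro G.diff_smooth G.add_smooth G.cmult_smooth fs F_smooth)
  have Xh: "X h = (\<lambda>p. X f p - (\<beta> * X (ext F1) p + \<gamma> * X (ext F2) p))" if X: "X \<in> G.VF" for X
    unfolding h_def[abs_def]
    by (simp add: G.vf_diff[OF X] G.vf_add[OF X] G.vf_cmult[OF X] G.add_smooth G.cmult_smooth fs F_smooth)
  have "E k h p = 0" if p: "fst p \<noteq> 0" "comp p = i" for k p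
  proof -
    have "Z1 h p = 0" "Z2 h p = 0"
      using \<beta>[OF p] \<gamma>[OF p] p unfolding Xh[OF Z(1)] Xh[OF Z(2)] Z(3-6) by (simp_all add: G_cst)
    then show ?thesis using E_Z[of k h p] by simp
  qed
  then obtain \<alpha> where \<alpha>: "\<And>p. fst p \<noteq> 0 \<Longrightarrow> comp p = i \<Longrightarrow> h p = \<alpha>"
    using constant_on_component[OF hs, of i] by blast
  show thesis by (rule that[of \<beta> \<gamma> \<alpha>]) (use \<alpha> in \<open>force simp: h_def F_def\<close>)
qed

end


lemma bool_neq_neq: "((i \<noteq> e) \<noteq> e) = i" for i e :: bool
  by auto

lemma open_component: "open {p. fst p \<noteq> 0 \<and> comp p = i}"
proof -
  have "{p. fst p \<noteq> 0 \<and> comp p = i} = (if i then {p. fst p < 0} else {p. 0 < fst p})"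
    by (auto simp: comp_def)
  moreover have "open {p::real \<times> real. fst p < 0}" "open {p::real \<times> real. 0 < fst p}"
    by (intro open_Collect_less continuous_intros)+
  ultimately show ?thesis by simp
qed

context developed
begin

text \<open>
  \<open>act \<epsilon> c\<close> exchanges the components if \<open>\<epsilon>\<close> holds and is, read through the developing map, the
  affine map \<open>ap (c i)\<close> on the component \<open>i\<close>.
\<close>

definition act :: "bool \<Rightarrow> (bool \<Rightarrow> nat \<Rightarrow> real) \<Rightarrow> real \<times> real \<Rightarrow> real \<times> real" where
  "act \<epsilon> c = (\<lambda>g\<in>points GM. KK (comp g \<noteq> \<epsilon>) (ap (c (comp g)) (F g)))"

abbreviation "S \<equiv> stabilizer \<Omega>"

lemma act_apply: "fst g \<noteq> 0 \<Longrightarrow> act \<epsilon> c g = KK (comp g \<noteq> \<epsilon>) (ap (c (comp g)) (F g))"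
  by (simp add: act_def points_GM)

lemma
  assumes c: "\<And>i. c i \<in> S" and g: "fst g \<noteq> 0"
  shows fst_act: "fst (act \<epsilon> c g) \<noteq> 0"
    and comp_act: "comp (act \<epsilon> c g) = (comp g \<noteq> \<epsilon>)"
    and F_act: "F (act \<epsilon> c g) = ap (c (comp g)) (F g)"
  unfolding act_apply[OF g]
  using fst_KK comp_KK F_KK stabilizer_ap[OF c F_in[OF g]] by auto

lemma act_act:
  assumes c: "\<And>i. c i \<in> S" and c': "\<And>i. c' i \<in> S" and g: "fst g \<noteq> 0"
  shows "act \<epsilon> c (act \<epsilon>' c' g) = act (\<epsilon> \<noteq> \<epsilon>') (\<lambda>i. cmul (c (i \<noteq> \<epsilon>')) (c' i)) g"
proof -
  have e: "((comp g \<noteq> \<epsilon>') \<noteq> \<epsilon>) = (comp g \<noteq> (\<epsilon> \<noteq> \<epsilon>'))" by auto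
  have gg: "fst (act \<epsilon>' c' g) \<noteq> 0" "comp (act \<epsilon>' c' g) = (comp g \<noteq> \<epsilon>')" "F (act \<epsilon>' c' g) = ap (c' (comp g)) (F g)"
    using fst_act[OF c' g] comp_act[OF c' g] F_act[OF c' g] by auto
  have "act \<epsilon> c (act \<epsilon>' c' g) = KK ((comp g \<noteq> \<epsilon>') \<noteq> \<epsilon>) (ap (c (comp g \<noteq> \<epsilon>')) (ap (c' (comp g)) (F g)))"
    using act_apply[OF gg(1), of \<epsilon> c] unfolding gg(2,3) .
  then show ?thesis unfolding act_apply[OF g, of "\<epsilon> \<noteq> \<epsilon>'"] e ap_cmul .
qed

lemma act_one: "fst g \<noteq> 0 \<Longrightarrow> act False (\<lambda>_. cone) g = g"
  by (simp add: act_apply ap_cone KK_F)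

definition cinvs :: "bool \<Rightarrow> (bool \<Rightarrow> nat \<Rightarrow> real) \<Rightarrow> bool \<Rightarrow> nat \<Rightarrow> real" where
  "cinvs \<epsilon> c i = cinv (c (i \<noteq> \<epsilon>))"

lemma cinvs_S: "(\<And>i. c i \<in> S) \<Longrightarrow> cinvs \<epsilon> c i \<in> S"
  by (simp add: cinvs_def stabilizer_cinv)

lemma act_inverse:
  assumes c: "\<And>i. c i \<in> S" and g: "fst g \<noteq> 0"
  shows "act \<epsilon> (cinvs \<epsilon> c) (act \<epsilon> c g) = g" "act \<epsilon> c (act \<epsilon> (cinvs \<epsilon> c) g) = g"
proof -
  have d: "cdet (c i) \<noteq> 0" for i using c[of i] by (simp add: stabilizer_def)
  have 1: "(\<lambda>i. cmul (cinvs \<epsilon> c (i \<noteq> \<epsilon>)) (c i)) = (\<lambda>_. cone)"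
    unfolding cinvs_def bool_neq_neq by (simp add: cmul_cinv d)
  have 2: "(\<lambda>i. cmul (c (i \<noteq> \<epsilon>)) (cinvs \<epsilon> c i)) = (\<lambda>_. cone)"
    by (auto simp: cinvs_def cmul_cinv d)
  show "act \<epsilon> (cinvs \<epsilon> c) (act \<epsilon> c g) = g"
    using act_act[of "cinvs \<epsilon> c" c g \<epsilon> \<epsilon>, OF cinvs_S[OF c] c g] 1 act_one[OF g] by simp
  show "act \<epsilon> c (act \<epsilon> (cinvs \<epsilon> c) g) = g"
    using act_act[of c "cinvs \<epsilon> c" g \<epsilon> \<epsilon>, OF c cinvs_S[OF c] g] 2 act_one[OF g] by simp
qed

lemma act_extensional: "act \<epsilon> c \<in> extensional (points GM)"
  by (simp add: act_def)


subsection \<open>The transformations are diffeomorphisms\<close>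

lemma K_smooth:
  "C_inf_on 2 {x \<in> Eset 2. (x 0, x (Suc 0)) \<in> \<Omega>} (\<lambda>x. fst (K (x 0, x (Suc 0))))"
  "C_inf_on 2 {x \<in> Eset 2. (x 0, x (Suc 0)) \<in> \<Omega>} (\<lambda>x. snd (K (x 0, x (Suc 0))))"
  using dev by (simp_all add: developing_pair_def)

lemma smooth_K_ap_F:
  assumes c: "c \<in> S"
  shows "C_inf_on 2 gW (\<lambda>x. fst (K (ap c (F (x 0, x (Suc 0))))))" "C_inf_on 2 gW (\<lambda>x. snd (K (ap c (F (x 0, x (Suc 0))))))"
proof -
  define g where "g x = gco (ap c (F (x 0, x (Suc 0))))" for x
  let ?T = "{x \<in> Eset 2. (x 0, x (Suc 0)) \<in> \<Omega>}"
  have To: "openin (Euclidean_space 2) ?T" by (rule openin_Eset_2[OF Omega_open])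
  have s: "C_inf_on 2 gW (\<lambda>x. ext F1 (x 0, x (Suc 0)))" "C_inf_on 2 gW (\<lambda>x. ext F2 (x 0, x (Suc 0)))"
    using F_smooth by (simp_all add: G_smooth_iff)
  have gs: "C_inf_on 2 gW (\<lambda>x. g x j)" if "j < 2" for j
    using that unfolding less_2 g_def ap_def F_def fst_conv snd_conv
    by (elim disjE; simp only: gco_simps fst_conv snd_conv)
       (intro C_inf_add C_inf_mult C_inf_const s gW_open)+
  have gT: "g x \<in> ?T" if "x \<in> gW" for x
    using stabilizer_ap[OF c F_in, of "(x 0, x (Suc 0))"] that gco_simps(3) by (simp add: g_def gW_def)
  show "C_inf_on 2 gW (\<lambda>x. fst (K (ap c (F (x 0, x (Suc 0))))))"
    using C_inf_compose[OF gW_open To K_smooth(1) gs gT] by (simp add: g_def)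
  show "C_inf_on 2 gW (\<lambda>x. snd (K (ap c (F (x 0, x (Suc 0))))))"
    using C_inf_compose[OF gW_open To K_smooth(2) gs gT] by (simp add: g_def)
qed

lemma C_inf_by_components:
  assumes "\<And>i. C_inf_on 2 gW (u i)" and "\<And>i x. x \<in> gW \<Longrightarrow> comp (x 0, x (Suc 0)) = i \<Longrightarrow> f x = u i x"
  shows "C_inf_on 2 gW f"
proof (rule C_inf_local[OF gW_open])
  fix x assume x: "x \<in> gW"
  define i where "i = comp (x 0, x (Suc 0))"
  let ?T = "{x \<in> Eset 2. (x 0, x (Suc 0)) \<in> {p. fst p \<noteq> 0 \<and> comp p = i}}"
  have To: "openin (Euclidean_space 2) ?T" by (rule openin_Eset_2[OF open_component])
  have TW: "?T \<subseteq> gW" by (auto simp: gW_def)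
  have "C_inf_on 2 ?T f"
    by (rule C_inf_cong[OF To _ C_inf_subset[OF gW_open To TW assms(1)[of i]]])
       (use assms(2)[of _ i] in \<open>auto simp: gW_def\<close>)
  moreover have "x \<in> ?T" using x by (auto simp: i_def gW_def)
  ultimately show "\<exists>T. openin (Euclidean_space 2) T \<and> x \<in> T \<and> T \<subseteq> gW \<and> C_inf_on 2 T f"
    using To TW by blast
qed

lemma act_smooth:
  assumes c: "\<And>i. c i \<in> S"
  shows "C_inf_on 2 gW (\<lambda>x. fst (act \<epsilon> c (x 0, x (Suc 0))))" "C_inf_on 2 gW (\<lambda>x. snd (act \<epsilon> c (x 0, x (Suc 0))))"
proof -
  let ?s = "\<lambda>i. if i \<noteq> \<epsilon> then -1 else 1 :: real"
  have e: "act \<epsilon> c (x 0, x (Suc 0)) = KK (comp (x 0, x (Suc 0)) \<noteq> \<epsilon>) (ap (c (comp (x 0, x (Suc 0)))) (F (x 0, x (Suc 0))))"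
    if "x \<in> gW" for x using that by (simp add: act_apply gW_def)
  show "C_inf_on 2 gW (\<lambda>x. fst (act \<epsilon> c (x 0, x (Suc 0))))"
    by (rule C_inf_by_components[of "\<lambda>i x. ?s i * fst (K (ap (c i) (F (x 0, x (Suc 0)))))"])
       (auto simp: e KK_def intro!: C_inf_minus gW_open smooth_K_ap_F c)
  show "C_inf_on 2 gW (\<lambda>x. snd (act \<epsilon> c (x 0, x (Suc 0))))"
    by (rule C_inf_by_components[of "\<lambda>i x. ?s i * snd (K (ap (c i) (F (x 0, x (Suc 0)))))"])
       (auto simp: e KK_def intro!: C_inf_minus gW_open smooth_K_ap_F c)
qed

lemma act_diffeo:
  assumes c: "\<And>i. c i \<in> S"
  shows "diffeo GM (act \<epsilon> c)"
proof -
  note c' = cinvs_S[OF c]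
  have e: "act \<epsilon> c \<in> extensional {p. fst p \<noteq> 0}" using act_extensional by (simp add: points_GM)
  note d = G_diffeoI[OF e fst_act[of c _ \<epsilon>, OF c] fst_act[of "cinvs \<epsilon> c" _ \<epsilon>, OF c']
      act_inverse[of c _ \<epsilon>, OF c] act_smooth[of c \<epsilon>, OF c] act_smooth[of "cinvs \<epsilon> c" \<epsilon>, OF c']]
  show "diffeo GM (act \<epsilon> c)" by (rule d(1))
qed


subsection \<open>The transformations preserve the connection\<close>

definition ind :: "bool \<Rightarrow> real \<times> real \<Rightarrow> real" where
  "ind i p = (if fst p \<noteq> 0 \<and> comp p = i then 1 else 0)"

lemma ind_smooth: "ind i \<in> G.SF"
  unfolding G_smooth_iff
proof
  show "C_inf_on 2 gW (\<lambda>x. ind i (x 0, x (Suc 0)))"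
    by (rule C_inf_by_components[of "\<lambda>j x. if j = i then 1 else 0"])
       (use C_inf_const[OF gW_open] in \<open>auto simp: ind_def gW_def\<close>)
qed (simp add: ind_def)

text \<open>An idempotent function is killed by every derivation.\<close>

lemma vf_ind:
  assumes X: "X \<in> G.VF"
  shows "X (ind i) = (\<lambda>p. 0)"
proof
  fix p
  have "(\<lambda>p. ind i p * ind i p) = ind i" by (auto simp: ind_def)
  then have "X (ind i) = (\<lambda>p. ind i p * X (ind i) p + ind i p * X (ind i) p)"
    using G.vf_mult[OF X ind_smooth ind_smooth, of i i] by simp
  from fun_cong[OF this, of p] show "X (ind i) p = 0" by (auto simp: ind_def split: if_splits)
qed

lemma affine_ind_mult:
  assumes f: "G.affine_fun D f"
  shows "G.affine_fun D (\<lambda>p. ind i p * f p)"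
proof -
  have fs: "f \<in> G.SF" using f by (simp add: G.affine_fun_def)
  have Xi: "X (\<lambda>p. ind i p * h p) = (\<lambda>p. ind i p * X h p)" if "X \<in> G.VF" "h \<in> G.SF" for X h
    using G.vf_mult[OF that(1) ind_smooth that(2)] vf_ind[OF that(1)] by simp
  show ?thesis
    unfolding G.affine_fun_def
  proof (intro conjI ballI G.mult_smooth ind_smooth fs)
    fix X Y assume XY: "X \<in> G.VF" "Y \<in> G.VF"
    show "D X Y (\<lambda>p. ind i p * f p) = X (Y (\<lambda>p. ind i p * f p))"
      using f XY by (simp add: Xi D_vf fs G.vf_smooth G.affine_fun_def)
  qed
qed

lemma affine_lin:
  assumes f: "G.affine_fun D f" and h: "G.affine_fun D h"
  shows "G.affine_fun D (\<lambda>p. a * f p + b * h p)"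
proof -
  have s: "f \<in> G.SF" "h \<in> G.SF" using f h by (auto simp: G.affine_fun_def)
  have Xl: "X (\<lambda>p. a * u p + b * v p) = (\<lambda>p. a * X u p + b * X v p)" if "X \<in> G.VF" "u \<in> G.SF" "v \<in> G.SF" for X u v
    using that by (simp add: G.vf_add[OF that(1)] G.vf_cmult[OF that(1)] G.cmult_smooth)
  show ?thesis
    unfolding G.affine_fun_def
  proof (intro conjI ballI G.add_smooth G.cmult_smooth s)
    fix X Y assume XY: "X \<in> G.VF" "Y \<in> G.VF"
    show "D X Y (\<lambda>p. a * f p + b * h p) = X (Y (\<lambda>p. a * f p + b * h p))"
      using f h XY by (simp add: Xl D_vf s G.vf_smooth G.affine_fun_def)
  qed
qed

lemma affine_cst: "G.affine_fun D (G.cst a)"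
  unfolding G.affine_fun_def
proof (intro conjI ballI G.cst_smooth)
  fix X Y assume XY: "X \<in> G.VF" "Y \<in> G.VF"
  have "(\<lambda>p. 0) = G.cst 0" by (auto simp: G_cst)
  then show "D X Y (G.cst a) = X (Y (G.cst a))"
    using XY by (simp add: G.vf_cst D_vf)
qed

lemma act_preserves:
  assumes c: "\<And>i. c i \<in> S"
  shows "preserves_connection GM D (act \<epsilon> c)"
proof (rule G.preservesI_affine[OF act_diffeo[of c \<epsilon>, OF c] D_vf, where H = "{ext F1, ext F2}"])
  show "G.affine_fun D h" if "h \<in> {ext F1, ext F2}" for h using that aff by auto
  have A: "G.affine_fun D (\<lambda>p. a * ext F1 p + b * ext F2 p + G.cst d p)" for a b d
    using affine_lin[OF affine_lin[OF aff, of a b] affine_cst[of d], of 1 1] by simp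
  have piecewise: "G.affine_fun D h"
    if "\<And>i. G.affine_fun D (u i)" "\<And>p. h p = ind False p * u False p + ind True p * u True p" for h u
  proof -
    have "G.affine_fun D (\<lambda>p. 1 * (ind False p * u False p) + 1 * (ind True p * u True p))"
      by (intro affine_lin affine_ind_mult that(1))
    moreover have "(\<lambda>p. 1 * (ind False p * u False p) + 1 * (ind True p * u True p)) = h"
      using that(2) by auto
    ultimately show ?thesis by simp
  qed
  have "pull_fun GM (act \<epsilon> c) (ext F1) p =
      ind False p * (c False 0 * ext F1 p + c False 1 * ext F2 p + G.cst (c False 2) p) +
      ind True p * (c True 0 * ext F1 p + c True 1 * ext F2 p + G.cst (c True 2) p)" for p
  proof (cases "fst p = 0")
    case False
    then have "ext F1 (act \<epsilon> c p) = fst (ap (c (comp p)) (F p))" using F_act[OF c, of p \<epsilon>] by (simp add: F_def prod_eq_iff)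
    then show ?thesis using False by (cases "comp p") (simp_all add: pull_fun_def points_GM ind_def ap_def F_def G_cst)
  qed (simp add: pull_fun_def points_GM ind_def)
  then have 1: "G.affine_fun D (pull_fun GM (act \<epsilon> c) (ext F1))"
    by (rule piecewise[rotated, where u = "\<lambda>i p. c i 0 * ext F1 p + c i 1 * ext F2 p + G.cst (c i 2) p"]) (rule A)
  have "pull_fun GM (act \<epsilon> c) (ext F2) p =
      ind False p * (c False 3 * ext F1 p + c False 4 * ext F2 p + G.cst (c False 5) p) +
      ind True p * (c True 3 * ext F1 p + c True 4 * ext F2 p + G.cst (c True 5) p)" for p
  proof (cases "fst p = 0")
    case False
    then have "ext F2 (act \<epsilon> c p) = snd (ap (c (comp p)) (F p))" using F_act[OF c, of p \<epsilon>] by (simp add: F_def prod_eq_iff)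
    then show ?thesis using False by (cases "comp p") (simp_all add: pull_fun_def points_GM ind_def ap_def F_def G_cst)
  qed (simp add: pull_fun_def points_GM ind_def)
  then have 2: "G.affine_fun D (pull_fun GM (act \<epsilon> c) (ext F2))"
    by (rule piecewise[rotated, where u = "\<lambda>i p. c i 3 * ext F1 p + c i 4 * ext F2 p + G.cst (c i 5) p"]) (rule A)
  show "G.affine_fun D (pull_fun GM (act \<epsilon> c) h)" if "h \<in> {ext F1, ext F2}" for h using that 1 2 by auto
qed (use separating in auto)


subsection \<open>All affine transformations arise in this way\<close>

text \<open>
  The pullbacks of \<open>F1\<close> and \<open>F2\<close> are affine functions, which yields the affine maps; by connectedness
  each component is mapped into one component.
\<close>

lemma affine_transformation_is_act:
  assumes phi: "\<phi> \<in> affine_transformations GM D"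
  obtains \<epsilon> c where "\<And>i. c i \<in> S" "\<phi> = act \<epsilon> c"
proof -
  have d: "diffeo GM \<phi>" and p: "preserves_connection GM D \<phi>" using phi by (auto simp: affine_transformations_def)
  have in_G: "fst (\<phi> g) \<noteq> 0" if "fst g \<noteq> 0" for g using G.diffeo_in[OF d, of g] that by (simp add: points_GM)
  have bij: "bij_betw \<phi> {p. fst p \<noteq> 0} {p. fst p \<noteq> 0}" and exts: "\<phi> \<in> extensional {p. fst p \<noteq> 0}"
    using d by (auto simp: diffeo_def Bij_def points_GM)
  have surj: "\<exists>g. fst g \<noteq> 0 \<and> \<phi> g = q" if "fst q \<noteq> 0" for q
  proof -
    have "q \<in> \<phi> ` {p. fst p \<noteq> 0}" using bij_betw_imp_surj_on[OF bij] that by simp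
    then show ?thesis by auto
  qed
  have pull: "G.affine_fun D (pull_fun GM \<phi> (ext F1))" "G.affine_fun D (pull_fun GM \<phi> (ext F2))"
    using G.preserves_imp_affine_pull[OF d p D_vf] aff by auto
  have "\<exists>a. a \<in> Eset 6 \<and> (\<forall>g. fst g \<noteq> 0 \<longrightarrow> comp g = i \<longrightarrow> F (\<phi> g) = ap a (F g))" for i
  proof -
    obtain \<alpha> \<beta> \<gamma> where 1: "\<And>g. fst g \<noteq> 0 \<Longrightarrow> comp g = i \<Longrightarrow> pull_fun GM \<phi> (ext F1) g = \<beta> * fst (F g) + \<gamma> * snd (F g) + \<alpha>"
      using affine_fun_form[OF pull(1), of i] by metis
    obtain \<alpha>' \<beta>' \<gamma>' where 2: "\<And>g. fst g \<noteq> 0 \<Longrightarrow> comp g = i \<Longrightarrow> pull_fun GM \<phi> (ext F2) g = \<beta>' * fst (F g) + \<gamma>' * snd (F g) + \<alpha>'"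
      using affine_fun_form[OF pull(2), of i] by metis
    have "F (\<phi> g) = ap (row \<beta> \<gamma> \<alpha> \<beta>' \<gamma>' \<alpha>') (F g)" if "fst g \<noteq> 0" "comp g = i" for g
      using 1[OF that] 2[OF that] that by (simp add: F_def[of "\<phi> g"] ap_def pull_fun_def points_GM)
    then show ?thesis using row_Eset by blast
  qed
  then have "\<forall>i. \<exists>a. a \<in> Eset 6 \<and> (\<forall>g. fst g \<noteq> 0 \<longrightarrow> comp g = i \<longrightarrow> F (\<phi> g) = ap a (F g))" by blast
  from choice[OF this] obtain c
    where "\<forall>i. c i \<in> Eset 6 \<and> (\<forall>g. fst g \<noteq> 0 \<longrightarrow> comp g = i \<longrightarrow> F (\<phi> g) = ap (c i) (F g))" by blast
  then have c: "\<And>i. c i \<in> Eset 6" "\<And>g. fst g \<noteq> 0 \<Longrightarrow> F (\<phi> g) = ap (c (comp g)) (F g)" by blast+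
  have cont: "continuous_on {p. fst p \<noteq> 0} \<phi>"
    using d by (simp add: diffeo_def smooth_map_def mtop_GM)
  have conv: "connected {p::real \<times> real. fst p \<noteq> 0 \<and> comp p = i}" for i
  proof -
    have e: "{p::real \<times> real. fst p \<noteq> 0 \<and> comp p = i} = fst -` (if i then {..<0} else {0<..})"
      by (auto simp: comp_def)
    show ?thesis unfolding e
      by (intro convex_connected convex_linear_vimage[OF linear_fst]) auto
  qed
  have comp_const: "comp (\<phi> g) = comp (\<phi> g')" if "fst g \<noteq> 0" "fst g' \<noteq> 0" "comp g = comp g'" for g g'
  proof -
    let ?A = "{p. fst p \<noteq> 0 \<and> comp p = comp g}"
    have "connected ((\<lambda>p. fst (\<phi> p)) ` ?A)"
      by (intro connected_continuous_image continuous_on_fst continuous_on_subset[OF cont] conv) auto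
    then have iv: "is_interval ((\<lambda>p. fst (\<phi> p)) ` ?A)" by (simp add: is_interval_connected_1)
    have "fst (\<phi> g) \<in> (\<lambda>p. fst (\<phi> p)) ` ?A" "fst (\<phi> g') \<in> (\<lambda>p. fst (\<phi> p)) ` ?A" using that by auto
    moreover have "0 \<notin> (\<lambda>p. fst (\<phi> p)) ` ?A" using in_G by force
    ultimately have "\<not> (fst (\<phi> g) \<le> 0 \<and> 0 \<le> fst (\<phi> g'))" "\<not> (fst (\<phi> g') \<le> 0 \<and> 0 \<le> fst (\<phi> g))"
      using iv unfolding is_interval_1 by blast+
    then show ?thesis unfolding comp_def by linarith
  qed
  define rep where "rep i = (if i then (-1, 0) else (1::real, 0::real))" for i
  have rep: "fst (rep i) \<noteq> 0" "comp (rep i) = i" for i by (simp_all add: rep_def comp_def)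
  define \<sigma> where "\<sigma> i = comp (\<phi> (rep i))" for i
  have \<sigma>: "comp (\<phi> g) = \<sigma> (comp g)" if "fst g \<noteq> 0" for g
    unfolding \<sigma>_def using comp_const[OF that rep(1)] rep(2) by simp
  have "\<sigma> True \<noteq> \<sigma> False"
  proof
    assume "\<sigma> True = \<sigma> False"
    then have k: "comp (\<phi> g) = \<sigma> False" if "fst g \<noteq> 0" for g using \<sigma>[OF that] by (cases "comp g") auto
    obtain g where "fst g \<noteq> 0" "\<phi> g = rep (\<not> \<sigma> False)"
      using surj[OF rep(1)] by blast
    then show False using k[of g] rep(2)[of "\<not> \<sigma> False"] by auto
  qed
  then have \<sigma>eq: "\<sigma> i = (i \<noteq> \<sigma> False)" for i by (cases i) auto
  have phi_eq: "\<phi> g = KK (comp g \<noteq> \<sigma> False) (ap (c (comp g)) (F g))" if "fst g \<noteq> 0" for g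
    using KK_F[OF in_G[OF that]] unfolding c(2)[OF that] \<sigma>[OF that] \<sigma>eq[symmetric] by simp
  have KKpt: "fst (KK i z) \<noteq> 0" "comp (KK i z) = i" "F (KK i z) = z" if "z \<in> \<Omega>" for i z
    using that by (rule fst_KK comp_KK F_KK)+
  have "c i \<in> S" for i
  proof -
    have im: "ap (c i) ` \<Omega> = \<Omega>"
    proof
      show "ap (c i) ` \<Omega> \<subseteq> \<Omega>"
      proof (rule image_subsetI)
        fix z assume z: "z \<in> \<Omega>"
        have "ap (c i) z = F (\<phi> (KK i z))" using c(2)[OF KKpt(1)[OF z]] KKpt[OF z] by simp
        then show "ap (c i) z \<in> \<Omega>" using F_in[OF in_G[OF KKpt(1)[OF z]]] by simp
      qed
      show "\<Omega> \<subseteq> ap (c i) ` \<Omega>"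
      proof
        fix z assume z: "z \<in> \<Omega>"
        obtain g where g: "fst g \<noteq> 0" "\<phi> g = KK (\<sigma> i) z"
          using surj[OF KKpt(1)[OF z]] by blast
        then have "\<sigma> (comp g) = \<sigma> i" using \<sigma>[OF g(1)] KKpt(2)[OF z] by simp
        then have "comp g = i" using \<sigma>eq by metis
        then have "z = ap (c i) (F g)" using c(2)[OF g(1)] g(2) KKpt(3)[OF z] by simp
        then show "z \<in> ap (c i) ` \<Omega>" using F_in[OF g(1)] by blast
      qed
    qed
    have "inj_on (ap (c i)) \<Omega>"
    proof (rule inj_onI)
      fix z w assume zw: "z \<in> \<Omega>" "w \<in> \<Omega>" "ap (c i) z = ap (c i) w"
      have "\<phi> (KK i z) = \<phi> (KK i w)"
        unfolding phi_eq[OF KKpt(1)[OF zw(1)]] phi_eq[OF KKpt(1)[OF zw(2)]] KKpt(2,3)[OF zw(1)]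
          KKpt(2,3)[OF zw(2)] zw(3) ..
      then have "KK i z = KK i w"
        by (rule inj_onD[OF bij_betw_imp_inj_on[OF bij]]) (use KKpt(1)[OF zw(1)] KKpt(1)[OF zw(2)] in simp_all)
      from arg_cong[OF this, of F] show "z = w" unfolding KKpt(3)[OF zw(1)] KKpt(3)[OF zw(2)] .
    qed
    then have "cdet (c i) \<noteq> 0" by (rule cdet_nonzero_if_inj[OF Omega_open Omega_nonempty])
    then show ?thesis using im c(1)[of i] by (simp add: stabilizer_def)
  qed
  moreover have "\<phi> = act (\<sigma> False) c"
  proof
    fix g
    show "\<phi> g = act (\<sigma> False) c g"
      using phi_eq[of g] act_apply[of g] extensional_arb[OF exts, of g]
        extensional_arb[OF act_extensional[of "\<sigma> False" c], of g]
      by (cases "fst g = 0") (simp_all add: points_GM)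
  qed
  ultimately show thesis using that by blast
qed

theorem affine_transformations_eq:
  "affine_transformations GM D = {act \<epsilon> c | \<epsilon> c. \<forall>i. c i \<in> S}"
proof
  show "affine_transformations GM D \<subseteq> {act \<epsilon> c | \<epsilon> c. \<forall>i. c i \<in> S}"
    using affine_transformation_is_act by blast
  show "{act \<epsilon> c | \<epsilon> c. \<forall>i. c i \<in> S} \<subseteq> affine_transformations GM D"
    using act_diffeo act_preserves by (auto simp: affine_transformations_def)
qed

end


section \<open>The topology of the group of affine transformations\<close>

lemma continuous_map_row:
  assumes "continuous_map X euclideanreal a" "continuous_map X euclideanreal b" "continuous_map X euclideanreal c"
    "continuous_map X euclideanreal d" "continuous_map X euclideanreal e" "continuous_map X euclideanreal f"
  shows "continuous_map X euclideanreal (\<lambda>x. row (a x) (b x) (c x) (d x) (e x) (f x) j)"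
  unfolding row_def using assms by simp

lemma C_inf_row:
  assumes "openin (Euclidean_space n) S" "C_inf_on n S a" "C_inf_on n S b" "C_inf_on n S c"
    "C_inf_on n S d" "C_inf_on n S e" "C_inf_on n S f"
  shows "C_inf_on n S (\<lambda>x. row (a x) (b x) (c x) (d x) (e x) (f x) j)"
proof -
  consider "j = 0" | "j = 1" | "j = 2" | "j = 3" | "j = 4" | "j = 5" | "j \<ge> 6" by linarith
  then show ?thesis
    by cases (use assms C_inf_const[OF assms(1), of 0] in \<open>simp_all add: row_def\<close>)
qed

text \<open>One half of the exponential law for the compact-open topology: the tube lemma.\<close>

lemma compact_open_continuous_map:
  fixes S :: "'b::topological_space set" and f :: "'b \<Rightarrow> 'a::topological_space \<Rightarrow> 'a"
  assumes ext: "\<And>x. x \<in> S \<Longrightarrow> f x \<in> extensional U"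
    and cont: "\<And>x. x \<in> S \<Longrightarrow> continuous_map (top_of_set U) (top_of_set U) (f x)"
    and joint: "continuous_on (S \<times> U) (\<lambda>(x, g). f x g)"
  shows "continuous_map (top_of_set S) (compact_open_topology (top_of_set U) (top_of_set U)) f"
  unfolding compact_open_topology_def continuous_on_generated_topo_iff
proof (intro conjI allI impI)
  let ?B = "{{f \<in> extensional (topspace (top_of_set U)). continuous_map (top_of_set U) (top_of_set U) f \<and> f ` K \<subseteq> V} | K V.
      compactin (top_of_set U) K \<and> openin (top_of_set U) V}"
  show "f ` topspace (top_of_set S) \<subseteq> \<Union> ?B"
  proof (rule image_subsetI)
    fix x assume "x \<in> topspace (top_of_set S)"
    then have "f x \<in> {f \<in> extensional (topspace (top_of_set U)). continuous_map (top_of_set U) (top_of_set U) f \<and> f ` {} \<subseteq> U}"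
      using ext cont by simp
    moreover have "compactin (top_of_set U) {}" "openin (top_of_set U) U" by simp_all
    ultimately show "f x \<in> \<Union> ?B" by blast
  qed
  fix B assume "B \<in> ?B"
  then obtain K V where B: "B = {f \<in> extensional (topspace (top_of_set U)). continuous_map (top_of_set U) (top_of_set U) f \<and> f ` K \<subseteq> V}"
    and K: "compactin (top_of_set U) K" and V: "openin (top_of_set U) V" by blast
  have Kc: "compact K" "K \<subseteq> U" using K by (auto simp: compactin_subtopology)
  obtain O' where O': "open O'" "V = U \<inter> O'" using V by (auto simp: openin_open)
  have "openin (top_of_set (S \<times> U)) ((S \<times> U) \<inter> (\<lambda>(x, g). f x g) -` O')"
    by (rule continuous_openin_preimage_gen[OF joint O'(1)])
  then obtain Q where Q: "open Q" "(S \<times> U) \<inter> (\<lambda>(x, g). f x g) -` O' = (S \<times> U) \<inter> Q" by (auto simp: openin_open)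
  have fU: "f x g \<in> U" if "x \<in> S" "g \<in> U" for x g
    using cont[OF that(1)] that(2) by (auto simp: continuous_map_def)
  have mem: "f x ` K \<subseteq> V \<longleftrightarrow> {x} \<times> K \<subseteq> Q" if x: "x \<in> S" for x
  proof -
    have "f x g \<in> V \<longleftrightarrow> (x, g) \<in> Q" if g: "g \<in> K" for g
    proof -
      have "(x, g) \<in> S \<times> U" using x g Kc by auto
      then show ?thesis using Q(2) fU[OF x, of g] O'(2) by auto
    qed
    then show ?thesis by auto
  qed
  have eq: "f -` B \<inter> topspace (top_of_set S) = {x \<in> S. {x} \<times> K \<subseteq> Q}"
  proof -
    have "f x \<in> B \<longleftrightarrow> {x} \<times> K \<subseteq> Q" if "x \<in> S" for x
      using mem[OF that] ext[OF that] cont[OF that] by (simp add: B)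
    then show ?thesis by auto
  qed
  show "openin (top_of_set S) (f -` B \<inter> topspace (top_of_set S))"
    unfolding eq
  proof (subst openin_subopen, intro ballI)
    fix x assume x: "x \<in> {x \<in> S. {x} \<times> K \<subseteq> Q}"
    then obtain X0 where "x \<in> X0" "open X0" "X0 \<times> K \<subseteq> Q"
      using Elementary_Topology.tube_lemma[OF Kc(1) Q(1), of x] by blast
    then show "\<exists>T. openin (top_of_set S) T \<and> x \<in> T \<and> T \<subseteq> {x \<in> S. {x} \<times> K \<subseteq> Q}"
      using x by (intro exI[of _ "S \<inter> X0"]) auto
  qed
qed

text \<open>
  The coefficients with indices \<open>sel 0\<close>, ..., \<open>sel (n - 1)\<close> are coordinates on the stabilizer of \<open>\<Omega>\<close>, and
  \<open>expand\<close> computes all six from them.  The last assumption is the source of the left invariant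
  connection: in these coordinates left multiplication is an affine map.
\<close>

locale coordinatized = developed +
  fixes n :: nat and sel :: "nat \<Rightarrow> nat" and expand :: "(nat \<Rightarrow> real) \<Rightarrow> nat \<Rightarrow> real" and WA :: "(nat \<Rightarrow> real) set"
  assumes WA_open: "openin (Euclidean_space n) WA"
    and expand_in: "\<And>u. u \<in> WA \<Longrightarrow> expand u \<in> stabilizer \<Omega>"
    and restr_in: "\<And>c. c \<in> stabilizer \<Omega> \<Longrightarrow> (\<lambda>k. if k < n then c (sel k) else 0) \<in> WA"
    and expand_restr: "\<And>c. c \<in> stabilizer \<Omega> \<Longrightarrow> expand (\<lambda>k. if k < n then c (sel k) else 0) = c"
    and restr_expand: "\<And>u. u \<in> WA \<Longrightarrow> (\<lambda>k. if k < n then expand u (sel k) else 0) = u"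
    and expand_smooth: "\<And>j. C_inf_on n WA (\<lambda>u. expand u j)"
    and affine_mul: "\<And>c k. c \<in> stabilizer \<Omega> \<Longrightarrow> k < n \<Longrightarrow>
      \<exists>a b. \<forall>u\<in>WA. cmul c (expand u) (sel k) = a + (\<Sum>j<n. b j * u j)"
begin

abbreviation "H \<equiv> affine_transformations GM D"
abbreviation "HT \<equiv> affine_group_topology GM D"

definition restr :: "(nat \<Rightarrow> real) \<Rightarrow> nat \<Rightarrow> real" where
  "restr c = (\<lambda>k. if k < n then c (sel k) else 0)"

definition pack :: "(bool \<Rightarrow> nat \<Rightarrow> real) \<Rightarrow> nat \<Rightarrow> real" where
  "pack v k = (if k < n then v False k else if k < 2 * n then v True (k - n) else 0)"

definition unpack :: "(nat \<Rightarrow> real) \<Rightarrow> bool \<Rightarrow> nat \<Rightarrow> real" where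
  "unpack x i k = (if k < n then x (if i then n + k else k) else 0)"

definition W2 :: "(nat \<Rightarrow> real) set" where
  "W2 = {x \<in> Eset (2 * n). \<forall>i. unpack x i \<in> WA}"

text \<open>The coefficients of an affine map, read off from its values at three points.\<close>

definition coef :: "(real \<times> real \<Rightarrow> real \<times> real) \<Rightarrow> real \<times> real \<Rightarrow> real \<Rightarrow> nat \<Rightarrow> real" where
  "coef T z h =
     (let a = (fst (T (z + (h, 0))) - fst (T z)) / h; b = (fst (T (z + (0, h))) - fst (T z)) / h;
          d = (snd (T (z + (h, 0))) - snd (T z)) / h; e = (snd (T (z + (0, h))) - snd (T z)) / h
      in row a b (fst (T z) - a * fst z - b * snd z) d e (snd (T z) - d * fst z - e * snd z))"

lemma coef_ap:
  assumes "c \<in> Eset 6" "h \<noteq> 0"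
  shows "coef (ap c) z h = c"
proof (rule Eset_6_eqI[OF _ assms(1)])
  show "coef (ap c) z h \<in> Eset 6" unfolding coef_def Let_def by (rule row_Eset)
qed (use assms(2) in \<open>simp_all add: coef_def Let_def ap_def field_simps\<close>)

lemma ex_base: "\<exists>z h. h > 0 \<and> z \<in> \<Omega> \<and> z + (h, 0) \<in> \<Omega> \<and> z + (0, h) \<in> \<Omega>"
proof -
  obtain z where z: "z \<in> \<Omega>" using Omega_nonempty by blast
  have "eventually (\<lambda>h. z + v h \<in> \<Omega>) (at_right (0::real))" if "(v \<longlongrightarrow> 0) (at_right 0)" for v
  proof -
    have "((\<lambda>h. z + v h) \<longlongrightarrow> z + 0) (at_right 0)" by (intro tendsto_intros that)
    then have "((\<lambda>h. z + v h) \<longlongrightarrow> z) (at_right 0)" by simp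
    then show ?thesis by (rule topological_tendstoD[OF _ Omega_open z])
  qed
  moreover have "((\<lambda>h::real. (h, 0::real)) \<longlongrightarrow> (0, 0)) (at_right 0)" "((\<lambda>h::real. (0::real, h)) \<longlongrightarrow> (0, 0)) (at_right 0)"
    by (intro tendsto_Pair tendsto_const tendsto_ident_at)+
  ultimately have "eventually (\<lambda>h. z + (h, 0) \<in> \<Omega>) (at_right 0)" "eventually (\<lambda>h. z + (0, h) \<in> \<Omega>) (at_right 0)"
    by (simp_all add: zero_prod_def)
  then have "eventually (\<lambda>h. z + (h, 0) \<in> \<Omega> \<and> z + (0, h) \<in> \<Omega> \<and> 0 < h) (at_right 0)"
    using eventually_at_right_less by (intro eventually_conj) auto
  then obtain h :: real where "z + (h, 0) \<in> \<Omega>" "z + (0, h) \<in> \<Omega>" "0 < h"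
    using eventually_happens' trivial_limit_at_right_real by blast
  then show ?thesis using z by blast
qed

definition base :: "(real \<times> real) \<times> real" where
  "base = (SOME (z, h). h > 0 \<and> z \<in> \<Omega> \<and> z + (h, 0) \<in> \<Omega> \<and> z + (0, h) \<in> \<Omega>)"

lemma base: "snd base > 0" "fst base \<in> \<Omega>" "fst base + (snd base, 0) \<in> \<Omega>" "fst base + (0, snd base) \<in> \<Omega>"
proof -
  have "case base of (z, h) \<Rightarrow> h > 0 \<and> z \<in> \<Omega> \<and> z + (h, 0) \<in> \<Omega> \<and> z + (0, h) \<in> \<Omega>"
    unfolding base_def by (rule someI_ex) (use ex_base in auto)
  then show "snd base > 0" "fst base \<in> \<Omega>" "fst base + (snd base, 0) \<in> \<Omega>" "fst base + (0, snd base) \<in> \<Omega>"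
    by (auto simp: case_prod_unfold)
qed

text \<open>
  A transformation is recovered from its values at finitely many points; this is why its
  coordinates are continuous in the compact-open topology.
\<close>

definition ep :: "(real \<times> real \<Rightarrow> real \<times> real) \<Rightarrow> bool" where
  "ep \<phi> = comp (\<phi> (1, 0))"

definition cf :: "(real \<times> real \<Rightarrow> real \<times> real) \<Rightarrow> bool \<Rightarrow> nat \<Rightarrow> real" where
  "cf \<phi> i = coef (\<lambda>z. F (\<phi> (KK i z))) (fst base) (snd base)"

lemma
  assumes c: "\<And>i. c i \<in> S"
  shows ep_act: "ep (act \<epsilon> c) = \<epsilon>" and cf_act: "cf (act \<epsilon> c) i = c i"
proof -
  show "ep (act \<epsilon> c) = \<epsilon>" using comp_act[OF c, of "(1, 0)" \<epsilon>] by (simp add: ep_def) (simp add: comp_def)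
  have "F (act \<epsilon> c (KK i z)) = ap (c i) z" if "z \<in> \<Omega>" for z
    using F_act[where \<epsilon> = \<epsilon>, OF c fst_KK[OF that, of i]] by (simp add: comp_KK[OF that] F_KK[OF that])
  then have "cf (act \<epsilon> c) i = coef (ap (c i)) (fst base) (snd base)"
    unfolding cf_def coef_def using base by simp
  also have "\<dots> = c i" using coef_ap[of "c i" "snd base"] c[of i] base(1) by (simp add: stabilizer_def)
  finally show "cf (act \<epsilon> c) i = c i" .
qed

lemma act_in_H: "(\<And>i. c i \<in> S) \<Longrightarrow> act \<epsilon> c \<in> H"
  unfolding affine_transformations_eq by blast

lemma H_cases:
  assumes "\<phi> \<in> H"
  obtains \<epsilon> c where "\<And>i. c i \<in> S" "\<phi> = act \<epsilon> c" "ep \<phi> = \<epsilon>" "cf \<phi> = c"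
proof -
  obtain \<epsilon> c where *: "\<And>i. c i \<in> S" "\<phi> = act \<epsilon> c" using assms unfolding affine_transformations_eq by blast
  have "cf \<phi> = c" unfolding *(2) by (rule ext) (rule cf_act[OF *(1)])
  moreover have "ep \<phi> = \<epsilon>" unfolding *(2) by (rule ep_act[OF *(1)])
  ultimately show thesis by (rule that[OF *(1) *(2), rotated])
qed

lemma cf_S: "\<phi> \<in> H \<Longrightarrow> cf \<phi> i \<in> S"
  by (erule H_cases) simp

lemma act_ep_cf: "\<phi> \<in> H \<Longrightarrow> act (ep \<phi>) (cf \<phi>) = \<phi>"
  by (erule H_cases) simp

definition co :: "(real \<times> real \<Rightarrow> real \<times> real) \<Rightarrow> nat \<Rightarrow> real" where
  "co \<phi> = pack (\<lambda>i. restr (cf \<phi> i))"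

definition pt :: "bool \<Rightarrow> (nat \<Rightarrow> real) \<Rightarrow> real \<times> real \<Rightarrow> real \<times> real" where
  "pt \<epsilon> x = act \<epsilon> (\<lambda>i. expand (unpack x i))"

lemma unpack_pack: "(\<And>i. v i \<in> Eset n) \<Longrightarrow> unpack (pack v) i = v i"
  by (auto simp: unpack_def pack_def fun_eq_iff)

lemma pack_unpack: "x \<in> Eset (2 * n) \<Longrightarrow> pack (unpack x) = x"
  by (auto simp: unpack_def pack_def fun_eq_iff)

lemma pack_Eset: "pack v \<in> Eset (2 * n)"
  by (simp add: pack_def)

lemma pack_restr_W2: "(\<And>i. c i \<in> S) \<Longrightarrow> pack (\<lambda>i. restr (c i)) \<in> W2"
  using pack_Eset unpack_pack[of "\<lambda>i. restr (c i)"] restr_in unfolding W2_def restr_def by simp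

lemma pt_in_H: "x \<in> W2 \<Longrightarrow> pt \<epsilon> x \<in> H"
  unfolding pt_def by (rule act_in_H) (simp add: W2_def expand_in)

lemma ep_pt: "x \<in> W2 \<Longrightarrow> ep (pt \<epsilon> x) = \<epsilon>"
  unfolding pt_def by (rule ep_act) (simp add: W2_def expand_in)

lemma cf_pt: "x \<in> W2 \<Longrightarrow> cf (pt \<epsilon> x) i = expand (unpack x i)"
  unfolding pt_def by (rule cf_act) (simp add: W2_def expand_in)

lemma pt_pack: "(\<And>i. c i \<in> S) \<Longrightarrow> pt \<epsilon> (pack (\<lambda>i. restr (c i))) = act \<epsilon> c"
  using unpack_pack[of "\<lambda>i. restr (c i)"] expand_restr unfolding pt_def restr_def by simp

lemma co_act: "(\<And>i. c i \<in> S) \<Longrightarrow> co (act \<epsilon> c) = pack (\<lambda>i. restr (c i))"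
  unfolding co_def by (simp add: cf_act)

lemma co_pt: "x \<in> W2 \<Longrightarrow> co (pt \<epsilon> x) = x"
proof -
  assume x: "x \<in> W2"
  then have "(\<lambda>i. restr (cf (pt \<epsilon> x) i)) = unpack x"
    using restr_expand by (auto simp: restr_def cf_pt[OF x] W2_def)
  then show ?thesis using x pack_unpack by (simp add: co_def W2_def)
qed

lemma co_in: "\<phi> \<in> H \<Longrightarrow> co \<phi> \<in> W2"
  unfolding co_def by (rule pack_restr_W2) (rule cf_S)

lemma pt_co: "\<phi> \<in> H \<Longrightarrow> pt (ep \<phi>) (co \<phi>) = \<phi>"
  unfolding co_def using pt_pack[of "cf \<phi>" "ep \<phi>"] cf_S act_ep_cf by simp

lemma continuous_on_unpack: "continuous_on A (\<lambda>x. unpack x i)"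
proof (rule continuous_on_coordinatewise_then_product)
  fix k show "continuous_on A (\<lambda>x. unpack x i k)"
    unfolding unpack_def
    by (cases "k < n") (simp_all add: continuous_on_product_then_coordinatewise[OF continuous_on_id])
qed

lemma W2_open: "openin (Euclidean_space (2 * n)) W2"
proof -
  obtain U where U: "open U" "WA = Eset n \<inter> U"
    using WA_open unfolding Euclidean_space_top_of_set openin_open by blast
  have 0: "openin (Euclidean_space (2 * n)) (Eset (2 * n))" by (simp add: Euclidean_space_top_of_set)
  from openin_Euclidean_preimage[OF this continuous_on_unpack U(1)]
  have "openin (Euclidean_space (2 * n)) ({x \<in> Eset (2 * n). unpack x False \<in> U} \<inter> {x \<in> Eset (2 * n). unpack x True \<in> U})"
    by (intro openin_Int)
  moreover have "{x \<in> Eset (2 * n). unpack x False \<in> U} \<inter> {x \<in> Eset (2 * n). unpack x True \<in> U} = W2"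
  proof -
    have "unpack x i \<in> Eset n" for x i by (simp add: unpack_def)
    then have "unpack x i \<in> WA \<longleftrightarrow> unpack x i \<in> U" for x i using U(2) by blast
    then show ?thesis unfolding W2_def by (auto simp: all_bool_eq)
  qed
  ultimately show ?thesis by simp
qed


subsection \<open>The compact-open topology in coordinates\<close>

lemma H_ext: "\<phi> \<in> H \<Longrightarrow> \<phi> \<in> extensional (points GM)"
  and H_cont: "\<phi> \<in> H \<Longrightarrow> continuous_map (mtop GM) (mtop GM) \<phi>"
  and H_map: "\<phi> \<in> H \<Longrightarrow> fst p \<noteq> 0 \<Longrightarrow> fst (\<phi> p) \<noteq> 0"
proof -
  assume "\<phi> \<in> H"
  then have d: "diffeo GM \<phi>" by (simp add: affine_transformations_def)
  then show "\<phi> \<in> extensional (points GM)" "continuous_map (mtop GM) (mtop GM) \<phi>"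
    by (auto simp: diffeo_def Bij_def smooth_map_def)
  show "fst p \<noteq> 0 \<Longrightarrow> fst (\<phi> p) \<noteq> 0" using G.diffeo_in[OF d, of p] by (simp add: points_GM)
qed

lemma topspace_HT: "topspace HT = H"
proof -
  have "\<phi> \<in> topspace (compact_open_topology (mtop GM) (mtop GM))" if phi: "\<phi> \<in> H" for \<phi>
  proof -
    have "\<phi> \<in> {f \<in> extensional (points GM). continuous_map (mtop GM) (mtop GM) f \<and> f ` {} \<subseteq> {}}"
      using H_ext[OF phi] H_cont[OF phi] by simp
    moreover have "compactin (mtop GM) {}" "openin (mtop GM) {}" by simp_all
    ultimately show ?thesis
      unfolding compact_open_topology_def topology_generated_by_topspace by blast
  qed
  then show ?thesis unfolding affine_group_topology_def by auto
qed

lemma continuous_map_eval: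
  assumes p: "fst p \<noteq> 0"
  shows "continuous_map HT (mtop GM) (\<lambda>\<phi>. \<phi> p)"
  unfolding continuous_map_def
proof (intro conjI allI impI)
  show "(\<lambda>\<phi>. \<phi> p) \<in> topspace HT \<rightarrow> topspace (mtop GM)"
    using H_map p by (auto simp: topspace_HT points_GM)
  fix V assume V: "openin (mtop GM) V"
  let ?B = "{f \<in> extensional (points GM). continuous_map (mtop GM) (mtop GM) f \<and> f ` {p} \<subseteq> V}"
  have "compactin (mtop GM) {p}" using p by (simp add: points_GM)
  then have "openin (compact_open_topology (mtop GM) (mtop GM)) ?B"
    unfolding compact_open_topology_def using V by (intro topology_generated_by_Basis) blast
  then have "openin HT (?B \<inter> H)" unfolding affine_group_topology_def by (auto simp: openin_subtopology)
  moreover have "{\<phi> \<in> topspace HT. \<phi> p \<in> V} = ?B \<inter> H" using H_ext H_cont by (auto simp: topspace_HT)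
  ultimately show "openin HT {\<phi> \<in> topspace HT. \<phi> p \<in> V}" by simp
qed

lemma continuous_map_eval_real:
  assumes p: "fst p \<noteq> 0" and u: "u \<in> G.SF"
  shows "continuous_map HT euclideanreal (\<lambda>\<phi>. u (\<phi> p))"
proof -
  have "continuous_on {p. fst p \<noteq> 0} (\<lambda>p. u (gco p 0, gco p (Suc 0)))"
    by (rule continuous_on_compose2[OF C_inf_continuous[OF gW_open] continuous_on_gco])
       (use u gco_image in \<open>auto simp: G_smooth_iff\<close>)
  then have "continuous_map (mtop GM) euclideanreal u" by (simp add: mtop_GM)
  from continuous_map_compose[OF continuous_map_eval[OF p] this] show ?thesis by (simp add: o_def)
qed

lemma continuous_map_cf: "continuous_map HT euclideanreal (\<lambda>\<phi>. cf \<phi> i j)"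
proof -
  have e: "continuous_map HT euclideanreal (\<lambda>\<phi>. fst (F (\<phi> (KK i z))))"
    "continuous_map HT euclideanreal (\<lambda>\<phi>. snd (F (\<phi> (KK i z))))" if "z \<in> \<Omega>" for z
    using continuous_map_eval_real[OF fst_KK[OF that]] F_smooth by (simp_all add: F_def)
  show ?thesis
    unfolding cf_def coef_def Let_def
    by (intro continuous_map_row continuous_map_diff continuous_map_real_mult continuous_map_real_divide
        e base continuous_map_const[THEN iffD2] disjI2) (use base(1) in auto)
qed

lemma openin_sheet: "openin HT {\<phi> \<in> H. ep \<phi> = \<epsilon>}"
proof -
  have "open {p. fst p \<noteq> 0 \<and> comp p = \<epsilon>}" by (rule open_component)
  then have "openin (mtop GM) {p. fst p \<noteq> 0 \<and> comp p = \<epsilon>}"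
    unfolding mtop_GM by (rule openin_open_eq[THEN iffD2, rotated, OF conjI]) (use open_fst_nonzero in auto)
  then have "openin HT {\<phi> \<in> topspace HT. \<phi> (1, 0) \<in> {p. fst p \<noteq> 0 \<and> comp p = \<epsilon>}}"
    by (intro openin_continuous_map_preimage[OF continuous_map_eval]) simp_all
  moreover have "{\<phi> \<in> topspace HT. \<phi> (1, 0) \<in> {p. fst p \<noteq> 0 \<and> comp p = \<epsilon>}} = {\<phi> \<in> H. ep \<phi> = \<epsilon>}"
    using H_map by (auto simp: topspace_HT ep_def)
  ultimately show ?thesis by simp
qed

lemma continuous_map_pack_restr:
  assumes "\<And>i j. continuous_map X euclideanreal (\<lambda>x. c x i j)" and "\<And>x i. x \<in> topspace X \<Longrightarrow> c x i \<in> S"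
  shows "continuous_map X (top_of_set W2) (\<lambda>x. pack (\<lambda>i. restr (c x i)))"
proof -
  have "continuous_map X euclideanreal (\<lambda>x. pack (\<lambda>i. restr (c x i)) k)" for k
    unfolding pack_def restr_def using assms(1) by simp
  then have "continuous_map X euclidean (\<lambda>x. pack (\<lambda>i. restr (c x i)))"
    unfolding euclidean_product_topology[symmetric] continuous_map_componentwise_UNIV by blast
  moreover have "pack (\<lambda>i. restr (c x i)) \<in> W2" if "x \<in> topspace X" for x
    using pack_restr_W2 assms(2)[OF that] by blast
  ultimately show ?thesis by (auto simp: continuous_map_in_subtopology)
qed

lemma continuous_map_co: "continuous_map HT (top_of_set W2) co"
  unfolding co_def[abs_def]
  by (rule continuous_map_pack_restr) (auto simp: continuous_map_cf topspace_HT cf_S)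

lemma continuous_on_K: "continuous_on \<Omega> K"
proof -
  let ?T = "{x \<in> Eset 2. (x 0, x (Suc 0)) \<in> \<Omega>}"
  have To: "openin (Euclidean_space 2) ?T" by (rule openin_Eset_2[OF Omega_open])
  have "gco ` \<Omega> \<subseteq> ?T" using gco_simps(3) by auto
  from continuous_on_compose2[OF C_inf_continuous[OF To K_smooth(1)] continuous_on_gco this]
    continuous_on_compose2[OF C_inf_continuous[OF To K_smooth(2)] continuous_on_gco this]
  have "continuous_on \<Omega> (\<lambda>z. (fst (K z), snd (K z)))" by (intro continuous_on_Pair) simp_all
  then show ?thesis by simp
qed

lemma continuous_on_F: "continuous_on {p. fst p \<noteq> 0} F"
proof -
  have "continuous_on {p. fst p \<noteq> 0} (\<lambda>p. u (gco p 0, gco p (Suc 0)))" if "u \<in> G.SF" for u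
    by (rule continuous_on_compose2[OF C_inf_continuous[OF gW_open] continuous_on_gco])
       (use that gco_image in \<open>auto simp: G_smooth_iff\<close>)
  from this[OF F_smooth(1)] this[OF F_smooth(2)] show ?thesis
    unfolding F_def[abs_def] by (intro continuous_on_Pair) simp_all
qed

lemma continuous_on_act: "continuous_on (W2 \<times> {p. fst p \<noteq> 0}) (\<lambda>(x, g). pt \<epsilon> x g)"
proof -
  let ?A = "\<lambda>i. W2 \<times> {p. fst p \<noteq> 0 \<and> comp p = i}"
  have part: "continuous_on (?A i) (\<lambda>(x, g). pt \<epsilon> x g)" for i
  proof -
    define B where "B = ?A i"
    have xW: "unpack (fst q) i \<in> WA" if "q \<in> B" for q using that by (auto simp: B_def W2_def)
    have ec: "continuous_on B (\<lambda>q. expand (unpack (fst q) i) j)" for j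
      by (rule continuous_on_compose2[OF C_inf_continuous[OF WA_open expand_smooth]
            continuous_on_compose2[OF continuous_on_unpack[of UNIV] continuous_on_fst[OF continuous_on_id]]])
         (use xW in auto)
    have Fc: "continuous_on B (\<lambda>q. F (snd q))"
      by (rule continuous_on_compose2[OF continuous_on_F continuous_on_snd[OF continuous_on_id]])
         (auto simp: B_def)
    have apc: "continuous_on B (\<lambda>q. ap (expand (unpack (fst q) i)) (F (snd q)))"
      unfolding ap_def by (intro continuous_intros ec continuous_on_fst[OF Fc] continuous_on_snd[OF Fc])
    have "ap (expand (unpack (fst q) i)) (F (snd q)) \<in> \<Omega>" if "q \<in> B" for q
      using stabilizer_ap[OF expand_in[OF xW[OF that]] F_in] that by (auto simp: B_def)
    then have "continuous_on B (\<lambda>q. K (ap (expand (unpack (fst q) i)) (F (snd q))))"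
      by (intro continuous_on_compose2[OF continuous_on_K apc]) auto
    then have "continuous_on B (\<lambda>q. KK (i \<noteq> \<epsilon>) (ap (expand (unpack (fst q) i)) (F (snd q))))"
      unfolding KK_def by (cases "i \<noteq> \<epsilon>") (auto intro: continuous_on_minus)
    then show ?thesis
      unfolding B_def[symmetric]
      by (rule continuous_on_eq) (auto simp: B_def pt_def act_apply)
  qed
  have op: "openin (top_of_set (W2 \<times> {p. fst p \<noteq> 0})) (?A i)" for i
  proof -
    have "?A i = (W2 \<times> {p. fst p \<noteq> 0}) \<inter> (UNIV \<times> {p. if i then fst p < 0 else 0 < fst p})"
      by (auto simp: comp_def)
    moreover have "open ((UNIV :: (nat \<Rightarrow> real) set) \<times> {p::real \<times> real. if i then fst p < 0 else 0 < fst p})"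
      by (cases i) (auto intro!: open_Times open_Collect_less continuous_intros)
    ultimately show ?thesis unfolding openin_open by blast
  qed
  have un: "W2 \<times> {p. fst p \<noteq> 0} = ?A False \<union> ?A True" by auto
  have co: "?A False = W2 \<times> {p. fst p \<noteq> 0} - ?A True" "?A True = W2 \<times> {p. fst p \<noteq> 0} - ?A False" by auto
  have "continuous_on (?A False \<union> ?A True) (\<lambda>(x, g). pt \<epsilon> x g)"
  proof (rule continuous_on_Un_local[OF _ _ part part])
    have t: "topspace (top_of_set (W2 \<times> {p::real\<times>real. fst p \<noteq> 0})) = W2 \<times> {p. fst p \<noteq> 0}" by simp
    show "closedin (top_of_set (?A False \<union> ?A True)) (?A False)"
      unfolding un[symmetric] by (subst co(1)) (use closedin_diff[OF closedin_topspace op[of True]] t in simp)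
    show "closedin (top_of_set (?A False \<union> ?A True)) (?A True)"
      unfolding un[symmetric] by (subst co(2)) (use closedin_diff[OF closedin_topspace op[of False]] t in simp)
  qed
  then show ?thesis using un by simp
qed

lemma continuous_map_pt: "continuous_map (top_of_set W2) HT (pt \<epsilon>)"
proof -
  have "continuous_map (top_of_set W2) (compact_open_topology (mtop GM) (mtop GM)) (pt \<epsilon>)"
    unfolding mtop_GM
    by (rule compact_open_continuous_map[OF _ _ continuous_on_act])
       (use H_ext[OF pt_in_H] H_cont[OF pt_in_H] in \<open>auto simp: points_GM mtop_GM\<close>)
  then show ?thesis
    unfolding affine_group_topology_def by (auto simp: continuous_map_in_subtopology pt_in_H)
qed

lemma homeomorphic_chart:
  "homeomorphic_maps (subtopology HT {\<phi> \<in> H. ep \<phi> = \<epsilon>}) (top_of_set W2) co (pt \<epsilon>)"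
  unfolding homeomorphic_maps_def
proof (intro conjI ballI)
  show "continuous_map (subtopology HT {\<phi> \<in> H. ep \<phi> = \<epsilon>}) (top_of_set W2) co"
    by (rule continuous_map_from_subtopology[OF continuous_map_co])
  show "continuous_map (top_of_set W2) (subtopology HT {\<phi> \<in> H. ep \<phi> = \<epsilon>}) (pt \<epsilon>)"
    unfolding continuous_map_in_subtopology using continuous_map_pt pt_in_H ep_pt by auto
  show "pt \<epsilon> (co \<phi>) = \<phi>" if "\<phi> \<in> topspace (subtopology HT {\<phi> \<in> H. ep \<phi> = \<epsilon>})" for \<phi>
    using that pt_co[of \<phi>] by (auto simp: topspace_HT)
  show "co (pt \<epsilon> x) = x" if "x \<in> topspace (top_of_set W2)" for x
    using that co_pt by simp
qed

end


section \<open>The Lie group of affine transformations\<close>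

context coordinatized
begin

definition MM :: "(real \<times> real \<Rightarrow> real \<times> real) manifold" where
  "MM = \<lparr>mdim = 2 * n, mtop = HT, matlas = (\<lambda>\<epsilon>. ({\<phi> \<in> H. ep \<phi> = \<epsilon>}, co)) ` UNIV\<rparr>"

lemma MM_simps [simp]: "mdim MM = 2 * n" "mtop MM = HT" "points MM = H"
  by (simp_all add: MM_def topspace_HT)

lemma image_co: "co ` {\<phi> \<in> H. ep \<phi> = \<epsilon>} = W2"
proof
  show "W2 \<subseteq> co ` {\<phi> \<in> H. ep \<phi> = \<epsilon>}"
  proof
    fix x assume "x \<in> W2"
    then have "x = co (pt \<epsilon> x)" "pt \<epsilon> x \<in> {\<phi> \<in> H. ep \<phi> = \<epsilon>}" by (simp_all add: co_pt pt_in_H ep_pt)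
    then show "x \<in> co ` {\<phi> \<in> H. ep \<phi> = \<epsilon>}" by blast
  qed
qed (auto simp: co_in)

sublocale MS: sheeted_manifold MM ep co UNIV W2 pt
proof
  show "openin (Euclidean_space (mdim MM)) W2" using W2_open by simp
  show "matlas MM = (\<lambda>c. ({p \<in> points MM. ep p = c}, co)) ` UNIV" by (simp add: MM_def topspace_HT)
  fix \<epsilon>
  have "homeomorphic_map (subtopology HT {\<phi> \<in> H. ep \<phi> = \<epsilon>}) (top_of_set W2) co"
    using homeomorphic_chart homeomorphic_map_maps by blast
  then show "is_chart (mdim MM) (mtop MM) {p \<in> points MM. ep p = \<epsilon>} co"
    unfolding is_chart_def MM_simps topspace_HT image_co subtopology_Euclidean_eq[OF W2_open]
    using openin_sheet W2_open by blast
qed (auto simp: pt_in_H ep_pt co_pt co_in pt_co topspace_HT)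

lemma Hausdorff_HT: "Hausdorff_space HT"
  unfolding Hausdorff_space_def
proof (intro allI impI, elim conjE)
  fix \<phi> \<psi> assume H: "\<phi> \<in> topspace HT" "\<psi> \<in> topspace HT" and ne: "\<phi> \<noteq> \<psi>"
  have "\<exists>p. fst p \<noteq> 0 \<and> \<phi> p \<noteq> \<psi> p"
  proof (rule ccontr)
    assume "\<nexists>p. fst p \<noteq> 0 \<and> \<phi> p \<noteq> \<psi> p"
    then have "\<phi> p = \<psi> p" if "p \<in> points GM" for p using that unfolding points_GM by blast
    then have "\<phi> = \<psi>" using H by (intro extensionalityI[OF H_ext H_ext]) (auto simp: topspace_HT)
    then show False using ne by simp
  qed
  then obtain p where p: "fst p \<noteq> 0" "\<phi> p \<noteq> \<psi> p" by blast
  have "Hausdorff_space (mtop GM)" by (simp add: mtop_GM Hausdorff_space_subtopology)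
  moreover have "\<phi> p \<in> points GM" "\<psi> p \<in> points GM" using H H_map p(1) by (auto simp: topspace_HT points_GM)
  ultimately obtain U V where UV: "openin (mtop GM) U" "openin (mtop GM) V" "\<phi> p \<in> U" "\<psi> p \<in> V" "disjnt U V"
    using p(2) unfolding Hausdorff_space_def by metis
  have "openin HT {\<phi> \<in> topspace HT. \<phi> p \<in> U}" "openin HT {\<phi> \<in> topspace HT. \<phi> p \<in> V}"
    using UV(1,2) openin_continuous_map_preimage[OF continuous_map_eval[OF p(1)]] by blast+
  moreover have "disjnt {\<phi> \<in> topspace HT. \<phi> p \<in> U} {\<phi> \<in> topspace HT. \<phi> p \<in> V}"
    using UV(5) unfolding disjnt_iff by blast
  ultimately show "\<exists>U V. openin HT U \<and> openin HT V \<and> \<phi> \<in> U \<and> \<psi> \<in> V \<and> disjnt U V"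
    using H UV(3,4) by blast
qed

lemma second_countable_HT: "second_countable HT"
proof -
  obtain B :: "(nat \<Rightarrow> real) set set" where B: "countable B" "\<And>U. U \<in> B \<Longrightarrow> open U"
    "\<And>S. open S \<Longrightarrow> \<exists>U. U \<subseteq> B \<and> S = \<Union>U"
    using univ_second_countable by metis
  define \<B> where "\<B> = (\<lambda>(\<epsilon>, U). {\<phi> \<in> H. ep \<phi> = \<epsilon> \<and> co \<phi> \<in> U}) ` (UNIV \<times> B)"
  have "openin HT V" if V: "V \<in> \<B>" for V
  proof -
    obtain q where q: "V = (case q of (\<epsilon>, U) \<Rightarrow> {\<phi> \<in> H. ep \<phi> = \<epsilon> \<and> co \<phi> \<in> U})" "q \<in> UNIV \<times> B"
      using V unfolding \<B>_def by (rule imageE)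
    obtain \<epsilon> U where "q = (\<epsilon>, U)" by (cases q)
    then have U: "U \<in> B" "V = {\<phi> \<in> H. ep \<phi> = \<epsilon> \<and> co \<phi> \<in> U}" using q by auto
    have "openin HT {\<phi> \<in> topspace HT. co \<phi> \<in> W2 \<inter> U}"
      using B(2)[OF U(1)] by (intro openin_continuous_map_preimage[OF continuous_map_co]) auto
    then have "openin HT ({\<phi> \<in> topspace HT. co \<phi> \<in> W2 \<inter> U} \<inter> {\<phi> \<in> H. ep \<phi> = \<epsilon>})"
      using openin_sheet by (rule openin_Int)
    moreover have "{\<phi> \<in> topspace HT. co \<phi> \<in> W2 \<inter> U} \<inter> {\<phi> \<in> H. ep \<phi> = \<epsilon>} = V"
      using co_in by (auto simp: U topspace_HT)
    ultimately show ?thesis by simp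
  qed
  moreover have "\<exists>V\<in>\<B>. \<phi> \<in> V \<and> V \<subseteq> Q" if Q: "openin HT Q" and phi: "\<phi> \<in> Q" for \<phi> Q
  proof -
    have QH: "Q \<subseteq> H" using openin_subset[OF Q] by (simp add: topspace_HT)
    have "openin (top_of_set W2) {x \<in> topspace (top_of_set W2). pt (ep \<phi>) x \<in> Q}"
      by (rule openin_continuous_map_preimage[OF continuous_map_pt Q])
    then obtain O' where O': "open O'" "{x \<in> W2. pt (ep \<phi>) x \<in> Q} = W2 \<inter> O'" by (auto simp: openin_open)
    have "\<phi> \<in> H" using phi QH by blast
    then have "co \<phi> \<in> {x \<in> W2. pt (ep \<phi>) x \<in> Q}" using phi co_in[of \<phi>] pt_co[of \<phi>] by simp
    then have "co \<phi> \<in> O'" unfolding O'(2) by blast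
    then obtain U where U: "U \<in> B" "co \<phi> \<in> U" "U \<subseteq> O'" using B(3)[OF O'(1)] by blast
    have "{\<psi> \<in> H. ep \<psi> = ep \<phi> \<and> co \<psi> \<in> U} \<subseteq> Q"
    proof
      fix \<psi> assume "\<psi> \<in> {\<psi> \<in> H. ep \<psi> = ep \<phi> \<and> co \<psi> \<in> U}"
      then have p: "\<psi> \<in> H" "ep \<psi> = ep \<phi>" "co \<psi> \<in> W2 \<inter> O'" using co_in U(3) by auto
      then have "co \<psi> \<in> {x \<in> W2. pt (ep \<phi>) x \<in> Q}" unfolding O'(2) by blast
      then show "\<psi> \<in> Q" using pt_co[OF p(1)] p(2) by simp
    qed
    moreover have "{\<psi> \<in> H. ep \<psi> = ep \<phi> \<and> co \<psi> \<in> U} \<in> \<B>" unfolding \<B>_def using U(1) by (intro image_eqI[of _ _ "(ep \<phi>, U)"]) auto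
    ultimately show ?thesis using phi QH U(2) by (intro bexI) auto
  qed
  moreover have "countable \<B>" unfolding \<B>_def using B(1) by (intro countable_image countable_SIGMA) auto
  ultimately show ?thesis unfolding second_countable_def by blast
qed

lemma smooth_manifold_MM: "smooth_manifold MM"
  by (rule MS.smooth_manifold_sheeted) (simp_all add: Hausdorff_HT second_countable_HT)


subsection \<open>The group operations\<close>

abbreviation "HG \<equiv> affine_group GM D"

definition mulcf :: "(bool \<Rightarrow> nat \<Rightarrow> real) \<Rightarrow> bool \<Rightarrow> (bool \<Rightarrow> nat \<Rightarrow> real) \<Rightarrow> bool \<Rightarrow> nat \<Rightarrow> real" where
  "mulcf c \<epsilon>' c' i = cmul (c (i \<noteq> \<epsilon>')) (c' i)"

lemma mulcf_S: "(\<And>i. c i \<in> S) \<Longrightarrow> (\<And>i. c' i \<in> S) \<Longrightarrow> mulcf c \<epsilon>' c' i \<in> S"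
  unfolding mulcf_def by (rule stabilizer_cmul)

lemma carrier_HG: "carrier HG = H"
  by (simp add: affine_group_def)

lemma H_Bij: "\<phi> \<in> H \<Longrightarrow> \<phi> \<in> Bij (points GM)"
  by (simp add: affine_transformations_def diffeo_def)

lemma mult_act:
  assumes c: "\<And>i. c i \<in> S" and c': "\<And>i. c' i \<in> S"
  shows "act \<epsilon> c \<otimes>\<^bsub>HG\<^esub> act \<epsilon>' c' = act (\<epsilon> \<noteq> \<epsilon>') (mulcf c \<epsilon>' c')"
proof -
  have "act \<epsilon> c \<otimes>\<^bsub>HG\<^esub> act \<epsilon>' c' = compose (points GM) (act \<epsilon> c) (act \<epsilon>' c')"
    using H_Bij[OF act_in_H[OF c]] H_Bij[OF act_in_H[OF c']] by (simp add: affine_group_def BijGroup_def)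
  also have "\<dots> = act (\<epsilon> \<noteq> \<epsilon>') (mulcf c \<epsilon>' c')"
  proof (rule extensionalityI[of _ "points GM"])
    show "compose (points GM) (act \<epsilon> c) (act \<epsilon>' c') g = act (\<epsilon> \<noteq> \<epsilon>') (mulcf c \<epsilon>' c') g" if "g \<in> points GM" for g
      using that act_act[where \<epsilon> = \<epsilon> and \<epsilon>' = \<epsilon>', OF c c', of g] by (simp add: compose_def points_GM mulcf_def[abs_def])
  qed (simp_all add: act_extensional compose_extensional)
  finally show ?thesis .
qed

lemma one_HG: "\<one>\<^bsub>HG\<^esub> = act False (\<lambda>_. cone)"
proof -
  have "\<one>\<^bsub>HG\<^esub> = (\<lambda>x\<in>points GM. x)" by (simp add: affine_group_def BijGroup_def)
  also have "\<dots> = act False (\<lambda>_. cone)"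
    by (rule extensionalityI[of _ "points GM"]) (use act_extensional in \<open>simp_all add: act_one points_GM\<close>)
  finally show ?thesis .
qed

lemma mult_inverse_act:
  assumes c: "\<And>i. c i \<in> S"
  shows "act \<epsilon> (cinvs \<epsilon> c) \<otimes>\<^bsub>HG\<^esub> act \<epsilon> c = \<one>\<^bsub>HG\<^esub>"
proof -
  have d: "cdet (c i) \<noteq> 0" for i using c[of i] by (simp add: stabilizer_def)
  have "mulcf (cinvs \<epsilon> c) \<epsilon> c = (\<lambda>_. cone)"
    unfolding mulcf_def[abs_def] cinvs_def bool_neq_neq by (simp add: cmul_cinv d)
  then show ?thesis unfolding mult_act[OF cinvs_S[OF c] c] one_HG by simp
qed

lemma group_HG: "group HG"
proof (rule groupI)
  show "x \<otimes>\<^bsub>HG\<^esub> y \<in> carrier HG" if "x \<in> carrier HG" "y \<in> carrier HG" for x y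
    using that unfolding carrier_HG by (elim H_cases) (simp add: mult_act mulcf_S act_in_H)
  show "\<one>\<^bsub>HG\<^esub> \<in> carrier HG" unfolding carrier_HG one_HG by (rule act_in_H) (rule stabilizer_cone)
  show "x \<otimes>\<^bsub>HG\<^esub> y \<otimes>\<^bsub>HG\<^esub> z = x \<otimes>\<^bsub>HG\<^esub> (y \<otimes>\<^bsub>HG\<^esub> z)"
    if "x \<in> carrier HG" "y \<in> carrier HG" "z \<in> carrier HG" for x y z
  proof -
    have B: "w \<in> carrier (BijGroup (points GM))" if "w \<in> {x, y, z}" for w
      using that \<open>x \<in> carrier HG\<close> \<open>y \<in> carrier HG\<close> \<open>z \<in> carrier HG\<close> H_Bij by (auto simp: carrier_HG BijGroup_def)
    have m: "(\<otimes>\<^bsub>HG\<^esub>) = (\<otimes>\<^bsub>BijGroup (points GM)\<^esub>)" by (simp add: affine_group_def)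
    show ?thesis unfolding m
      by (rule monoid.m_assoc[OF group.is_monoid[OF group_BijGroup]]) (use B in auto)
  qed
  show "\<one>\<^bsub>HG\<^esub> \<otimes>\<^bsub>HG\<^esub> x = x" if "x \<in> carrier HG" for x
  proof -
    have m: "(\<otimes>\<^bsub>HG\<^esub>) = (\<otimes>\<^bsub>BijGroup (points GM)\<^esub>)" "\<one>\<^bsub>HG\<^esub> = \<one>\<^bsub>BijGroup (points GM)\<^esub>"
      by (simp_all add: affine_group_def)
    show ?thesis unfolding m
      by (rule monoid.l_one[OF group.is_monoid[OF group_BijGroup]])
         (use that H_Bij in \<open>auto simp: carrier_HG BijGroup_def\<close>)
  qed
  show "\<exists>y\<in>carrier HG. y \<otimes>\<^bsub>HG\<^esub> x = \<one>\<^bsub>HG\<^esub>" if "x \<in> carrier HG" for x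
  proof -
    have "x \<in> H" using that by (simp add: carrier_HG)
    from H_cases[OF this] obtain \<epsilon> c where x: "\<And>i. c i \<in> S" "x = act \<epsilon> c" by blast
    have "act \<epsilon> (cinvs \<epsilon> c) \<in> carrier HG" unfolding carrier_HG by (rule act_in_H) (rule cinvs_S[OF x(1)])
    then show ?thesis using mult_inverse_act[where c = c and \<epsilon> = \<epsilon>, OF x(1)] x(2) by blast
  qed
qed

lemma inv_act:
  assumes c: "\<And>i. c i \<in> S"
  shows "inv\<^bsub>HG\<^esub> (act \<epsilon> c) = act \<epsilon> (cinvs \<epsilon> c)"
  by (rule group.inv_equality[OF group_HG mult_inverse_act[OF c]])
     (simp_all add: carrier_HG act_in_H c cinvs_S)

lemma
  assumes "\<phi> \<in> H" "\<psi> \<in> H"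
  shows mult_H: "\<phi> \<otimes>\<^bsub>HG\<^esub> \<psi> = pt (ep \<phi> \<noteq> ep \<psi>) (pack (\<lambda>i. restr (mulcf (cf \<phi>) (ep \<psi>) (cf \<psi>) i)))"
    and mult_in_H: "\<phi> \<otimes>\<^bsub>HG\<^esub> \<psi> \<in> H"
    and ep_mult: "ep (\<phi> \<otimes>\<^bsub>HG\<^esub> \<psi>) = (ep \<phi> \<noteq> ep \<psi>)"
    and co_mult: "co (\<phi> \<otimes>\<^bsub>HG\<^esub> \<psi>) = pack (\<lambda>i. restr (mulcf (cf \<phi>) (ep \<psi>) (cf \<psi>) i))"
proof -
  have m: "mulcf (cf \<phi>) (ep \<psi>) (cf \<psi>) i \<in> S" for i using mulcf_S cf_S assms by blast
  have e: "\<phi> \<otimes>\<^bsub>HG\<^esub> \<psi> = act (ep \<phi> \<noteq> ep \<psi>) (mulcf (cf \<phi>) (ep \<psi>) (cf \<psi>))"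
    using mult_act[of "cf \<phi>" "cf \<psi>" "ep \<phi>" "ep \<psi>", OF cf_S[OF assms(1)] cf_S[OF assms(2)]]
    by (simp add: act_ep_cf assms)
  show "\<phi> \<otimes>\<^bsub>HG\<^esub> \<psi> = pt (ep \<phi> \<noteq> ep \<psi>) (pack (\<lambda>i. restr (mulcf (cf \<phi>) (ep \<psi>) (cf \<psi>) i)))"
    unfolding e pt_pack[OF m] ..
  show "\<phi> \<otimes>\<^bsub>HG\<^esub> \<psi> \<in> H" unfolding e by (rule act_in_H[OF m])
  show "ep (\<phi> \<otimes>\<^bsub>HG\<^esub> \<psi>) = (ep \<phi> \<noteq> ep \<psi>)" unfolding e by (rule ep_act[OF m])
  show "co (\<phi> \<otimes>\<^bsub>HG\<^esub> \<psi>) = pack (\<lambda>i. restr (mulcf (cf \<phi>) (ep \<psi>) (cf \<psi>) i))" unfolding e by (rule co_act[OF m])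
qed

lemma
  assumes "\<phi> \<in> H"
  shows inv_H: "inv\<^bsub>HG\<^esub> \<phi> = pt (ep \<phi>) (pack (\<lambda>i. restr (cinvs (ep \<phi>) (cf \<phi>) i)))"
    and inv_in_H: "inv\<^bsub>HG\<^esub> \<phi> \<in> H"
    and ep_inv: "ep (inv\<^bsub>HG\<^esub> \<phi>) = ep \<phi>"
    and co_inv: "co (inv\<^bsub>HG\<^esub> \<phi>) = pack (\<lambda>i. restr (cinvs (ep \<phi>) (cf \<phi>) i))"
proof -
  have m: "cinvs (ep \<phi>) (cf \<phi>) i \<in> S" for i using cinvs_S cf_S assms by blast
  have e: "inv\<^bsub>HG\<^esub> \<phi> = act (ep \<phi>) (cinvs (ep \<phi>) (cf \<phi>))"
    using inv_act[of "cf \<phi>" "ep \<phi>", OF cf_S[OF assms]] by (simp add: act_ep_cf assms)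
  show "inv\<^bsub>HG\<^esub> \<phi> = pt (ep \<phi>) (pack (\<lambda>i. restr (cinvs (ep \<phi>) (cf \<phi>) i)))" unfolding e pt_pack[OF m] ..
  show "inv\<^bsub>HG\<^esub> \<phi> \<in> H" unfolding e by (rule act_in_H[OF m])
  show "ep (inv\<^bsub>HG\<^esub> \<phi>) = ep \<phi>" unfolding e by (rule ep_act[OF m])
  show "co (inv\<^bsub>HG\<^esub> \<phi>) = pack (\<lambda>i. restr (cinvs (ep \<phi>) (cf \<phi>) i))" unfolding e by (rule co_act[OF m])
qed


subsection \<open>Continuity and smoothness of the group operations\<close>

lemma continuous_map_cmul:
  assumes "\<And>j. continuous_map X euclideanreal (\<lambda>x. c x j)" "\<And>j. continuous_map X euclideanreal (\<lambda>x. d x j)"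
  shows "continuous_map X euclideanreal (\<lambda>x. cmul (c x) (d x) j)"
  unfolding cmul_def
  by (intro continuous_map_row continuous_map_add continuous_map_real_mult assms)

lemma C_inf_cmul:
  assumes "openin (Euclidean_space m) T" "\<And>j. C_inf_on m T (\<lambda>x. c x j)" "\<And>j. C_inf_on m T (\<lambda>x. d x j)"
  shows "C_inf_on m T (\<lambda>x. cmul (c x) (d x) j)"
  unfolding cmul_def by (intro C_inf_row C_inf_add C_inf_mult assms)

lemma continuous_map_cinv:
  assumes c: "\<And>j. continuous_map X euclideanreal (\<lambda>x. c x j)" and nz: "\<And>x. x \<in> topspace X \<Longrightarrow> cdet (c x) \<noteq> 0"
  shows "continuous_map X euclideanreal (\<lambda>x. cinv (c x) j)"
  unfolding cinv_def
  by (intro continuous_map_row continuous_map_real_divide nz)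
     (auto simp: cdet_def intro!: continuous_map_diff continuous_map_real_mult continuous_map_minus c)

lemma C_inf_cinv:
  assumes T: "openin (Euclidean_space m) T" and c: "\<And>j. C_inf_on m T (\<lambda>x. c x j)" and nz: "\<And>x. x \<in> T \<Longrightarrow> cdet (c x) \<noteq> 0"
  shows "C_inf_on m T (\<lambda>x. cinv (c x) j)"
proof -
  have d: "C_inf_on m T (\<lambda>x. cdet (c x))"
    unfolding cdet_def by (intro C_inf_diff C_inf_mult c T)
  show ?thesis unfolding cinv_def
    by (intro C_inf_row C_inf_divide d nz C_inf_diff C_inf_mult C_inf_minus c T)
qed

lemma C_inf_pack_restr:
  assumes T: "openin (Euclidean_space m) T" and "\<And>i j. C_inf_on m T (\<lambda>x. c x i j)"
  shows "C_inf_on m T (\<lambda>x. pack (\<lambda>i. restr (c x i)) k)"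
  unfolding pack_def restr_def using assms(2) C_inf_const[OF T, of 0]
  by (cases "k < n"; cases "k < 2 * n"; cases "k - n < n"; simp)

lemma C_inf_expand_unpack:
  assumes T: "openin (Euclidean_space m) T" and g: "\<And>x. x \<in> T \<Longrightarrow> g x \<in> W2" "\<And>k. C_inf_on m T (\<lambda>x. g x k)"
  shows "C_inf_on m T (\<lambda>x. expand (unpack (g x) i) j)"
proof (rule C_inf_compose[OF T WA_open expand_smooth])
  show "C_inf_on m T (\<lambda>x. unpack (g x) i k)" for k
    using g(2) C_inf_const[OF T, of 0] unfolding unpack_def by (cases "k < n"; cases i) simp_all
  show "unpack (g x) i \<in> WA" if "x \<in> T" for x using g(1)[OF that] by (simp add: W2_def)
qed

lemma continuous_map_inv: "continuous_map HT HT (\<lambda>\<phi>. inv\<^bsub>HG\<^esub> \<phi>)"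
proof (rule pasting_lemma[where I = UNIV and T = "\<lambda>\<epsilon>. {\<phi> \<in> H. ep \<phi> = \<epsilon>}"
      and f = "\<lambda>\<epsilon> \<phi>. pt \<epsilon> (pack (\<lambda>i. restr (cinvs \<epsilon> (cf \<phi>) i)))"])
  fix \<epsilon>
  have "continuous_map HT (top_of_set W2) (\<lambda>\<phi>. pack (\<lambda>i. restr (cinvs \<epsilon> (cf \<phi>) i)))"
  proof (rule continuous_map_pack_restr)
    show "continuous_map HT euclideanreal (\<lambda>\<phi>. cinvs \<epsilon> (cf \<phi>) i j)" for i j
      unfolding cinvs_def
      by (rule continuous_map_cinv[OF continuous_map_cf]) (use cf_S in \<open>auto simp: topspace_HT stabilizer_def\<close>)
  qed (use cinvs_S cf_S topspace_HT in blast)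
  from continuous_map_compose[OF this continuous_map_pt[of \<epsilon>]]
  show "continuous_map (subtopology HT {\<phi> \<in> H. ep \<phi> = \<epsilon>}) HT (\<lambda>\<phi>. pt \<epsilon> (pack (\<lambda>i. restr (cinvs \<epsilon> (cf \<phi>) i))))"
    by (intro continuous_map_from_subtopology) (simp add: o_def)
qed (use openin_sheet inv_H in \<open>auto simp: topspace_HT\<close>)

lemma continuous_map_mult: "continuous_map (prod_topology HT HT) HT (\<lambda>(\<phi>, \<psi>). \<phi> \<otimes>\<^bsub>HG\<^esub> \<psi>)"
proof (rule pasting_lemma[where I = UNIV and T = "\<lambda>(\<epsilon>, \<epsilon>'). {\<phi> \<in> H. ep \<phi> = \<epsilon>} \<times> {\<phi> \<in> H. ep \<phi> = \<epsilon>'}"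
      and f = "\<lambda>(\<epsilon>, \<epsilon>') p. pt (\<epsilon> \<noteq> \<epsilon>') (pack (\<lambda>i. restr (mulcf (cf (fst p)) \<epsilon>' (cf (snd p)) i)))"])
  let ?X = "prod_topology HT HT"
  fix e :: "bool \<times> bool"
  obtain \<epsilon> \<epsilon>' where e: "e = (\<epsilon>, \<epsilon>')" by (cases e)
  show "openin ?X (case e of (\<epsilon>, \<epsilon>') \<Rightarrow> {\<phi> \<in> H. ep \<phi> = \<epsilon>} \<times> {\<phi> \<in> H. ep \<phi> = \<epsilon>'})"
    using openin_sheet by (simp add: e openin_prod_Times_iff)
  have c1: "continuous_map ?X euclideanreal (\<lambda>p. cf (fst p) i j)" for i j
    using continuous_map_compose[OF continuous_map_fst continuous_map_cf] by (simp add: o_def)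
  have c2: "continuous_map ?X euclideanreal (\<lambda>p. cf (snd p) i j)" for i j
    using continuous_map_compose[OF continuous_map_snd continuous_map_cf] by (simp add: o_def)
  have "continuous_map ?X (top_of_set W2) (\<lambda>p. pack (\<lambda>i. restr (mulcf (cf (fst p)) \<epsilon>' (cf (snd p)) i)))"
  proof (rule continuous_map_pack_restr)
    show "continuous_map ?X euclideanreal (\<lambda>p. mulcf (cf (fst p)) \<epsilon>' (cf (snd p)) i j)" for i j
      unfolding mulcf_def by (intro continuous_map_cmul c1 c2)
    show "mulcf (cf (fst p)) \<epsilon>' (cf (snd p)) i \<in> S" if "p \<in> topspace ?X" for p i
      using that by (intro mulcf_S cf_S) (auto simp: topspace_HT)
  qed
  from continuous_map_compose[OF this continuous_map_pt[of "\<epsilon> \<noteq> \<epsilon>'"]]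
  have "continuous_map ?X HT (\<lambda>p. pt (\<epsilon> \<noteq> \<epsilon>') (pack (\<lambda>i. restr (mulcf (cf (fst p)) \<epsilon>' (cf (snd p)) i))))"
    by (simp add: o_def)
  then show "continuous_map (subtopology ?X (case e of (\<epsilon>, \<epsilon>') \<Rightarrow> {\<phi> \<in> H. ep \<phi> = \<epsilon>} \<times> {\<phi> \<in> H. ep \<phi> = \<epsilon>'})) HT
      (case e of (\<epsilon>, \<epsilon>') \<Rightarrow> \<lambda>p. pt (\<epsilon> \<noteq> \<epsilon>') (pack (\<lambda>i. restr (mulcf (cf (fst p)) \<epsilon>' (cf (snd p)) i))))"
    unfolding e prod.case by (rule continuous_map_from_subtopology)
next
  fix p assume "p \<in> topspace (prod_topology HT HT)"
  then obtain \<phi> \<psi> where p: "p = (\<phi>, \<psi>)" "\<phi> \<in> H" "\<psi> \<in> H" by (auto simp: topspace_HT)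
  show "\<exists>j. j \<in> UNIV \<and> p \<in> (case j of (\<epsilon>, \<epsilon>') \<Rightarrow> {\<phi> \<in> H. ep \<phi> = \<epsilon>} \<times> {\<phi> \<in> H. ep \<phi> = \<epsilon>'}) \<and>
      (case p of (\<phi>, \<psi>) \<Rightarrow> \<phi> \<otimes>\<^bsub>HG\<^esub> \<psi>) =
      (case j of (\<epsilon>, \<epsilon>') \<Rightarrow> \<lambda>p. pt (\<epsilon> \<noteq> \<epsilon>') (pack (\<lambda>i. restr (mulcf (cf (fst p)) \<epsilon>' (cf (snd p)) i)))) p"
    using p mult_H[OF p(2,3)] by (intro exI[of _ "(ep \<phi>, ep \<psi>)"]) simp
qed auto

lemma smooth_map_inv: "smooth_map MM MM (\<lambda>\<phi>. inv\<^bsub>HG\<^esub> \<phi>)"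
proof (rule MS.smooth_mapI_sheets[where \<tau> = "\<lambda>\<epsilon>. \<epsilon>"])
  show "continuous_map (mtop MM) (mtop MM) (\<lambda>\<phi>. inv\<^bsub>HG\<^esub> \<phi>)" using continuous_map_inv by simp
  show "ep (inv\<^bsub>HG\<^esub> (pt \<epsilon> x)) = \<epsilon>" if "x \<in> W2" for \<epsilon> x
    using ep_inv[OF pt_in_H[OF that]] ep_pt[OF that] by simp
  fix \<epsilon> k
  have "C_inf_on (2 * n) W2 (\<lambda>x. pack (\<lambda>i. restr (cinvs \<epsilon> (\<lambda>i. expand (unpack x i)) i)) k)"
  proof (rule C_inf_pack_restr[OF W2_open])
    show "C_inf_on (2 * n) W2 (\<lambda>x. cinvs \<epsilon> (\<lambda>i. expand (unpack x i)) i j)" for i j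
      unfolding cinvs_def
    proof (rule C_inf_cinv[OF W2_open C_inf_expand_unpack[OF W2_open _ C_inf_coord[OF W2_open]]])
      show "cdet (expand (unpack x (i \<noteq> \<epsilon>))) \<noteq> 0" if "x \<in> W2" for x
        using expand_in[of "unpack x (i \<noteq> \<epsilon>)"] that by (simp add: W2_def stabilizer_def)
    qed
  qed
  then have "C_inf_on (2 * n) W2 (\<lambda>x. co (inv\<^bsub>HG\<^esub> (pt \<epsilon> x)) k)"
  proof (rule C_inf_cong[OF W2_open, rotated])
    fix x assume x: "x \<in> W2"
    have "cf (pt \<epsilon> x) = (\<lambda>i. expand (unpack x i))" using cf_pt[OF x] by auto
    then show "pack (\<lambda>i. restr (cinvs \<epsilon> (\<lambda>i. expand (unpack x i)) i)) k = co (inv\<^bsub>HG\<^esub> (pt \<epsilon> x)) k"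
      using co_inv[OF pt_in_H[OF x]] ep_pt[OF x] by simp
  qed
  then show "C_inf_on (mdim MM) W2 (\<lambda>x. co (inv\<^bsub>HG\<^esub> (pt \<epsilon> x)) k)" by simp
qed

end


context coordinatized
begin

lemma smooth_map_mult: "smooth_map (product_manifold MM MM) MM (\<lambda>(\<phi>, \<psi>). \<phi> \<otimes>\<^bsub>HG\<^esub> \<psi>)"
proof -
  \<comment> \<open>\<open>lp\<close> and \<open>rp\<close> split the coordinates of the product manifold into those of the two factors.\<close>
  define N where "N = 2 * n"
  define lp where "lp x i = (if i < N then x i else 0)" for x :: "nat \<Rightarrow> real" and i
  define rp where "rp x i = x (i + N)" for x :: "nat \<Rightarrow> real" and i
  define W4 where "W4 = {x \<in> Eset (N + N). lp x \<in> W2 \<and> rp x \<in> W2}"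
  let ?sh = "\<lambda>\<epsilon>. {\<phi> \<in> H. ep \<phi> = \<epsilon>}"
  let ?pc = "product_chart N co co"
  let ?m = "\<lambda>(\<phi>, \<psi>). \<phi> \<otimes>\<^bsub>HG\<^esub> \<psi>"
  have W2E: "W2 \<subseteq> Eset N" using openin_Euclidean_subset[OF W2_open] by (simp add: N_def)
  have pc: "lp (?pc (\<phi>, \<psi>)) = co \<phi>" "rp (?pc (\<phi>, \<psi>)) = co \<psi>" if "\<phi> \<in> H" "\<psi> \<in> H" for \<phi> \<psi>
  proof -
    have "co \<phi> \<in> Eset N" using co_in[OF that(1)] W2E by blast
    then show "lp (?pc (\<phi>, \<psi>)) = co \<phi>" by (auto simp: lp_def product_chart_def fun_eq_iff)
    show "rp (?pc (\<phi>, \<psi>)) = co \<psi>" by (auto simp: rp_def product_chart_def fun_eq_iff)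
  qed
  have pc_pt: "?pc (pt \<epsilon> (lp x), pt \<epsilon>' (rp x)) = x" if "x \<in> W4" for x \<epsilon> \<epsilon>'
  proof
    fix i
    show "?pc (pt \<epsilon> (lp x), pt \<epsilon>' (rp x)) i = x i"
      using that by (simp add: product_chart_def W4_def co_pt) (simp add: lp_def rp_def)
  qed
  have pc_in: "?pc q \<in> W4" if qH: "q \<in> H \<times> H" for q
  proof -
    obtain \<phi> \<psi> where q: "q = (\<phi>, \<psi>)" "\<phi> \<in> H" "\<psi> \<in> H" using qH by auto
    have "co \<psi> \<in> Eset N" using co_in[OF q(3)] W2E by blast
    then have "?pc q \<in> Eset (N + N)" by (auto simp: product_chart_def q)
    then show ?thesis using pc[OF q(2,3)] co_in q by (simp add: W4_def)
  qed
  have image: "?pc ` (?sh \<epsilon> \<times> ?sh \<epsilon>') = W4" for \<epsilon> \<epsilon>'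
  proof
    show "?pc ` (?sh \<epsilon> \<times> ?sh \<epsilon>') \<subseteq> W4" using pc_in by blast
    show "W4 \<subseteq> ?pc ` (?sh \<epsilon> \<times> ?sh \<epsilon>')"
    proof
      fix x assume x: "x \<in> W4"
      then have "(pt \<epsilon> (lp x), pt \<epsilon>' (rp x)) \<in> ?sh \<epsilon> \<times> ?sh \<epsilon>'" by (simp add: W4_def pt_in_H ep_pt)
      from imageI[OF this, of ?pc] show "x \<in> ?pc ` (?sh \<epsilon> \<times> ?sh \<epsilon>')" unfolding pc_pt[OF x] .
    qed
  qed
  have inj: "inj_on ?pc (?sh \<epsilon> \<times> ?sh \<epsilon>')" for \<epsilon> \<epsilon>'
  proof (rule inj_onI)
    fix p q assume p: "p \<in> ?sh \<epsilon> \<times> ?sh \<epsilon>'" and q: "q \<in> ?sh \<epsilon> \<times> ?sh \<epsilon>'" and eq: "?pc p = ?pc q"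
    obtain a b c d where ab: "p = (a, b)" "q = (c, d)" by (cases p, cases q)
    have "co a = co c" "co b = co d" using pc[of a b] pc[of c d] p q eq by (auto simp: ab)
    then show "p = q" using pt_co[of a] pt_co[of b] pt_co[of c] pt_co[of d] p q by (auto simp: ab)
  qed
  have inv: "inv_into (?sh \<epsilon> \<times> ?sh \<epsilon>') ?pc x = (pt \<epsilon> (lp x), pt \<epsilon>' (rp x))" if "x \<in> W4" for x \<epsilon> \<epsilon>'
  proof -
    have mem: "(pt \<epsilon> (lp x), pt \<epsilon>' (rp x)) \<in> ?sh \<epsilon> \<times> ?sh \<epsilon>'"
      using that by (simp add: W4_def pt_in_H ep_pt)
    show ?thesis
      using inv_into_f_f[of ?pc "?sh \<epsilon> \<times> ?sh \<epsilon>'", OF inj mem] unfolding pc_pt[OF that] .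
  qed
  have lpc: "continuous_on A lp" for A
  proof (rule continuous_on_coordinatewise_then_product)
    fix i show "continuous_on A (\<lambda>x. lp x i)"
      unfolding lp_def by (cases "i < N") (simp_all add: continuous_on_product_then_coordinatewise[OF continuous_on_id])
  qed
  have rpc: "continuous_on A rp" for A
    unfolding rp_def
    by (intro continuous_on_coordinatewise_then_product continuous_on_product_then_coordinatewise[OF continuous_on_id])
  have W4o: "openin (Euclidean_space (N + N)) W4"
  proof -
    obtain U where U: "open U" "W2 = Eset N \<inter> U"
      using W2_open unfolding N_def[symmetric] Euclidean_space_top_of_set openin_open by blast
    have 0: "openin (Euclidean_space (N + N)) (Eset (N + N))" by (simp add: Euclidean_space_top_of_set)
    have "openin (Euclidean_space (N + N)) ({x \<in> Eset (N + N). lp x \<in> U} \<inter> {x \<in> Eset (N + N). rp x \<in> U})"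
      by (intro openin_Int openin_Euclidean_preimage[OF 0 lpc U(1)] openin_Euclidean_preimage[OF 0 rpc U(1)])
    moreover have "{x \<in> Eset (N + N). lp x \<in> U} \<inter> {x \<in> Eset (N + N). rp x \<in> U} = W4"
    proof -
      have "lp x \<in> Eset N" for x by (simp add: lp_def)
      moreover have "rp x \<in> Eset N" if "x \<in> Eset (N + N)" for x using that by (simp add: rp_def)
      ultimately show ?thesis unfolding W4_def U(2) by blast
    qed
    ultimately show ?thesis by simp
  qed
  have smooth: "C_inf_on (N + N) W4 (\<lambda>x. co (?m (inv_into (?sh \<epsilon> \<times> ?sh \<epsilon>') ?pc x)) k)" for \<epsilon> \<epsilon>' k
  proof (rule C_inf_cong[OF W4o])
    have l: "C_inf_on (N + N) W4 (\<lambda>x. expand (unpack (lp x) i) j)" for i j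
    proof (rule C_inf_expand_unpack[OF W4o])
      show "C_inf_on (N + N) W4 (\<lambda>x. lp x k)" for k
        unfolding lp_def using C_inf_coord[OF W4o] C_inf_const[OF W4o] by (cases "k < N") simp_all
    qed (simp add: W4_def)
    have r: "C_inf_on (N + N) W4 (\<lambda>x. expand (unpack (rp x) i) j)" for i j
    proof (rule C_inf_expand_unpack[OF W4o])
      show "C_inf_on (N + N) W4 (\<lambda>x. rp x k)" for k unfolding rp_def by (rule C_inf_coord[OF W4o])
    qed (simp add: W4_def)
    show "C_inf_on (N + N) W4 (\<lambda>x. pack (\<lambda>i. restr (mulcf (\<lambda>i. expand (unpack (lp x) i)) \<epsilon>' (\<lambda>i. expand (unpack (rp x) i)) i)) k)"
      by (rule C_inf_pack_restr[OF W4o]) (unfold mulcf_def, intro C_inf_cmul[OF W4o] l r)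
    show "pack (\<lambda>i. restr (mulcf (\<lambda>i. expand (unpack (lp x) i)) \<epsilon>' (\<lambda>i. expand (unpack (rp x) i)) i)) k =
        co (?m (inv_into (?sh \<epsilon> \<times> ?sh \<epsilon>') ?pc x)) k" if x: "x \<in> W4" for x
    proof -
      have x2: "lp x \<in> W2" "rp x \<in> W2" using x by (simp_all add: W4_def)
      have "cf (pt \<epsilon> (lp x)) = (\<lambda>i. expand (unpack (lp x) i))" "cf (pt \<epsilon>' (rp x)) = (\<lambda>i. expand (unpack (rp x) i))"
        using cf_pt x2 by auto
      then show ?thesis
        using co_mult[OF pt_in_H[OF x2(1)] pt_in_H[OF x2(2)]] ep_pt[OF x2(2)] by (simp add: inv[OF x])
    qed
  qed
  have "C_inf_on (N + N) (?pc ` ((?sh \<epsilon> \<times> ?sh \<epsilon>') \<inter> ?m -` ?sh \<delta>)) (\<lambda>x. co (?m (inv_into (?sh \<epsilon> \<times> ?sh \<epsilon>') ?pc x)) k)"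
    for \<epsilon> \<epsilon>' \<delta> k
  proof (cases "\<delta> = (\<epsilon> \<noteq> \<epsilon>')")
    case True
    have "(?sh \<epsilon> \<times> ?sh \<epsilon>') \<inter> ?m -` ?sh \<delta> = ?sh \<epsilon> \<times> ?sh \<epsilon>'"
      using mult_in_H ep_mult True by auto
    then show ?thesis using smooth image by simp
  next
    case False
    have "(?sh \<epsilon> \<times> ?sh \<epsilon>') \<inter> ?m -` ?sh \<delta> = {}"
    proof (rule equals0I)
      fix p assume p: "p \<in> (?sh \<epsilon> \<times> ?sh \<epsilon>') \<inter> ?m -` ?sh \<delta>"
      obtain \<phi> \<psi> where "p = (\<phi>, \<psi>)" by (cases p)
      then show False using p ep_mult[of \<phi> \<psi>] False by simp
    qed
    then have e: "?pc ` ((?sh \<epsilon> \<times> ?sh \<epsilon>') \<inter> ?m -` ?sh \<delta>) = {}" by simp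
    have o: "openin (Euclidean_space (N + N)) {}" by simp
    show ?thesis unfolding e by (rule C_inf_cong[OF o _ C_inf_const[OF o]]) auto
  qed
  note main = this
  have at: "\<exists>\<epsilon> \<epsilon>'. p = (?sh \<epsilon> \<times> ?sh \<epsilon>', ?pc)" if "p \<in> matlas (product_manifold MM MM)" for p
    using that unfolding product_manifold_def by (auto simp: MM_def N_def)
  have at': "\<exists>\<delta>. p = (?sh \<delta>, co)" if "p \<in> matlas MM" for p
    using that by (auto simp: MM_def)
  have d: "mdim (product_manifold MM MM) = N + N" by (simp add: product_manifold_def N_def)
  have "\<forall>(U, \<phi>) \<in> matlas (product_manifold MM MM). \<forall>(V, \<psi>) \<in> matlas MM. \<forall>i < mdim MM.
        C_inf_on (mdim (product_manifold MM MM)) (\<phi> ` (U \<inter> ?m -` V)) (\<lambda>x. \<psi> (?m (inv_into U \<phi> x)) i)"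
  proof
    fix p assume "p \<in> matlas (product_manifold MM MM)"
    then obtain \<epsilon> \<epsilon>' where p: "p = (?sh \<epsilon> \<times> ?sh \<epsilon>', ?pc)" using at by blast
    show "case p of (U, \<phi>) \<Rightarrow> \<forall>(V, \<psi>) \<in> matlas MM. \<forall>i < mdim MM.
        C_inf_on (mdim (product_manifold MM MM)) (\<phi> ` (U \<inter> ?m -` V)) (\<lambda>x. \<psi> (?m (inv_into U \<phi> x)) i)"
      unfolding p prod.case
    proof
      fix q assume "q \<in> matlas MM"
      then obtain \<delta> where q: "q = (?sh \<delta>, co)" using at' by blast
      show "case q of (V, \<psi>) \<Rightarrow> \<forall>i < mdim MM.
          C_inf_on (mdim (product_manifold MM MM)) (?pc ` ((?sh \<epsilon> \<times> ?sh \<epsilon>') \<inter> ?m -` V))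
            (\<lambda>x. \<psi> (?m (inv_into (?sh \<epsilon> \<times> ?sh \<epsilon>') ?pc x)) i)"
        unfolding q prod.case d using main by blast
    qed
  qed
  then show ?thesis
    unfolding smooth_map_def using continuous_map_mult by (simp add: product_manifold_def)
qed

lemma lie_group_HG: "lie_group HG MM"
  unfolding lie_group_def
  using group_HG smooth_manifold_MM smooth_map_mult smooth_map_inv by (simp add: carrier_HG topspace_HT)


subsection \<open>The flat left invariant connection on the group of affine transformations\<close>

text \<open>
  The linear part depends on the sheet: the coordinates of the component \<open>i\<close> of the product involve
  those of the component \<open>i\<close> of the right factor only.
\<close>

lemma co_left_translation_affine:
  assumes phi: "\<phi> \<in> H" and k: "k < 2 * n"
  shows "\<exists>a b. \<forall>x\<in>W2. co (\<phi> \<otimes>\<^bsub>HG\<^esub> pt \<epsilon> x) k = a + (\<Sum>l<2 * n. b l * x l)"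
proof -
  define i where "i = (\<not> k < n)"
  define k' where "k' = (if i then k - n else k)"
  have k': "k' < n" using k by (auto simp: k'_def i_def)
  obtain a b where ab: "\<And>u. u \<in> WA \<Longrightarrow> cmul (cf \<phi> (i \<noteq> \<epsilon>)) (expand u) (sel k') = a + (\<Sum>j<n. b j * u j)"
    using affine_mul[OF cf_S[OF phi] k', of "i \<noteq> \<epsilon>"] by blast
  have "co (\<phi> \<otimes>\<^bsub>HG\<^esub> pt \<epsilon> x) k = a + (\<Sum>l<2 * n. (if i then (if l < n then 0 else b (l - n)) else (if l < n then b l else 0)) * x l)"
    if x: "x \<in> W2" for x
  proof -
    have "co (\<phi> \<otimes>\<^bsub>HG\<^esub> pt \<epsilon> x) k = cmul (cf \<phi> (i \<noteq> \<epsilon>)) (expand (unpack x i)) (sel k')"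
      unfolding co_mult[OF phi pt_in_H[OF x]] ep_pt[OF x] using k k'
      by (cases "k < n") (simp_all add: pack_def restr_def mulcf_def cf_pt[OF x] i_def k'_def)
    also have "\<dots> = a + (\<Sum>j<n. b j * unpack x i j)" using x by (intro ab) (simp add: W2_def)
    also have "(\<Sum>j<n. b j * unpack x i j) =
        (\<Sum>l<2 * n. (if i then (if l < n then 0 else b (l - n)) else (if l < n then b l else 0)) * x l)"
    proof -
      have split: "(\<Sum>l<2 * n. g l) = (\<Sum>l<n. g l) + (\<Sum>l<n. g (n + l))" for g :: "nat \<Rightarrow> real"
      proof -
        have "(\<Sum>l<n + m. g l) = (\<Sum>l<n. g l) + (\<Sum>l<m. g (n + l))" for m
          by (induction m) (simp_all add: add.assoc)
        then show ?thesis by (simp add: mult_2)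
      qed
      show ?thesis unfolding split by (cases i) (simp_all add: unpack_def)
    qed
    finally show ?thesis .
  qed
  then show ?thesis
    by (intro exI[of _ a] exI[of _ "\<lambda>l. if i then (if l < n then 0 else b (l - n)) else (if l < n then b l else 0)"]) simp
qed

lemma smooth_left_translation:
  assumes phi: "\<phi> \<in> H" and f: "\<And>\<psi>. \<psi> \<in> H \<Longrightarrow> f \<psi> = \<phi> \<otimes>\<^bsub>HG\<^esub> \<psi>"
  shows "smooth_map MM MM f"
proof (rule MS.smooth_mapI_sheets[where \<tau> = "\<lambda>\<epsilon>. ep \<phi> \<noteq> \<epsilon>"])
  have "continuous_map HT (prod_topology HT HT) (\<lambda>\<psi>. (\<phi>, \<psi>))"
    using phi by (intro continuous_map_pairedI) (simp_all add: topspace_HT)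
  from continuous_map_compose[OF this continuous_map_mult]
  have "continuous_map HT HT (\<lambda>\<psi>. \<phi> \<otimes>\<^bsub>HG\<^esub> \<psi>)" by (simp add: o_def)
  then show "continuous_map (mtop MM) (mtop MM) f"
    unfolding MM_simps by (rule continuous_map_eq) (simp add: f topspace_HT)
  show "ep (f (pt \<epsilon> x)) = (ep \<phi> \<noteq> \<epsilon>)" if "x \<in> W2" for \<epsilon> x
    using f[OF pt_in_H[OF that]] ep_mult[OF phi pt_in_H[OF that]] ep_pt[OF that] by simp
  show "C_inf_on (mdim MM) W2 (\<lambda>x. co (f (pt \<epsilon> x)) k)" if k: "k < mdim MM" for \<epsilon> k
  proof -
    obtain a b where ab: "\<And>x. x \<in> W2 \<Longrightarrow> co (\<phi> \<otimes>\<^bsub>HG\<^esub> pt \<epsilon> x) k = a + (\<Sum>l<2 * n. b l * x l)"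
      using co_left_translation_affine[OF phi, of k \<epsilon>] k by auto
    have "C_inf_on (2 * n) W2 (\<lambda>x. a + (\<Sum>l<2 * n. b l * x l))"
      by (intro C_inf_add C_inf_sum C_inf_mult C_inf_const C_inf_coord W2_open)
    then have "C_inf_on (2 * n) W2 (\<lambda>x. co (f (pt \<epsilon> x)) k)"
      by (rule C_inf_cong[OF W2_open, rotated]) (simp add: ab f pt_in_H)
    then show ?thesis by simp
  qed
qed

lemma diffeo_left_translation:
  assumes phi: "\<phi> \<in> H"
  shows "diffeo MM (left_translation HG \<phi>)"
proof -
  have L: "left_translation HG \<phi> \<psi> = \<phi> \<otimes>\<^bsub>HG\<^esub> \<psi>" if "\<psi> \<in> H" for \<phi> \<psi>
    using that by (simp add: left_translation_def carrier_HG)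
  interpret HG: group HG by (rule group_HG)
  have inv: "inv\<^bsub>HG\<^esub> \<phi> \<in> H" by (rule inv_in_H[OF phi])
  have c: "\<phi> \<in> carrier HG" using phi by (simp add: carrier_HG)
  have 1: "left_translation HG (inv\<^bsub>HG\<^esub> \<phi>) (left_translation HG \<phi> \<psi>) = \<psi>"
    and 2: "left_translation HG \<phi> (left_translation HG (inv\<^bsub>HG\<^esub> \<phi>) \<psi>) = \<psi>" if psi: "\<psi> \<in> H" for \<psi>
  proof -
    have "\<psi> \<in> carrier HG" using psi by (simp add: carrier_HG)
    then show "left_translation HG (inv\<^bsub>HG\<^esub> \<phi>) (left_translation HG \<phi> \<psi>) = \<psi>"
      "left_translation HG \<phi> (left_translation HG (inv\<^bsub>HG\<^esub> \<phi>) \<psi>) = \<psi>"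
      using c by (simp_all add: L psi mult_in_H phi inv HG.m_assoc[symmetric])
  qed
  have bij: "bij_betw (left_translation HG \<phi>) H H"
    by (rule bij_betwI[where g = "left_translation HG (inv\<^bsub>HG\<^esub> \<phi>)"])
       (use 1 2 in \<open>auto simp: L mult_in_H phi inv\<close>)
  have "inv_into H (left_translation HG \<phi>) \<psi> = inv\<^bsub>HG\<^esub> \<phi> \<otimes>\<^bsub>HG\<^esub> \<psi>" if psi: "\<psi> \<in> H" for \<psi>
    by (rule inv_into_f_eq[OF bij_betw_imp_inj_on[OF bij]])
       (use 2[OF psi] psi in \<open>simp_all add: L mult_in_H inv\<close>)
  then have "smooth_map MM MM (inv_into H (left_translation HG \<phi>))"
    by (rule smooth_left_translation[OF inv])
  moreover have "left_translation HG \<phi> \<in> extensional H" by (simp add: left_translation_def carrier_HG)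
  ultimately show ?thesis
    unfolding diffeo_def Bij_def using bij smooth_left_translation[OF phi L] by (simp add: topspace_HT)
qed

lemma left_translation_preserves:
  assumes phi: "\<phi> \<in> H"
  shows "preserves_connection MM MS.flat_conn (left_translation HG \<phi>)"
proof (rule MS.preservesI_affine[OF diffeo_left_translation[OF phi] MS.flat_conn_vf,
      where H = "MS.coord ` {..<2 * n}"])
  show "MS.affine_fun MS.flat_conn h" if "h \<in> MS.coord ` {..<2 * n}" for h
    using that MS.affine_flat_conn_coord by auto
  show "MS.affine_fun MS.flat_conn (pull_fun MM (left_translation HG \<phi>) h)" if h: "h \<in> MS.coord ` {..<2 * n}" for h
  proof -
    obtain k where k: "k < 2 * n" "h = MS.coord k" using h by auto
    have e: "pull_fun MM (left_translation HG \<phi>) h (pt \<epsilon> x) = co (\<phi> \<otimes>\<^bsub>HG\<^esub> pt \<epsilon> x) k" if "x \<in> W2" for \<epsilon> x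
      using pt_in_H[OF that] mult_in_H[OF phi pt_in_H[OF that]]
      by (simp add: pull_fun_def k(2) MS.coord_def left_translation_def carrier_HG topspace_HT)
    show ?thesis
    proof (rule MS.affine_flat_conn_if_affine_in_coordinates)
      show "pull_fun MM (left_translation HG \<phi>) h p = 0" if "p \<notin> points MM" for p
        using that by (simp add: pull_fun_def)
      show "\<exists>a b. \<forall>x\<in>W2. pull_fun MM (left_translation HG \<phi>) h (pt \<epsilon> x) = a + (\<Sum>l<mdim MM. b l * x l)" for \<epsilon>
        using co_left_translation_affine[OF phi k(1), of \<epsilon>] e by simp
    qed
  qed
  show "Z = Z'" if "Z \<in> MS.VF" "Z' \<in> MS.VF" "\<And>h. h \<in> MS.coord ` {..<2 * n} \<Longrightarrow> Z h = Z' h" for Z Z'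
    by (rule MS.vf_eqI[OF that(1,2)]) (use that(3) in auto)
qed

theorem flat_affine_HG: "flat_affine_lie_group HG MM"
  unfolding flat_affine_lie_group_def flat_left_invariant_affine_structure_def
  using lie_group_HG MS.linear_connection_flat_conn MS.flat_flat_conn MS.torsion_free_flat_conn
    left_translation_preserves carrier_HG by blast

end


section \<open>The stabilizers of the three kinds of domains\<close>

lemma stabilizer_iff:
  "c \<in> stabilizer \<Omega> \<longleftrightarrow> c \<in> Eset 6 \<and> cdet c \<noteq> 0 \<and> (\<forall>z. ap c z \<in> \<Omega> \<longleftrightarrow> z \<in> \<Omega>)"
proof -
  have "ap c ` \<Omega> = \<Omega> \<longleftrightarrow> (\<forall>z. ap c z \<in> \<Omega> \<longleftrightarrow> z \<in> \<Omega>)" if d: "cdet c \<noteq> 0"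
  proof
    assume im: "ap c ` \<Omega> = \<Omega>"
    show "\<forall>z. ap c z \<in> \<Omega> \<longleftrightarrow> z \<in> \<Omega>"
    proof (intro allI iffI)
      fix z
      show "ap c z \<in> \<Omega>" if "z \<in> \<Omega>" using imageI[OF that, of "ap c"] unfolding im .
      assume "ap c z \<in> \<Omega>"
      then have "ap c z \<in> ap c ` \<Omega>" unfolding im .
      then obtain w where w: "ap c z = ap c w" "w \<in> \<Omega>" by (rule imageE)
      have "z = w" using arg_cong[OF w(1), of "ap (cinv c)"] unfolding ap_cinv(2)[OF d] .
      then show "z \<in> \<Omega>" using w(2) by simp
    qed
  next
    assume iff: "\<forall>z. ap c z \<in> \<Omega> \<longleftrightarrow> z \<in> \<Omega>"
    show "ap c ` \<Omega> = \<Omega>"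
    proof
      show "\<Omega> \<subseteq> ap c ` \<Omega>"
      proof
        fix z assume "z \<in> \<Omega>"
        then have "ap c (ap (cinv c) z) \<in> \<Omega>" unfolding ap_cinv(1)[OF d] .
        then have "ap (cinv c) z \<in> \<Omega>" using iff by blast
        from imageI[OF this, of "ap c"] show "z \<in> ap c ` \<Omega>" unfolding ap_cinv(1)[OF d] .
      qed
      show "ap c ` \<Omega> \<subseteq> \<Omega>"
      proof (rule image_subsetI)
        show "ap c z \<in> \<Omega>" if "z \<in> \<Omega>" for z using iff that by blast
      qed
    qed
  qed
  then show ?thesis unfolding stabilizer_def by blast
qed

lemma stabilizer_UNIV: "stabilizer UNIV = {c \<in> Eset 6. cdet c \<noteq> 0}"
  by (auto simp: stabilizer_iff)

lemma stabilizer_half_domain: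
  "c \<in> stabilizer half_domain \<longleftrightarrow> c \<in> Eset 6 \<and> c 1 = 0 \<and> c 2 = 0 \<and> 0 < c 0 \<and> c 4 \<noteq> 0"
proof
  assume c: "c \<in> stabilizer half_domain"
  then have iff: "0 < c 0 * x + c 1 * y + c 2 \<longleftrightarrow> 0 < x" for x y
    unfolding stabilizer_iff half_domain_def by (auto simp: ap_def)
  have c1: "c 1 = 0"
  proof (rule ccontr)
    assume n: "c 1 \<noteq> 0"
    then have "c 0 * 1 + c 1 * (- (c 0 + c 2) / c 1) + c 2 = 0" by simp
    then show False using iff[of 1 "- (c 0 + c 2) / c 1"] by linarith
  qed
  have le: "c 2 \<le> 0" using iff[of 0 0] by simp
  have pos: "0 < c 0 + c 2" using iff[of 1 0] by simp
  have "c 2 = 0"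
  proof (rule ccontr)
    assume "c 2 \<noteq> 0"
    then have n: "c 2 < 0" "c 0 > 0" using le pos by auto
    then have "0 < - c 2 / (2 * c 0)" by (intro divide_pos_pos) auto
    moreover have "c 0 * (- c 2 / (2 * c 0)) + c 1 * 0 + c 2 = c 2 / 2" using n by (simp add: field_simps)
    ultimately show False using iff[of "- c 2 / (2 * c 0)" 0] n by simp
  qed
  then show "c \<in> Eset 6 \<and> c 1 = 0 \<and> c 2 = 0 \<and> 0 < c 0 \<and> c 4 \<noteq> 0"
    using c c1 pos by (auto simp: stabilizer_iff cdet_def)
next
  assume "c \<in> Eset 6 \<and> c 1 = 0 \<and> c 2 = 0 \<and> 0 < c 0 \<and> c 4 \<noteq> 0"
  then show "c \<in> stabilizer half_domain"
    unfolding stabilizer_iff half_domain_def by (simp add: cdet_def ap_def zero_less_mult_iff)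
qed

text \<open>
  An affine map that preserves the domain preserves its boundary parabola; comparing coefficients
  in the resulting identity of polynomials determines the map up to two parameters.
\<close>

lemma stabilizer_parabola_domain:
  assumes s: "s \<noteq> 0"
  shows "c \<in> stabilizer (parabola_domain s) \<longleftrightarrow>
    c \<in> Eset 6 \<and> c 1 = 0 \<and> c 0 \<noteq> 0 \<and> c 4 = (c 0)\<^sup>2 \<and> c 3 = 2 * s * c 0 * c 2 \<and> c 5 = s * (c 2)\<^sup>2"
proof
  assume c: "c \<in> stabilizer (parabola_domain s)"
  define P where "P x h = c 3 * x + c 4 * (s * x\<^sup>2 + h) + c 5 - s * (c 0 * x + c 1 * (s * x\<^sup>2 + h) + c 2)\<^sup>2" for x h
  have iff: "0 < P x h \<longleftrightarrow> 0 < h" for x h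
  proof -
    have "ap c (x, s * x\<^sup>2 + h) \<in> parabola_domain s \<longleftrightarrow> (x, s * x\<^sup>2 + h) \<in> parabola_domain s"
      using c by (simp add: stabilizer_iff)
    then show ?thesis by (simp add: P_def parabola_domain_def ap_def)
  qed
  have P0: "P x 0 = 0" for x
  proof -
    have "((\<lambda>h. P x h) \<longlongrightarrow> P x 0) (at_right 0)"
      unfolding P_def by (intro tendsto_intros)
    moreover have "eventually (\<lambda>h. 0 \<le> P x h) (at_right 0)"
      using eventually_at_right_less[of "0::real"] by eventually_elim (use iff less_imp_le in blast)
    ultimately have "0 \<le> P x 0" by (intro tendsto_lowerbound) auto
    then show ?thesis using iff[of x 0] by simp
  qed
  \<comment> \<open>The fourth difference isolates the leading coefficient.\<close>
  have "P 2 0 + P (-2) 0 - 4 * (P 1 0 + P (-1) 0) + 6 * P 0 0 = - 24 * s * (c 1 * s)\<^sup>2"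
    by (simp add: P_def power2_eq_square algebra_simps)
  then have c1: "c 1 = 0" using s by (simp add: P0)
  have c1': "c (Suc 0) = 0" using c1 by simp
  have e: "c 5 = s * (c 2)\<^sup>2" "c 3 + c 4 * s + c 5 = s * (c 0 + c 2)\<^sup>2" "- c 3 + c 4 * s + c 5 = s * (- c 0 + c 2)\<^sup>2"
    using P0[of 0] P0[of 1] P0[of "-1"] by (simp_all add: P_def c1')
  have "2 * (s * (c 4 - (c 0)\<^sup>2)) = 0" using e by algebra
  then have c4: "c 4 = (c 0)\<^sup>2" using s by simp
  have "2 * (c 3 - 2 * s * c 0 * c 2) = 0" using e by algebra
  then have c3: "c 3 = 2 * s * c 0 * c 2" by simp
  have "c 0 \<noteq> 0" using c c1 by (auto simp: stabilizer_iff cdet_def)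
  then show "c \<in> Eset 6 \<and> c 1 = 0 \<and> c 0 \<noteq> 0 \<and> c 4 = (c 0)\<^sup>2 \<and> c 3 = 2 * s * c 0 * c 2 \<and> c 5 = s * (c 2)\<^sup>2"
    using c c1 c3 c4 e(1) by (simp add: stabilizer_iff)
next
  assume c: "c \<in> Eset 6 \<and> c 1 = 0 \<and> c 0 \<noteq> 0 \<and> c 4 = (c 0)\<^sup>2 \<and> c 3 = 2 * s * c 0 * c 2 \<and> c 5 = s * (c 2)\<^sup>2"
  have "ap c z \<in> parabola_domain s \<longleftrightarrow> z \<in> parabola_domain s" for z
  proof -
    have "snd (ap c z) - s * (fst (ap c z))\<^sup>2 = (c 0)\<^sup>2 * (snd z - s * (fst z)\<^sup>2)"
      using c by (simp add: ap_def power2_eq_square algebra_simps)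
    then have "0 < snd (ap c z) - s * (fst (ap c z))\<^sup>2 \<longleftrightarrow> 0 < snd z - s * (fst z)\<^sup>2"
      using c by (simp only:) (simp add: zero_less_mult_iff)
    then show ?thesis by (simp add: parabola_domain_def)
  qed
  then show "c \<in> stabilizer (parabola_domain s)" using c by (simp add: stabilizer_iff cdet_def)
qed


subsection \<open>Coordinates on the stabilizers\<close>

lemma sum_lessThan_6: "(\<Sum>j<6. f j) = f 0 + f 1 + f 2 + f 3 + f 4 + f (5::nat)" for f :: "nat \<Rightarrow> real"
  by (simp add: eval_nat_numeral)

lemma sum_lessThan_4: "(\<Sum>j<4. f j) = f 0 + f 1 + f 2 + f (3::nat)" for f :: "nat \<Rightarrow> real"
  by (simp add: eval_nat_numeral)

lemma coordinatized_UNIV: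
  assumes "developed D UNIV F1 F2 K"
  shows "coordinatized D UNIV F1 F2 K 6 (\<lambda>k. k) (\<lambda>u. u) {u \<in> Eset 6. cdet u \<noteq> 0}"
proof -
  have E: "openin (Euclidean_space 6) (Eset 6)" by (simp add: Euclidean_space_top_of_set)
  have r: "(\<lambda>k. if k < 6 then c k else 0) = c" if "c \<in> Eset 6" for c using that by (auto simp: not_less)
  have o: "openin (Euclidean_space 6) {u \<in> Eset 6. cdet u \<noteq> 0}"
  proof -
    have "continuous_on (Eset 6) cdet"
      unfolding cdet_def
      by (intro continuous_intros continuous_on_product_then_coordinatewise[OF continuous_on_id])
    moreover have "open (- {0::real})" by (simp add: open_Compl)
    ultimately have "openin (Euclidean_space 6) {u \<in> Eset 6. cdet u \<in> - {0}}"
      by (rule openin_Euclidean_preimage[OF E])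
    then show ?thesis by simp
  qed
  show ?thesis
  proof (rule coordinatized.intro[OF assms], unfold_locales)
    fix c k assume c: "c \<in> stabilizer UNIV" and k: "k < (6::nat)"
    have row_sum: "(\<Sum>j<6. row a b p d e f j * u j) = a * u 0 + b * u 1 + p * u 2 + d * u 3 + e * u 4 + f * u 5"
      for a b p d e f and u :: "nat \<Rightarrow> real" by (simp add: sum_lessThan_6)
    consider "k = 0" | "k = 1" | "k = 2" | "k = 3" | "k = 4" | "k = 5" using k by linarith
    then show "\<exists>a b. \<forall>u\<in>{u \<in> Eset 6. cdet u \<noteq> 0}. cmul c u k = a + (\<Sum>j<6. b j * u j)"
    proof cases
      case 1 then show ?thesis by (intro exI[of _ 0] exI[of _ "row (c 0) 0 0 (c 1) 0 0"]) (simp add: row_sum cmul_def)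
    next
      case 2 then show ?thesis by (intro exI[of _ 0] exI[of _ "row 0 (c 0) 0 0 (c 1) 0"]) (simp add: row_sum cmul_def)
    next
      case 3 then show ?thesis by (intro exI[of _ "c 2"] exI[of _ "row 0 0 (c 0) 0 0 (c 1)"]) (simp add: row_sum cmul_def)
    next
      case 4 then show ?thesis by (intro exI[of _ 0] exI[of _ "row (c 3) 0 0 (c 4) 0 0"]) (simp add: row_sum cmul_def)
    next
      case 5 then show ?thesis by (intro exI[of _ 0] exI[of _ "row 0 (c 3) 0 0 (c 4) 0"]) (simp add: row_sum cmul_def)
    next
      case 6 then show ?thesis by (intro exI[of _ "c 5"] exI[of _ "row 0 0 (c 3) 0 0 (c 4)"]) (simp add: row_sum cmul_def)
    qed
  qed (use o r in \<open>auto simp: stabilizer_UNIV intro: C_inf_coord\<close>)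
qed

lemma coordinatized_half_domain:
  assumes "developed D half_domain F1 F2 K"
  shows "coordinatized D half_domain F1 F2 K 4 (\<lambda>k. if k = 0 then 0 else if k = 1 then 3 else if k = 2 then 4 else 5)
    (\<lambda>u. row (u 0) 0 0 (u 1) (u 2) (u 3)) {u \<in> Eset 4. 0 < u 0 \<and> u 2 \<noteq> 0}"
proof -
  let ?W = "{u \<in> Eset 4. 0 < u 0 \<and> u 2 \<noteq> 0}"
  let ?e = "\<lambda>u :: nat \<Rightarrow> real. row (u 0) 0 0 (u 1) (u 2) (u 3)"
  let ?s = "\<lambda>k::nat. if k = 0 then 0 else if k = 1 then 3 else if k = 2 then 4 else 5"
  have E: "openin (Euclidean_space 4) (Eset 4)" by (simp add: Euclidean_space_top_of_set)
  have o: "openin (Euclidean_space 4) ?W"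
  proof -
    have c: "continuous_on (Eset 4) (\<lambda>u. (u 0, u 2))"
      by (intro continuous_intros continuous_on_product_then_coordinatewise[OF continuous_on_id])
    have "open ({0<..} \<times> - {0::real} :: (real \<times> real) set)" by (intro open_Times) auto
    from openin_Euclidean_preimage[OF E c this] show ?thesis by (simp add: mem_Times_iff)
  qed
  show ?thesis
  proof (rule coordinatized.intro[OF assms], unfold_locales)
    show "openin (Euclidean_space 4) ?W" by (rule o)
    show "?e u \<in> stabilizer half_domain" if "u \<in> ?W" for u
      using that row_Eset by (simp add: stabilizer_half_domain)
    fix c assume c: "c \<in> stabilizer half_domain"
    show "(\<lambda>k. if k < 4 then c (?s k) else 0) \<in> ?W"
      using c by (simp add: stabilizer_half_domain)
    show "?e (\<lambda>k. if k < 4 then c (?s k) else 0) = c"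
      by (rule Eset_6_eqI[OF row_Eset]) (use c in \<open>simp_all add: stabilizer_half_domain\<close>)
    fix k :: nat assume k: "k < 4"
    have c1: "c 1 = 0" "c (Suc 0) = 0" using c by (simp_all add: stabilizer_half_domain)
    have row_sum: "(\<Sum>j<4. row a b p d 0 0 j * u j) = a * u 0 + b * u 1 + p * u 2 + d * u 3"
      for a b p d and u :: "nat \<Rightarrow> real" by (simp add: sum_lessThan_4)
    consider "k = 0" | "k = 1" | "k = 2" | "k = 3" using k by linarith
    then show "\<exists>a b. \<forall>u\<in>?W. cmul c (?e u) (?s k) = a + (\<Sum>j<4. b j * u j)"
    proof cases
      case 1 then show ?thesis by (intro exI[of _ 0] exI[of _ "row (c 0) 0 0 0 0 0"]) (simp add: row_sum cmul_def c1)
    next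
      case 2 then show ?thesis by (intro exI[of _ 0] exI[of _ "row (c 3) (c 4) 0 0 0 0"]) (simp add: row_sum cmul_def c1)
    next
      case 3 then show ?thesis by (intro exI[of _ 0] exI[of _ "row 0 0 (c 4) 0 0 0"]) (simp add: row_sum cmul_def c1)
    next
      case 4 then show ?thesis by (intro exI[of _ "c 5"] exI[of _ "row 0 0 0 (c 4) 0 0"]) (simp add: row_sum cmul_def c1)
    qed
  next
    fix u :: "nat \<Rightarrow> real" assume u: "u \<in> ?W"
    show "(\<lambda>k. if k < 4 then ?e u (?s k) else 0) = u"
    proof
      fix k :: nat
      consider "k = 0" | "k = 1" | "k = 2" | "k = 3" | "k \<ge> 4" by linarith
      then show "(if k < 4 then ?e u (?s k) else 0) = u k" by cases (use u in auto)
    qed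
  next
    show "C_inf_on 4 ?W (\<lambda>u. ?e u j)" for j by (intro C_inf_row C_inf_const C_inf_coord o)
  qed
qed

lemma coordinatized_parabola_domain:
  assumes "developed D (parabola_domain s) F1 F2 K" and s: "s \<noteq> 0"
  shows "coordinatized D (parabola_domain s) F1 F2 K 2 (\<lambda>k. if k = 0 then 0 else 2)
    (\<lambda>u. row (u 0) 0 (u 1) (2 * s * u 0 * u 1) ((u 0)\<^sup>2) (s * (u 1)\<^sup>2)) {u \<in> Eset 2. u 0 \<noteq> 0}"
proof -
  let ?W = "{u \<in> Eset 2. u 0 \<noteq> 0}"
  let ?e = "\<lambda>u :: nat \<Rightarrow> real. row (u 0) 0 (u 1) (2 * s * u 0 * u 1) ((u 0)\<^sup>2) (s * (u 1)\<^sup>2)"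
  let ?s = "\<lambda>k::nat. if k = 0 then 0 else 2::nat"
  note st = stabilizer_parabola_domain[OF s]
  have o: "openin (Euclidean_space 2) ?W" using gW_open by (simp add: gW_def)
  show ?thesis
  proof (rule coordinatized.intro[OF assms(1)], unfold_locales)
    show "openin (Euclidean_space 2) ?W" by (rule o)
    show "?e u \<in> stabilizer (parabola_domain s)" if "u \<in> ?W" for u
      unfolding st using that by (intro conjI row_Eset) simp_all
    fix c assume c: "c \<in> stabilizer (parabola_domain s)"
    show "(\<lambda>k. if k < 2 then c (?s k) else 0) \<in> ?W"
      using c by (simp add: st)
    show "?e (\<lambda>k. if k < 2 then c (?s k) else 0) = c"
      by (rule Eset_6_eqI[OF row_Eset]) (use c in \<open>simp_all add: st\<close>)
    fix k :: nat assume k: "k < 2"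
    have c1: "c 1 = 0" "c (Suc 0) = 0" using c by (simp_all add: st)
    show "\<exists>a b. \<forall>u\<in>?W. cmul c (?e u) (?s k) = a + (\<Sum>j<2. b j * u j)"
    proof (cases "k = 0")
      case True
      then show ?thesis by (intro exI[of _ 0] exI[of _ "row (c 0) 0 0 0 0 0"]) (simp add: sum_2 cmul_def c1)
    next
      case False
      then show ?thesis using k
        by (intro exI[of _ "c 2"] exI[of _ "row 0 (c 0) 0 0 0 0"]) (simp add: sum_2 cmul_def c1)
    qed
  next
    fix u :: "nat \<Rightarrow> real" assume u: "u \<in> ?W"
    show "(\<lambda>k. if k < 2 then ?e u (?s k) else 0) = u"
    proof
      fix k :: nat
      consider "k = 0" | "k = 1" | "k \<ge> 2" by linarith
      then show "(if k < 2 then ?e u (?s k) else 0) = u k" by cases (use u in auto)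
    qed
  next
    show "C_inf_on 2 ?W (\<lambda>u. ?e u j)" for j by (intro C_inf_row C_inf_mult C_inf_power C_inf_const C_inf_coord o)
  qed
qed


section \<open>The affine transformations form a flat affine Lie group\<close>

theorem theorem23:
  fixes D :: "(real \<times> real) vfield \<Rightarrow> (real \<times> real) vfield \<Rightarrow> (real \<times> real) vfield"
  assumes "flat_left_invariant_affine_structure Aff_line Aff_line_manifold D"
  shows "\<exists>M. mtop M = affine_group_topology Aff_line_manifold D \<and>
             flat_affine_lie_group (affine_group Aff_line_manifold D) M"
proof -
  interpret flat_structure D by (rule flat_structure.intro) (rule assms)
  obtain \<Omega> F1 F2 K where \<Omega>: "\<Omega> = UNIV \<or> \<Omega> = half_domain \<or> (\<exists>s. s \<noteq> 0 \<and> \<Omega> = parabola_domain s)"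
    and dev: "developing_pair \<Omega> F1 F2 K" "G.affine_fun D (ext F1)" "G.affine_fun D (ext F2)"
    "\<And>p. fst p \<noteq> 0 \<Longrightarrow> E 0 (ext F1) p * E (Suc 0) (ext F2) p - E (Suc 0) (ext F1) p * E 0 (ext F2) p \<noteq> 0"
    by (rule developing_pair_exists) (rule that)
  have d: "developed D \<Omega> F1 F2 K" by unfold_locales (fact dev)+
  have "\<exists>n sel expand WA. coordinatized D \<Omega> F1 F2 K n sel expand WA"
    using \<Omega>
  proof (elim disjE exE conjE)
    assume "\<Omega> = UNIV"
    then show ?thesis using coordinatized_UNIV d by blast
  next
    assume "\<Omega> = half_domain"
    then show ?thesis using coordinatized_half_domain d by blast
  next
    fix s assume s: "s \<noteq> 0" "\<Omega> = parabola_domain s"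
    then show ?thesis using coordinatized_parabola_domain[OF d[unfolded s(2)] s(1)] by blast
  qed
  then obtain n sel expand WA where "coordinatized D \<Omega> F1 F2 K n sel expand WA" by blast
  then interpret coordinatized D \<Omega> F1 F2 K n sel expand WA .
  show ?thesis using flat_affine_HG MM_simps(2) by blast
qed

end
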